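(* Let $\mathbf C$ be a connected component of $\mathscr C$ such that $\mathring{\mathbf C}\neq\emptyset$ and $\mathbf C\neq\Omega_p$. Then $\partial\mathbf C\cap\partial\Omega_p$ has at most two connected components and: (i) if $\partial\mathbf C\cap\partial\Omega_p$ has exactly two connected components, then $\partial^c\mathbf C=\emptyset$ and all characteristic lines $L_z$, $z\in\mathbf C$, that intersect $\partial\mathbf C\cap\partial\Omega_p$ must intersect both connected components; (ii) if $\partial\mathbf C\cap\partial\Omega_p$ is connected, then $\partial^c\mathbf C$ is either a point or a closed line segment contained in $\partial\mathbf C\cap\partial\Omega_p$, the set $(\partial\mathbf C\cap\partial\Omega_p)\setminus\partial^c\mathbf C$ has two connected components, and all characteristic lines $L_z$, $z\in\mathbf C$, that intersect $\partial\mathbf C\cap\partial\Omega_p$ must intersect both connected components of $(\partial\mathbf C\cap\partial\Omega_p)\setminus\partial^c\mathbf C$.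
   Context: Setting. $\Omega\subset\mathbb{R}^2$ is a bounded open set with Lipschitz boundary and outer unit normal $\nu$, $w\in H^1(\Omega)$, and $(u,\sigma,p)$ is a minimizer of $\frac12\int_\Omega|\sigma|^2dx+|p|(\overline\Omega)$ over all $(u,\sigma,p)\in BV(\Omega)\times L^2(\Omega;\mathbb{R}^2)\times\mathcal M(\overline\Omega;\mathbb{R}^2)$ with $Du=\sigma+p$ in $\Omega$ and $p=(w-u)\nu\mathcal H^1$ on $\partial\Omega$. The field $\sigma$ is unique, lies in $H^1_{\rm loc}(\Omega;\mathbb{R}^2)$, and satisfies $\operatorname{div}\sigma=0$, $|\sigma|\le1$. Standing hypothesis: $\Omega_p\subset\Omega$ is a nonempty convex open set with $|\sigma|=1$ a.e. on $\Omega_p$; then $\sigma$ has a locally Lipschitz representative on $\Omega_p$, which is used throughout. For $z=(z_1,z_2)$, $z^\perp=(-z_2,z_1)$. For $x\in\Omega_p$, $L_x:=x+\mathbb{R}\sigma^\perp(x)$ is the characteristic line through $x$; $\sigma$ is constant on $L_x\cap\Omega_p$, and two distinct characteristic lines do not meet inside $\Omega_p$. Fans. $\mathcal F$ is the set of $\bar z\in\partial\Omega_p$ for which there are $x\neq y$ in $\Omega_p$ with $L_x\cap L_y=\{\bar z\}$. For $\bar z\in\mathcal F$, $\mathbf F_{\bar z}:=\operatorname{int}\{z\in\Omega_p:\bar z\in L_z\}$ is the boundary fan with apex $\bar z$. Set $\mathscr C:=\Omega_p\setminus\bigcup_{\bar z\in\mathcal F}\mathbf F_{\bar z}$. Boundaries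 and interiors are taken in $\mathbb{R}^2$. Characteristic boundary points. For a connected component $\mathbf C$ of $\mathscr C$ with nonempty interior, $\partial^c\mathbf C$ is the set of all $x\in\partial\mathbf C\cap\partial\Omega_p$ such that $x\notin L_z$ for all $z\in\mathbf C$. *)

theory Defs
  imports "HOL-Analysis.Analysis"
begin

section \<open>One-dimensional Hausdorff measure in the plane\<close>

text \<open>The library's diameter of an unbounded set is a junk value, so coverings are restricted
  to bounded sets.\<close>

definition hausdorff_pre :: "real \<Rightarrow> (real^2) set \<Rightarrow> ennreal" where
  "hausdorff_pre \<delta> A =
     (INF U\<in>{U :: nat \<Rightarrow> (real^2) set. A \<subseteq> (\<Union>i. U i) \<and> (\<forall>i. bounded (U i) \<and> diameter (U i) \<le> \<delta>)}.
        \<Sum>i. ennreal (diameter (U i)))"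

definition hausdorff1_outer :: "(real^2) set \<Rightarrow> ennreal" where
  "hausdorff1_outer A = (SUP \<delta>\<in>{0<..}. hausdorff_pre \<delta> A)"

text \<open>A metric outer measure is countably additive on the Borel sets (Caratheodory), so
  the measure below is the outer measure on every Borel set.\<close>

definition hausdorff1 :: "(real^2) measure" where
  "hausdorff1 = measure_of UNIV (sets borel) hausdorff1_outer"


section \<open>Bounded vector measures\<close>

text \<open>An element of the space of bounded \<open>\<real>\<^sup>2\<close>-valued Radon measures on a Borel set
  \<open>S\<close> is a set function of which only the values on Borel subsets of \<open>S\<close> matter.\<close>

definition total_variation :: "(real^2) set \<Rightarrow> ((real^2) set \<Rightarrow> real^2) \<Rightarrow> ennreal" where
  "total_variation S \<mu> =
     (SUP P\<in>{P. finite P \<and> disjoint P \<and> (\<forall>B\<in>P. B \<in> sets borel \<and> B \<subseteq> S)}.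
        ennreal (\<Sum>B\<in>P. norm (\<mu> B)))"

definition vector_measure_on :: "(real^2) set \<Rightarrow> ((real^2) set \<Rightarrow> real^2) \<Rightarrow> bool" where
  "vector_measure_on S \<mu> \<longleftrightarrow>
     (\<forall>A :: nat \<Rightarrow> (real^2) set. range A \<subseteq> {B \<in> sets borel. B \<subseteq> S} \<longrightarrow> disjoint_family A \<longrightarrow>
        (\<lambda>i. \<mu> (A i)) sums \<mu> (\<Union>i. A i)) \<and>
     total_variation S \<mu> < \<infinity>"

text \<open>Positive part in the Jordan decomposition of a signed measure \<open>m\<close> on \<open>S\<close>; the negative part is
  the positive part of \<open>-m\<close>. The competitor \<open>A = {}\<close> makes the supremum nonnegative.\<close>

definition positive_part :: "(real^2) set \<Rightarrow> ((real^2) set \<Rightarrow> real) \<Rightarrow> (real^2) measure" where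
  "positive_part S m =
     measure_of S (sets (restrict_space borel S))
       (\<lambda>B. SUP A\<in>{A \<in> sets borel. A \<subseteq> B}. ennreal (m A))"

definition vector_measure_integral ::
    "(real^2) set \<Rightarrow> ((real^2) set \<Rightarrow> real^2) \<Rightarrow> (real^2 \<Rightarrow> real) \<Rightarrow> real^2" where
  "vector_measure_integral S \<mu> \<phi> =
     (\<chi> i. (LINT x|positive_part S (\<lambda>B. \<mu> B $ i). \<phi> x) -
           (LINT x|positive_part S (\<lambda>B. - (\<mu> B $ i)). \<phi> x))"


section \<open>Function spaces\<close>

definition gradient :: "(real^2 \<Rightarrow> real) \<Rightarrow> real^2 \<Rightarrow> real^2" where
  "gradient \<phi> x = (\<chi> i. frechet_derivative \<phi> (at x) (axis i 1))"

definition divergence :: "(real^2 \<Rightarrow> real^2) \<Rightarrow> real^2 \<Rightarrow> real" where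
  "divergence \<phi> x = (\<Sum>i\<in>UNIV. gradient (\<lambda>y. \<phi> y $ i) x $ i)"

text \<open>Test functions, \<open>C\<^sup>1\<close> with compact support in \<open>\<Omega>\<close>, extended by zero to the plane.\<close>

definition test_function :: "(real^2) set \<Rightarrow> (real^2 \<Rightarrow> real) \<Rightarrow> bool" where
  "test_function \<Omega> \<phi> \<longleftrightarrow>
     (\<forall>x. \<phi> differentiable (at x)) \<and> continuous_on UNIV (gradient \<phi>) \<and>
     (\<exists>K. compact K \<and> K \<subseteq> \<Omega> \<and> (\<forall>x. x \<notin> K \<longrightarrow> \<phi> x = 0))"

definition square_integrable_on :: "(real^2) set \<Rightarrow> (real^2 \<Rightarrow> 'a::euclidean_space) \<Rightarrow> bool" where
  "square_integrable_on \<Omega> f \<longleftrightarrow>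
     f \<in> borel_measurable (lebesgue_on \<Omega>) \<and> integrable (lebesgue_on \<Omega>) (\<lambda>x. (norm (f x))\<^sup>2)"

definition weak_gradient :: "(real^2) set \<Rightarrow> (real^2 \<Rightarrow> real) \<Rightarrow> (real^2 \<Rightarrow> real^2) \<Rightarrow> bool" where
  "weak_gradient \<Omega> w g \<longleftrightarrow>
     (\<forall>\<phi>. test_function \<Omega> \<phi> \<longrightarrow>
        (LINT x|lebesgue_on \<Omega>. w x *\<^sub>R gradient \<phi> x) = - (LINT x|lebesgue_on \<Omega>. \<phi> x *\<^sub>R g x))"

definition H1_space :: "(real^2) set \<Rightarrow> (real^2 \<Rightarrow> real) \<Rightarrow> bool" where
  "H1_space \<Omega> w \<longleftrightarrow>
     square_integrable_on \<Omega> w \<and> (\<exists>g. square_integrable_on \<Omega> g \<and> weak_gradient \<Omega> w g)"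

definition BV_space :: "(real^2) set \<Rightarrow> (real^2 \<Rightarrow> real) \<Rightarrow> bool" where
  "BV_space \<Omega> u \<longleftrightarrow>
     integrable (lebesgue_on \<Omega>) u \<and>
     bdd_above {LINT x|lebesgue_on \<Omega>. u x * divergence \<phi> x | \<phi>.
       (\<forall>i. test_function \<Omega> (\<lambda>x. \<phi> x $ i)) \<and> (\<forall>x. norm (\<phi> x) \<le> 1)}"


section \<open>Lipschitz domains and traces\<close>

definition lipschitz_boundary :: "(real^2) set \<Rightarrow> bool" where
  "lipschitz_boundary \<Omega> \<longleftrightarrow>
     (\<forall>x\<in>frontier \<Omega>. \<exists>(R :: real^2 \<Rightarrow> real^2) \<gamma> L r. orthogonal_transformation R \<and> L-lipschitz_on UNIV (\<gamma> :: real \<Rightarrow> real) \<and> r > 0 \<and>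
        (\<forall>y\<in>ball x r. y \<in> \<Omega> \<longleftrightarrow> \<gamma> (R y $ 1) < R y $ 2))"

text \<open>\<open>n\<close> is the outer unit normal at \<open>x\<close> if, near \<open>x\<close>, every cone about \<open>n\<close> of opening less than a half
  plane lies outside \<open>\<Omega>\<close> and the opposite cone lies inside. For a Lipschitz graph this is the classical
  normal, which exists at each differentiability point of the graph.\<close>

definition outer_unit_normal_at :: "(real^2) set \<Rightarrow> real^2 \<Rightarrow> real^2 \<Rightarrow> bool" where
  "outer_unit_normal_at \<Omega> x n \<longleftrightarrow>
     norm n = 1 \<and>
     (\<forall>e>0. \<forall>\<^sub>F y in at x.
        ((y - x) \<bullet> n > e * norm (y - x) \<longrightarrow> y \<notin> \<Omega>) \<and>
        ((y - x) \<bullet> n < - e * norm (y - x) \<longrightarrow> y \<in> \<Omega>))"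

definition outer_unit_normal :: "(real^2) set \<Rightarrow> (real^2 \<Rightarrow> real^2) \<Rightarrow> bool" where
  "outer_unit_normal \<Omega> \<nu> \<longleftrightarrow>
     \<nu> \<in> borel_measurable borel \<and>
     (AE x in hausdorff1. x \<in> frontier \<Omega> \<longrightarrow> outer_unit_normal_at \<Omega> x (\<nu> x))"

definition boundary_trace :: "(real^2) set \<Rightarrow> (real^2 \<Rightarrow> real) \<Rightarrow> (real^2 \<Rightarrow> real) \<Rightarrow> bool" where
  "boundary_trace \<Omega> u t \<longleftrightarrow>
     set_integrable hausdorff1 (frontier \<Omega>) t \<and>
     (AE x in hausdorff1. x \<in> frontier \<Omega> \<longrightarrow>
        ((\<lambda>r. (LINT y|lebesgue_on (\<Omega> \<inter> ball x r). \<bar>u y - t x\<bar>) / r\<^sup>2) \<longlongrightarrow> 0) (at_right 0))"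


section \<open>The minimization problem\<close>

text \<open>The equation \<open>Du = \<sigma> + p\<close> in \<open>\<Omega>\<close> is read in the sense of distributions, with \<open>\<sigma>\<close> standing for
  the measure of density \<open>\<sigma>\<close>.\<close>

definition admissible ::
    "(real^2) set \<Rightarrow> (real^2 \<Rightarrow> real^2) \<Rightarrow> (real^2 \<Rightarrow> real) \<Rightarrow>
     (real^2 \<Rightarrow> real) \<Rightarrow> (real^2 \<Rightarrow> real^2) \<Rightarrow> ((real^2) set \<Rightarrow> real^2) \<Rightarrow> bool" where
  "admissible \<Omega> \<nu> w u \<sigma> p \<longleftrightarrow>
     BV_space \<Omega> u \<and> square_integrable_on \<Omega> \<sigma> \<and> vector_measure_on (closure \<Omega>) p \<and>
     (\<forall>\<phi>. test_function \<Omega> \<phi> \<longrightarrow>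
        (LINT x|lebesgue_on \<Omega>. u x *\<^sub>R gradient \<phi> x) =
        - ((LINT x|lebesgue_on \<Omega>. \<phi> x *\<^sub>R \<sigma> x) + vector_measure_integral \<Omega> p \<phi>)) \<and>
     (\<exists>tu tw. boundary_trace \<Omega> u tu \<and> boundary_trace \<Omega> w tw \<and>
        (\<forall>B\<in>sets borel. B \<subseteq> frontier \<Omega> \<longrightarrow>
           p B = (LINT x:B|hausdorff1. (tw x - tu x) *\<^sub>R \<nu> x)))"

definition energy ::
    "(real^2) set \<Rightarrow> (real^2 \<Rightarrow> real^2) \<Rightarrow> ((real^2) set \<Rightarrow> real^2) \<Rightarrow> ennreal" where
  "energy \<Omega> \<sigma> p =
     ennreal (1/2) * (\<integral>\<^sup>+x. ennreal ((norm (\<sigma> x))\<^sup>2) \<partial>lebesgue_on \<Omega>) + total_variation (closure \<Omega>) p"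

definition minimizer ::
    "(real^2) set \<Rightarrow> (real^2 \<Rightarrow> real^2) \<Rightarrow> (real^2 \<Rightarrow> real) \<Rightarrow>
     (real^2 \<Rightarrow> real) \<Rightarrow> (real^2 \<Rightarrow> real^2) \<Rightarrow> ((real^2) set \<Rightarrow> real^2) \<Rightarrow> bool" where
  "minimizer \<Omega> \<nu> w u \<sigma> p \<longleftrightarrow>
     admissible \<Omega> \<nu> w u \<sigma> p \<and>
     (\<forall>v \<tau> q. admissible \<Omega> \<nu> w v \<tau> q \<longrightarrow> energy \<Omega> \<sigma> p \<le> energy \<Omega> \<tau> q)"


section \<open>Characteristic lines and fans\<close>

text \<open>Below, \<open>P\<close> is the convex open set on which the field has unit length and \<open>s\<close> is the
  locally Lipschitz representative of the field there.\<close>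

definition perp :: "real^2 \<Rightarrow> real^2" where
  "perp z = vector [- (z $ 2), z $ 1]"

definition char_line :: "(real^2 \<Rightarrow> real^2) \<Rightarrow> real^2 \<Rightarrow> (real^2) set" where
  "char_line s x = {x + t *\<^sub>R perp (s x) | t. True}"

definition fan_apexes :: "(real^2) set \<Rightarrow> (real^2 \<Rightarrow> real^2) \<Rightarrow> (real^2) set" where
  "fan_apexes P s =
     {z \<in> frontier P. \<exists>x\<in>P. \<exists>y\<in>P. x \<noteq> y \<and> char_line s x \<inter> char_line s y = {z}}"

definition boundary_fan :: "(real^2) set \<Rightarrow> (real^2 \<Rightarrow> real^2) \<Rightarrow> real^2 \<Rightarrow> (real^2) set" where
  "boundary_fan P s a = interior {z \<in> P. a \<in> char_line s z}"

definition fan_complement :: "(real^2) set \<Rightarrow> (real^2 \<Rightarrow> real^2) \<Rightarrow> (real^2) set" where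
  "fan_complement P s = P - (\<Union>a\<in>fan_apexes P s. boundary_fan P s a)"

definition char_boundary :: "(real^2) set \<Rightarrow> (real^2 \<Rightarrow> real^2) \<Rightarrow> (real^2) set \<Rightarrow> (real^2) set" where
  "char_boundary P s C = {x \<in> frontier C \<inter> frontier P. \<forall>z\<in>C. x \<notin> char_line s z}"

end

theory Submission
  imports Defs
begin

text \<open>Varying the minimizer in the directions \<open>(\<phi>, \<nabla>\<phi>, 0)\<close> shows that the stress is divergence free, so on
  the convex set where it has unit length its rotation is locally the gradient of a solution of the
  eikonal equation. Such a solution is affine with slope one along its gradient lines, whence the
  field is constant on characteristic chords. The chords are then totally ordered: \<open>a\<close> precedes \<open>y\<close> if
  \<open>(y - a) \<bullet> s a > 0\<close>, which excludes \<open>(a - y) \<bullet> s y > 0\<close> by connectedness of half planes in the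
  convex set. A component of the fan complement is a closed interval of this order. If it has two
  extreme chords, its boundary consists of the two curves traced by the endpoints of its chords. If
  it has only one, the chords escape to the compact convex set of boundary points lying beyond all
  of them; this is the characteristic boundary, as a chord ending there would create a fan.\<close>

subsection \<open>Planar preliminaries\<close>

text \<open>Constancy along chords is obtained without following an ODE: for a function whose
  gradient has length one, the Lipschitz bound and an extremal point on a sphere already force an
  affine segment. What remains is driven by one function, the signed distance
  \<open>side s a y\<close> from \<open>y\<close> to the line of \<open>a\<close>. It is affine in
  \<open>y\<close>, so its half planes in \<open>P\<close> are convex, and continuous in
  \<open>a\<close>; hence it keeps its sign on connected sets that avoid its zeros. Antisymmetry,
  transitivity and the location of boundary points are all instances of this. The endpoint curves
  are never parametrised as arcs. Each is the image of the connected set \<open>C\<close> under a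
  continuous map, and the two are kept apart by a single straight line that every chord of
  \<open>C\<close> crosses inside \<open>P\<close>. When the chords escape to the boundary such a
  line still exists, as one of its points may be taken in the set to which they escape. Replacing
  \<open>s\<close> by \<open>- s\<close> keeps the chords, reverses their order and swaps their
  endpoints, so one end and one direction suffice throughout.\<close>

lemma perp_nth [simp]: "perp v $ 1 = - (v $ 2)" "perp v $ 2 = v $ 1"
  by (simp_all add: perp_def)

lemma inner_vec2: "(a :: real^2) \<bullet> b = a $ 1 * b $ 1 + a $ 2 * b $ 2"
  by (simp add: inner_vec_def sum_2)

lemma perp_inner_self [simp]: "perp v \<bullet> v = 0" "v \<bullet> perp v = 0"
  by (simp_all add: inner_vec2)

lemma perp_inner_perp [simp]: "perp a \<bullet> perp b = a \<bullet> b"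
  by (simp add: inner_vec2)

lemma perp_eq_iff [simp]: "perp a = perp b \<longleftrightarrow> a = b"
  by (auto simp: vec_eq_iff forall_2)

lemma perp_minus: "perp (- v) = - perp v"
  by (simp add: vec_eq_iff forall_2)

lemma norm_perp [simp]: "norm (perp v) = norm v"
  by (simp add: norm_eq_sqrt_inner)

lemma continuous_on_perp [continuous_intros]:
  assumes "continuous_on S f"
  shows "continuous_on S (\<lambda>x. perp (f x))"
proof -
  have "perp = (\<lambda>z. (- (z $ 2)) *\<^sub>R axis 1 1 + (z $ 1) *\<^sub>R axis 2 1)"
    by (auto simp: fun_eq_iff vec_eq_iff forall_2 axis_def)
  then have "continuous_on UNIV perp"
    by (rule ssubst) (intro continuous_intros)
  then show ?thesis
    using assms by (rule continuous_on_compose2) auto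
qed

lemma unit_frame_decomposition:
  assumes "norm (v :: real^2) = 1"
  shows "x = (x \<bullet> v) *\<^sub>R v + (x \<bullet> perp v) *\<^sub>R perp v"
proof -
  have "v \<bullet> v = 1" using assms by (simp add: dot_square_norm)
  then have v: "v $ 1 * v $ 1 + v $ 2 * v $ 2 = 1" by (simp add: inner_vec2)
  have a: "x $ 1 * (v $ 1 * v $ 1 + v $ 2 * v $ 2) = x $ 1"
    and b: "x $ 2 * (v $ 1 * v $ 1 + v $ 2 * v $ 2) = x $ 2"
    by (simp_all add: v)
  from a b show ?thesis
    by (simp add: vec_eq_iff forall_2 inner_vec2 algebra_simps)
qed

text \<open>A connected subset of the union on which \<open>g\<close> never vanishes cannot meet
  both pieces, so each piece is maximal. The function \<open>g\<close> will be the signed distance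
  to a line.\<close>

lemma components_Un_separated:
  fixes g :: "'a::topological_space \<Rightarrow> real"
  assumes "connected A" "connected B" "A \<noteq> {}" "B \<noteq> {}" "continuous_on (A \<union> B) g"
    and pos: "\<And>x. x \<in> A \<Longrightarrow> g x > 0" and neg: "\<And>x. x \<in> B \<Longrightarrow> g x < 0"
  shows "components (A \<union> B) = {A, B}" "A \<noteq> B"
proof -
  have sep: "D \<inter> A = {} \<or> D \<inter> B = {}" if "connected D" "D \<subseteq> A \<union> B" for D
  proof (rule ccontr)
    assume "\<not> ?thesis"
    then obtain a b where ab: "a \<in> D" "a \<in> A" "b \<in> D" "b \<in> B" by auto
    have "connected (g ` D)"
      using that assms(5) by (intro connected_continuous_image) (auto intro: continuous_on_subset)
    then have "0 \<in> g ` D"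
      using ab pos[of a] neg[of b] connectedD_interval[of "g ` D" "g b" "g a" 0] by auto
    then show False using that pos neg by fastforce
  qed
  have "A \<in> components (A \<union> B)"
    unfolding in_components_maximal
  proof (intro conjI allI impI)
    fix d assume d: "d \<noteq> {} \<and> A \<subseteq> d \<and> d \<subseteq> A \<union> B \<and> connected d"
    then have "d \<inter> B = {}" using sep[of d] assms(3) by blast
    with d show "d = A" by blast
  qed (use assms in auto)
  moreover have "B \<in> components (A \<union> B)"
    unfolding in_components_maximal
  proof (intro conjI allI impI)
    fix d assume d: "d \<noteq> {} \<and> B \<subseteq> d \<and> d \<subseteq> A \<union> B \<and> connected d"
    then have "d \<inter> A = {}" using sep[of d] assms(4) by blast
    with d show "d = B" by blast
  qed (use assms in auto)
  moreover have "D = A \<or> D = B" if D: "D \<in> components (A \<union> B)" for D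
  proof -
    obtain x where "x \<in> D" "x \<in> A \<union> B"
      using in_components_nonempty[OF D] in_components_subset[OF D] by blast
    then show ?thesis
      using components_nonoverlap[OF D] calculation by blast
  qed
  ultimately show "components (A \<union> B) = {A, B}" by auto
  show "A \<noteq> B" using assms by (metis ex_in_conv less_asym)
qed

subsection \<open>Exit points of rays\<close>

text \<open>For \<open>z\<close> in a bounded open convex set and \<open>v\<close> nonzero the
  choice is forced, since a ray from inside meets the frontier once
  (\<open>ray_frontier_unique\<close>).\<close>

definition exit_time :: "'a::euclidean_space set \<Rightarrow> 'a \<Rightarrow> 'a \<Rightarrow> real" where
  "exit_time P z v = (SOME t. t > 0 \<and> z + t *\<^sub>R v \<in> frontier P)"

context
  fixes P :: "'a::euclidean_space set"
  assumes P: "open P" "convex P" "bounded P"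
begin

lemma segment_in_open_convex:
  assumes "z \<in> P" "x \<in> closure P" "0 \<le> t" "t < 1"
  shows "z + t *\<^sub>R (x - z) \<in> P"
proof -
  have "x - (1 - t) *\<^sub>R (x - z) \<in> interior P"
    using assms P by (intro mem_interior_closure_convex_shrink) (auto simp: interior_open)
  then show ?thesis using P by (simp add: interior_open algebra_simps)
qed

lemma exit_time:
  assumes "z \<in> P" "v \<noteq> 0"
  shows "exit_time P z v > 0" "z + exit_time P z v *\<^sub>R v \<in> frontier P"
proof -
  have "z \<in> interior P" using assms P(1) by (simp add: interior_open)
  then obtain d where "0 < d" "z + d *\<^sub>R v \<in> frontier P"
    by (rule ray_to_frontier[OF P(3) _ assms(2)])
  then have "exit_time P z v > 0 \<and> z + exit_time P z v *\<^sub>R v \<in> frontier P"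
    unfolding exit_time_def
    using someI[of "\<lambda>t. t > 0 \<and> z + t *\<^sub>R v \<in> frontier P" d] by blast
  then show "exit_time P z v > 0" "z + exit_time P z v *\<^sub>R v \<in> frontier P" by auto
qed

lemma less_exit_time_iff:
  assumes "z \<in> P" "v \<noteq> 0" "0 \<le> t"
  shows "z + t *\<^sub>R v \<in> P \<longleftrightarrow> t < exit_time P z v"
proof -
  let ?T = "exit_time P z v"
  note T = exit_time[OF assms(1,2)]
  have front: "frontier P = closure P - P"
    using P by (simp add: frontier_def interior_open)
  show ?thesis
  proof
    assume t: "t < ?T"
    have "z + (t / ?T) *\<^sub>R ((z + ?T *\<^sub>R v) - z) \<in> P"
      using t T assms front by (intro segment_in_open_convex) auto
    then show "z + t *\<^sub>R v \<in> P" using T by simp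
  next
    assume t: "z + t *\<^sub>R v \<in> P"
    show "t < ?T"
    proof (rule ccontr)
      assume "\<not> t < ?T"
      then have le: "?T \<le> t" by simp
      with T have "t > 0" by linarith
      have "z + (?T / t) *\<^sub>R ((z + t *\<^sub>R v) - z) \<in> P"
      proof (cases "?T = t")
        case False
        then show ?thesis using t le T \<open>t > 0\<close> assms closure_subset[of P]
          by (intro segment_in_open_convex) auto
      qed (use t \<open>t > 0\<close> in simp)
      then show False using T front \<open>t > 0\<close> by simp
    qed
  qed
qed

lemma closure_imp_le_exit_time:
  assumes "z \<in> P" "v \<noteq> 0" "0 \<le> t" "z + t *\<^sub>R v \<in> closure P"
  shows "t \<le> exit_time P z v"
proof (rule ccontr)
  assume "\<not> ?thesis"
  then have lt: "exit_time P z v < t" by simp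
  note T = exit_time[OF assms(1,2)]
  have "z + (exit_time P z v / t) *\<^sub>R ((z + t *\<^sub>R v) - z) \<in> P"
    using T lt assms by (intro segment_in_open_convex) auto
  then show False using less_exit_time_iff[OF assms(1,2), of "exit_time P z v"] T lt by auto
qed

text \<open>Both strict inequalities are open conditions: a point reached before the exit stays in
  the open set \<open>P\<close> under perturbation, and one beyond it stays in the open complement
  of \<open>closure P\<close>.\<close>

lemma continuous_on_exit_time:
  assumes "continuous_on P v" "\<And>z. z \<in> P \<Longrightarrow> v z \<noteq> 0"
  shows "continuous_on P (\<lambda>z. exit_time P z (v z))"
  unfolding continuous_on_def
proof (intro ballI order_tendstoI)
  fix z a assume z: "z \<in> P"
  have cont: "((\<lambda>w. w + t *\<^sub>R v w) \<longlongrightarrow> z + t *\<^sub>R v z) (at z within P)" for t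
    using assms(1) z by (intro tendsto_intros) (auto simp: continuous_on_def)
  have inP: "\<forall>\<^sub>F w in at z within P. w \<in> P"
    by (auto simp: eventually_at_topological)
  {
    assume a: "a < exit_time P z (v z)"
    \<comment> \<open>A negative bound \<open>a\<close> must be raised to \<open>0\<close>, as exit
      times are compared with nonnegative times only.\<close>
    define t where "t = max a 0"
    have t: "t \<ge> 0" "t < exit_time P z (v z)" "a \<le> t"
      using a exit_time[OF z, of "v z"] assms z by (auto simp: t_def)
    have "z + t *\<^sub>R v z \<in> P" using less_exit_time_iff z assms t by blast
    then have "\<forall>\<^sub>F w in at z within P. w + t *\<^sub>R v w \<in> P"
      using cont[of t] P(1) by (auto intro: topological_tendstoD)
    with inP show "\<forall>\<^sub>F w in at z within P. a < exit_time P w (v w)"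
      by eventually_elim (use less_exit_time_iff assms t in fastforce)
  next
    assume a: "exit_time P z (v z) < a"
    then have a0: "a > 0" using exit_time[OF z, of "v z"] assms z by auto
    have "z + a *\<^sub>R v z \<notin> closure P"
      using closure_imp_le_exit_time[of z "v z" a] z assms a a0 by auto
    then have "\<forall>\<^sub>F w in at z within P. w + a *\<^sub>R v w \<in> - closure P"
      using cont[of a] by (intro topological_tendstoD) auto
    with inP show "\<forall>\<^sub>F w in at z within P. exit_time P w (v w) < a"
    proof eventually_elim
      case (elim w)
      then have w: "w \<in> P" "v w \<noteq> 0" using assms by auto
      show ?case
      proof (rule ccontr)
        assume n: "\<not> exit_time P w (v w) < a"
        then have "a = exit_time P w (v w) \<or> a < exit_time P w (v w)" by auto
        then have "w + a *\<^sub>R v w \<in> closure P"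
          using less_exit_time_iff[OF w, of a] exit_time[OF w] a0 closure_subset[of P]
          by (auto simp: frontier_def)
        then show False using elim by auto
      qed
    qed
  }
qed

lemma ray_frontier_unique:
  assumes "z \<in> P" "v \<noteq> 0" "t > 0" "z + t *\<^sub>R v \<in> frontier P"
  shows "t = exit_time P z v"
proof -
  have "z + t *\<^sub>R v \<in> closure P" "z + t *\<^sub>R v \<notin> P"
    using assms P by (auto simp: frontier_def interior_open)
  then show ?thesis
    using closure_imp_le_exit_time[of z v t] less_exit_time_iff[of z v t] assms by auto
qed

end

subsection \<open>Unit gradient fields are constant along their integral lines\<close>

text \<open>With \<open>G\<close> merely continuous, integral curves of \<open>G\<close> need not be
  unique, so none are followed. The function \<psi> is 1-Lipschitz, yet some \<open>y\<close> on the
  sphere of radius \<open>r\<close> satisfies \<psi> y \<ge> \<psi> x + r. Equality in the Lipschitz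
  bound makes \<psi> affine with slope one from \<open>x\<close> to \<open>y\<close>, which
  identifies \<open>G\<close> on that segment.\<close>

lemma eikonal_segment:
  fixes \<psi> :: "'a::euclidean_space \<Rightarrow> real"
  assumes der: "\<And>y. y \<in> ball x R \<Longrightarrow> (\<psi> has_derivative (\<lambda>h. G y \<bullet> h)) (at y)"
    and unit: "\<And>y. y \<in> ball x R \<Longrightarrow> norm (G y) = 1"
    and contG: "continuous_on (ball x R) G"
    and r: "0 < r" "r < R"
    and t: "0 \<le> t" "t < r"
  shows "G (x + t *\<^sub>R G x) = G x"
proof -
  have sub: "cball x r \<subseteq> ball x R" using r by auto
  have lip: "\<psi> y - \<psi> z \<le> norm (y - z)" if yz: "y \<in> ball x R" "z \<in> ball x R" for y z
  proof -
    have "norm (\<psi> y - \<psi> z) \<le> 1 * norm (y - z)"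
    proof (rule differentiable_bound[OF convex_ball _ _ yz])
      fix w assume w: "w \<in> ball x R"
      show "(\<psi> has_derivative (\<lambda>h. G w \<bullet> h)) (at w within ball x R)"
        using der[OF w] by (rule has_derivative_at_withinI)
      show "onorm (\<lambda>h. G w \<bullet> h) \<le> 1"
        by (rule onorm_bound) (use unit[OF w] Cauchy_Schwarz_ineq2[of "G w"] in auto)
    qed
    then show ?thesis by auto
  qed
  have cont\<psi>: "continuous_on (cball x r) \<psi>"
    using der sub by (meson continuous_at_imp_continuous_on has_derivative_continuous subset_eq)
  have almost: "\<exists>y\<in>sphere x r. \<psi> y \<ge> \<psi> x + (1 - e) * r" if e: "0 < e" "e < 1" for e
  proof -
    \<comment> \<open>At a maximum inside the ball, a small step along \<open>G y\<close> would
      raise \<psi> at rate one and the penalty at rate at most \<open>1 - e\<close>. So the maximum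
      of \<open>F\<close> lies on the sphere; the full gain \<open>r\<close> follows as
      \<open>e\<close> tends to \<open>0\<close>.\<close>
    define F where "F y = \<psi> y - (1 - e) * norm (y - x)" for y
    have "continuous_on (cball x r) F"
      unfolding F_def by (intro continuous_intros cont\<psi>)
    then obtain y where y: "y \<in> cball x r" and max: "\<And>z. z \<in> cball x r \<Longrightarrow> F z \<le> F y"
      using continuous_attains_sup[of "cball x r" F] r by auto
    have "\<not> norm (y - x) < r"
    proof
      assume lt: "norm (y - x) < r"
      have yb: "y \<in> ball x R" using y sub by auto
      define f where "f t = \<psi> (y + t *\<^sub>R G y) - (1 - e) * t" for t
      have "((\<lambda>t. \<psi> (y + t *\<^sub>R G y)) has_derivative (\<lambda>h. G y \<bullet> (h *\<^sub>R G y))) (at 0)"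
      proof -
        have "(\<psi> has_derivative (\<lambda>h. G y \<bullet> h)) (at (y + 0 *\<^sub>R G y))" using der[OF yb] by simp
        then show ?thesis
          by (intro has_derivative_compose[where g=\<psi> and f="\<lambda>t. y + t *\<^sub>R G y"])
            (auto intro!: derivative_eq_intros)
      qed
      moreover have "(\<lambda>h. G y \<bullet> (h *\<^sub>R G y)) = times 1"
        using unit[OF yb] by (simp add: fun_eq_iff dot_square_norm)
      ultimately have "((\<lambda>t. \<psi> (y + t *\<^sub>R G y)) has_real_derivative 1) (at 0)"
        by (simp add: has_field_derivative_def)
      then have "(f has_real_derivative e) (at 0)"
        unfolding f_def by (auto intro!: derivative_eq_intros)
      then obtain d where d: "d > 0" "\<And>h. 0 < h \<Longrightarrow> h < d \<Longrightarrow> f 0 < f (0 + h)"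
        using DERIV_pos_inc_right[of f e 0] e by auto
      define h where "h = min (d / 2) (r - norm (y - x))"
      have h: "0 < h" "h < d" "h \<le> r - norm (y - x)" using d lt by (auto simp: h_def)
      have n: "norm (y + h *\<^sub>R G y - x) \<le> norm (y - x) + h"
        using norm_triangle_ineq[of "y - x" "h *\<^sub>R G y"] unit[OF yb] h by (simp add: algebra_simps)
      have "F (y + h *\<^sub>R G y) \<le> F y"
        by (rule max) (use n h in \<open>simp add: dist_norm norm_minus_commute\<close>)
      moreover have "(1 - e) * norm (y + h *\<^sub>R G y - x) \<le> (1 - e) * (norm (y - x) + h)"
        using n e by (intro mult_left_mono) auto
      moreover have "f 0 < f h" using d(2)[of h] h by simp
      ultimately show False unfolding F_def f_def by (simp add: algebra_simps)
    qed
    then have yr: "norm (y - x) = r" using y by (auto simp: dist_norm norm_minus_commute)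
    moreover have "F x \<le> F y" using max[of x] r by simp
    ultimately show ?thesis
      by (intro bexI[of _ y]) (auto simp: F_def dist_norm norm_minus_commute algebra_simps)
  qed
  have "sphere x r \<noteq> {}" using almost[of "1/2"] by auto
  then obtain y where y: "y \<in> sphere x r" and ymax: "\<And>z. z \<in> sphere x r \<Longrightarrow> \<psi> z \<le> \<psi> y"
    using continuous_attains_sup[of "sphere x r" \<psi>] continuous_on_subset[OF cont\<psi> sphere_cball]
    by auto
  have full: "\<psi> x + r \<le> \<psi> y"
  proof (rule field_le_epsilon)
    fix d :: real assume d: "d > 0"
    define e where "e = min (1/2) (d / r)"
    have e: "0 < e" "e < 1" "e * r \<le> d" using d r by (auto simp: e_def min_def field_simps)
    obtain z where "z \<in> sphere x r" "\<psi> z \<ge> \<psi> x + (1 - e) * r" using almost[OF e(1,2)] by auto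
    then show "\<psi> x + r \<le> \<psi> y + d" using ymax[of z] e by (simp add: algebra_simps)
  qed
  define v where "v = (y - x) /\<^sub>R r"
  have ny: "norm (y - x) = r" using y by (simp add: dist_norm norm_minus_commute)
  have v: "norm v = 1" "y = x + r *\<^sub>R v" using r ny by (auto simp: v_def)
  have inb: "x + t *\<^sub>R v \<in> ball x R" if "0 \<le> t" "t \<le> r" for t
    using v that r by (simp add: dist_norm)
  \<comment> \<open>The Lipschitz bound from \<open>x\<close> gives one inequality, and the bound
    towards \<open>y\<close>, where the gain is already \<open>r\<close>, gives the other.\<close>
  have affine: "\<psi> (x + t *\<^sub>R v) = \<psi> x + t" if t: "0 \<le> t" "t \<le> r" for t
  proof (rule antisym)
    show "\<psi> (x + t *\<^sub>R v) \<le> \<psi> x + t"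
      using lip[OF inb[OF t], of x] r v t by simp
    have "y - (x + t *\<^sub>R v) = (r - t) *\<^sub>R v" using v by (simp add: algebra_simps)
    then have "\<psi> y - \<psi> (x + t *\<^sub>R v) \<le> r - t"
      using lip[OF _ inb[OF t], of y] inb[of r] r v t by simp
    then show "\<psi> x + t \<le> \<psi> (x + t *\<^sub>R v)" using full by simp
  qed
  \<comment> \<open>The slope one along \<open>v\<close> is \<open>?g \<bullet> v\<close>, and
    equality in Cauchy-Schwarz for unit vectors gives \<open>?g = v\<close>. The value at
    \<open>x\<close> itself is recovered afterwards as a one-sided limit.\<close>
  have Gv: "G (x + t *\<^sub>R v) = v" if t: "0 < t" "t < r" for t
  proof -
    let ?g = "G (x + t *\<^sub>R v)"
    have b: "x + t *\<^sub>R v \<in> ball x R" using inb t by auto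
    have "((\<lambda>t. \<psi> (x + t *\<^sub>R v)) has_derivative (\<lambda>h. ?g \<bullet> (h *\<^sub>R v))) (at t)"
      by (rule has_derivative_compose[where g=\<psi> and f="\<lambda>t. x + t *\<^sub>R v", OF _ der[OF b]])
        (auto intro!: derivative_eq_intros)
    then have d1: "((\<lambda>t. \<psi> (x + t *\<^sub>R v)) has_real_derivative ?g \<bullet> v) (at t)"
      by (simp add: has_field_derivative_def mult_commute_abs)
    have "((\<lambda>t. \<psi> x + t) has_real_derivative 1) (at t)" by (auto intro!: derivative_eq_intros)
    then have "((\<lambda>t. \<psi> (x + t *\<^sub>R v)) has_real_derivative 1) (at t)"
      by (rule has_field_derivative_transform_within_open[where S="{0<..<r}"]) (use affine t in auto)
    then have "?g \<bullet> v = 1" using d1 DERIV_unique by blast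
    then show ?thesis
      using norm_cauchy_schwarz_eq[of ?g v] v(1) unit[OF b] by simp
  qed
  have "((\<lambda>t. G (x + t *\<^sub>R v)) \<longlongrightarrow> G x) (at_right 0)"
  proof -
    have "isCont G x" using contG r by (simp add: continuous_on_eq_continuous_at)
    moreover have "((\<lambda>t. x + t *\<^sub>R v) \<longlongrightarrow> x + 0 *\<^sub>R v) (at_right 0)" by (intro tendsto_intros)
    ultimately show ?thesis using isCont_tendsto_compose[of x G] by simp
  qed
  moreover have "((\<lambda>t. G (x + t *\<^sub>R v)) \<longlongrightarrow> v) (at_right 0)"
    by (rule tendsto_eventually)
      (use Gv r in \<open>auto simp: eventually_at_right_field intro!: exI[of _ r]\<close>)
  ultimately have "G x = v" using tendsto_unique[of "at_right (0::real)"] by force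
  then show ?thesis using Gv t by (cases "t = 0") auto
qed

text \<open>Changing the sign of both \<psi> and \<open>G\<close> preserves the hypotheses and turns
  negative times into positive ones.\<close>

lemma eikonal_local_const:
  fixes \<psi> :: "'a::euclidean_space \<Rightarrow> real"
  assumes der: "\<And>y. y \<in> ball x R \<Longrightarrow> (\<psi> has_derivative (\<lambda>h. G y \<bullet> h)) (at y)"
    and unit: "\<And>y. y \<in> ball x R \<Longrightarrow> norm (G y) = 1"
    and contG: "continuous_on (ball x R) G"
    and t: "\<bar>t\<bar> < R"
  shows "G (x + t *\<^sub>R G x) = G x"
proof -
  obtain r where r: "\<bar>t\<bar> < r" "r < R" using dense[OF t] by auto
  show ?thesis
  proof (cases "t \<ge> 0")
    case True
    then show ?thesis using eikonal_segment[OF der unit contG, of r t] r by auto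
  next
    case False
    have "((\<lambda>y. - \<psi> y) has_derivative (\<lambda>h. (- G y) \<bullet> h)) (at y)" if "y \<in> ball x R" for y
      using der[OF that] by (auto intro!: derivative_eq_intros)
    then have "- G (x + (- t) *\<^sub>R (- G x)) = - G x"
      using eikonal_segment[of x R "\<lambda>y. - \<psi> y" "\<lambda>y. - G y" r "- t"] r False unit contG
      by (auto intro!: continuous_intros)
    then show ?thesis by simp
  qed
qed

text \<open>The radius in \<open>loc\<close> depends on the point and has no uniform lower bound, so
  the parameters at which \<open>s\<close> has its initial value are shown to be closed and open in
  the unit interval.\<close>

lemma const_on_segment:
  fixes s :: "'a::real_normed_vector \<Rightarrow> 'b::real_normed_vector"
  assumes P: "convex P" "x \<in> P" "x + a *\<^sub>R f (s x) \<in> P" and cont: "continuous_on P s"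
    and loc: "\<And>x. x \<in> P \<Longrightarrow> \<exists>d>0. \<forall>t. \<bar>t\<bar> < d \<longrightarrow> s (x + t *\<^sub>R f (s x)) = s x"
  shows "s (x + a *\<^sub>R f (s x)) = s x"
proof -
  define p where "p t = x + (t * a) *\<^sub>R f (s x)" for t
  have pP: "p t \<in> P" if "t \<in> {0..1}" for t
    using convexD[OF P, of "1 - t" t] that by (simp add: p_def algebra_simps)
  define T where "T = {t \<in> {0..1}. s (p t) = s x}"
  have "continuous_on {0..1} (\<lambda>t. s (p t))"
    by (rule continuous_on_compose2[OF cont]) (use pP in \<open>auto simp: p_def intro!: continuous_intros\<close>)
  then have "closedin (top_of_set {0..1}) T"
    unfolding T_def by (rule continuous_closedin_preimage_constant)
  moreover have "openin (top_of_set {0..1}) T"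
    unfolding openin_euclidean_subtopology_iff
  proof (intro conjI ballI)
    fix t assume t: "t \<in> T"
    then have t01: "t \<in> {0..1}" and st: "s (p t) = s x" by (auto simp: T_def)
    obtain d where d: "d > 0" "\<And>t'. \<bar>t'\<bar> < d \<Longrightarrow> s (p t + t' *\<^sub>R f (s (p t))) = s (p t)"
      using loc[OF pP[OF t01]] by auto
    show "\<exists>e>0. \<forall>x'\<in>{0..1}. dist x' t < e \<longrightarrow> x' \<in> T"
    proof (intro exI conjI ballI impI)
      \<comment> \<open>A parameter change moves the point by the factor \<open>a\<close>; the added
        \<open>1\<close> covers \<open>a = 0\<close>.\<close>
      show "d / (\<bar>a\<bar> + 1) > 0" using d by simp
      fix t' :: real assume t': "t' \<in> {0..1}" "dist t' t < d / (\<bar>a\<bar> + 1)"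
      have "\<bar>t' - t\<bar> * \<bar>a\<bar> \<le> \<bar>t' - t\<bar> * (\<bar>a\<bar> + 1)" by (intro mult_left_mono) auto
      also have "\<dots> < d" using t' by (simp add: dist_real_def field_simps)
      finally have "\<bar>(t' - t) * a\<bar> < d" by (simp add: abs_mult)
      then have "s (p t + ((t' - t) * a) *\<^sub>R f (s (p t))) = s (p t)" by (rule d)
      moreover have "p t + ((t' - t) * a) *\<^sub>R f (s (p t)) = p t'"
        unfolding st by (simp add: p_def algebra_simps)
      ultimately show "t' \<in> T" using t' st by (simp add: T_def)
    qed
  qed (auto simp: T_def)
  moreover have "0 \<in> T" by (simp add: T_def p_def)
  ultimately have "T = {0..1}"
    using connected_clopen[of "{0..1::real}"] by (metis connected_Icc empty_iff)
  then have "1 \<in> T" by simp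
  then show ?thesis by (simp add: T_def p_def)
qed

subsection \<open>Poincare lemma in the plane\<close>

text \<open>The potential is the integral of \<open>F\<close> along the segment from
  \<open>x0\<close>. Differentiating under the integral produces \<open>V x t\<close>, and vanishing
  curl makes \<open>V x t\<close> the derivative in \<open>t\<close> of \<open>t\<close> times
  \<open>F (q x t)\<close>, which integrates to \<open>F x\<close>.\<close>

lemma poincare_plane:
  fixes F g1 g2 :: "real^2 \<Rightarrow> real^2"
  assumes d1: "\<And>x. ((\<lambda>x. F x $ 1) has_derivative (\<lambda>h. g1 x \<bullet> h)) (at x)"
    and d2: "\<And>x. ((\<lambda>x. F x $ 2) has_derivative (\<lambda>h. g2 x \<bullet> h)) (at x)"
    and c1: "continuous_on UNIV g1" and c2: "continuous_on UNIV g2"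
    and curl: "\<And>x. x \<in> ball x0 r \<Longrightarrow> g1 x $ 2 = g2 x $ 1"
  shows "\<exists>\<psi>. \<psi> x0 = 0 \<and> (\<forall>x\<in>ball x0 r. (\<psi> has_derivative (\<lambda>h. F x \<bullet> h)) (at x))"
proof -
  define q where "q x t = x0 + t *\<^sub>R (x - x0)" for x :: "real^2" and t :: real
  \<comment> \<open>The gradient in \<open>x\<close> of the integrand
    \<open>F (q x t) \<bullet> (x - x0)\<close>.\<close>
  define V where "V x t = F (q x t) + t *\<^sub>R ((x - x0) $ 1 *\<^sub>R g1 (q x t) + (x - x0) $ 2 *\<^sub>R g2 (q x t))"
    for x t
  define \<psi> where "\<psi> x = integral (cbox 0 1) (\<lambda>t. F (q x t) \<bullet> (x - x0))" for x
  have cF1: "continuous_on UNIV (\<lambda>x. F x $ 1)" and cF2: "continuous_on UNIV (\<lambda>x. F x $ 2)"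
    using d1 d2 by (auto intro!: continuous_at_imp_continuous_on has_derivative_continuous)
  have F_eq: "F = (\<lambda>x. F x $ 1 *\<^sub>R axis 1 1 + F x $ 2 *\<^sub>R axis 2 1)"
    by (auto simp: fun_eq_iff vec_eq_iff forall_2 axis_def)
  have cF: "continuous_on UNIV F"
    by (subst F_eq) (intro continuous_intros cF1 cF2)
  have dq: "((\<lambda>x. q x t) has_derivative (\<lambda>h. t *\<^sub>R h)) (at x)" for t x
    unfolding q_def by (auto intro!: derivative_eq_intros)
  have dqt: "((\<lambda>t. q x t) has_derivative (\<lambda>h. h *\<^sub>R (x - x0))) (at t)" for t x
    unfolding q_def by (auto intro!: derivative_eq_intros)
  have der: "((\<lambda>x. F (q x t) \<bullet> (x - x0)) has_derivative blinfun_apply (blinfun_inner_right (V x t))) (at x within UNIV)"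
    for x t
  proof -
    have e1: "((\<lambda>x. F (q x t) $ 1) has_derivative (\<lambda>h. g1 (q x t) \<bullet> (t *\<^sub>R h))) (at x)"
      by (rule has_derivative_compose[OF dq d1])
    have e2: "((\<lambda>x. F (q x t) $ 2) has_derivative (\<lambda>h. g2 (q x t) \<bullet> (t *\<^sub>R h))) (at x)"
      by (rule has_derivative_compose[OF dq d2])
    have n1: "((\<lambda>x. (x - x0) $ i) has_derivative (\<lambda>h. h $ i)) (at x)" for i :: 2
      by (rule bounded_linear.has_derivative[OF bounded_linear_vec_nth]) (auto intro!: derivative_eq_intros)
    have "((\<lambda>x. F (q x t) $ 1 * (x - x0) $ 1 + F (q x t) $ 2 * (x - x0) $ 2) has_derivative
      (\<lambda>h. (F (q x t) $ 1 * h $ 1 + g1 (q x t) \<bullet> (t *\<^sub>R h) * (x - x0) $ 1) +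
        (F (q x t) $ 2 * h $ 2 + g2 (q x t) \<bullet> (t *\<^sub>R h) * (x - x0) $ 2))) (at x)"
      by (intro has_derivative_add has_derivative_mult e1 e2 n1)
    moreover have "(\<lambda>x. F (q x t) $ 1 * (x - x0) $ 1 + F (q x t) $ 2 * (x - x0) $ 2) =
        (\<lambda>x. F (q x t) \<bullet> (x - x0))"
      by (simp add: fun_eq_iff inner_vec2)
    moreover have "(\<lambda>h. (F (q x t) $ 1 * h $ 1 + g1 (q x t) \<bullet> (t *\<^sub>R h) * (x - x0) $ 1) +
        (F (q x t) $ 2 * h $ 2 + g2 (q x t) \<bullet> (t *\<^sub>R h) * (x - x0) $ 2)) =
        blinfun_apply (blinfun_inner_right (V x t))"
      by (simp add: fun_eq_iff V_def inner_vec2 algebra_simps)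
    ultimately show ?thesis by simp
  qed
  have cq: "continuous_on S (\<lambda>z. q (f z) (g z))" if "continuous_on S f" "continuous_on S g"
    for S and f :: "'z::topological_space \<Rightarrow> real^2" and g
    unfolding q_def by (intro continuous_intros that)
  have cV: "continuous_on (UNIV \<times> cbox 0 1) (\<lambda>(x, t). blinfun_inner_right (V x t))"
    unfolding V_def split_beta
    by (intro continuous_intros bounded_linear.continuous_on[OF bounded_linear_blinfun_inner_right]
        continuous_on_compose2[OF cF cq] continuous_on_compose2[OF c1 cq] continuous_on_compose2[OF c2 cq]) auto
  have cVt: "continuous_on (cbox 0 1) (V x)" for x
    unfolding V_def
    by (intro continuous_intros continuous_on_compose2[OF cF cq] continuous_on_compose2[OF c1 cq]
        continuous_on_compose2[OF c2 cq]) auto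
  have "(\<psi> has_derivative (\<lambda>h. F x \<bullet> h)) (at x)" if x: "x \<in> ball x0 r" for x
  proof -
    have "(\<psi> has_derivative integral (cbox 0 1) (\<lambda>t. blinfun_inner_right (V x t))) (at x within UNIV)"
      unfolding \<psi>_def
    proof (rule leibniz_rule[OF der _ cV])
      show "(\<lambda>t. F (q x t) \<bullet> (x - x0)) integrable_on cbox 0 1" for x
        by (intro integrable_continuous continuous_intros continuous_on_compose2[OF cF cq]) auto
    qed auto
    moreover have "integral (cbox 0 1) (\<lambda>t. blinfun_inner_right (V x t)) = blinfun_inner_right (F x)"
    proof -
      have qb: "q x t \<in> ball x0 r" if "t \<in> {0..1}" for t
      proof -
        have "norm (t *\<^sub>R (x - x0)) \<le> 1 * norm (x - x0)"
          unfolding norm_scaleR using that by (intro mult_right_mono) auto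
        then show ?thesis using x by (simp add: q_def dist_norm norm_minus_commute)
      qed
      \<comment> \<open>The product rule yields the Jacobian of \<open>F\<close> applied to
        \<open>x - x0\<close>, whereas \<open>V\<close> contains its transpose; \<open>curl\<close>
        says that the two agree.\<close>
      have dt: "((\<lambda>t. t *\<^sub>R F (q x t)) has_vector_derivative V x t) (at t within {0..1})"
        if t: "t \<in> {0..1}" for t
      proof -
        have e1: "((\<lambda>t. F (q x t) $ 1) has_derivative (\<lambda>h. g1 (q x t) \<bullet> (h *\<^sub>R (x - x0)))) (at t)"
          by (rule has_derivative_compose[OF dqt d1])
        have e2: "((\<lambda>t. F (q x t) $ 2) has_derivative (\<lambda>h. g2 (q x t) \<bullet> (h *\<^sub>R (x - x0)))) (at t)"
          by (rule has_derivative_compose[OF dqt d2])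
        have "((\<lambda>t. t *\<^sub>R (F (q x t) $ 1 *\<^sub>R axis 1 1 + F (q x t) $ 2 *\<^sub>R axis 2 1)) has_derivative
          (\<lambda>h. t *\<^sub>R ((g1 (q x t) \<bullet> (h *\<^sub>R (x - x0))) *\<^sub>R axis 1 1 + (g2 (q x t) \<bullet> (h *\<^sub>R (x - x0))) *\<^sub>R axis 2 1)
            + h *\<^sub>R (F (q x t) $ 1 *\<^sub>R axis 1 1 + F (q x t) $ 2 *\<^sub>R (axis 2 1 :: real^2)))) (at t)"
          by (intro has_derivative_scaleR has_derivative_add has_derivative_scaleR_left e1 e2 has_derivative_ident)
        moreover have "(\<lambda>h. t *\<^sub>R ((g1 (q x t) \<bullet> (h *\<^sub>R (x - x0))) *\<^sub>R axis 1 1 + (g2 (q x t) \<bullet> (h *\<^sub>R (x - x0))) *\<^sub>R axis 2 1)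
            + h *\<^sub>R (F (q x t) $ 1 *\<^sub>R axis 1 1 + F (q x t) $ 2 *\<^sub>R (axis 2 1 :: real^2))) = (\<lambda>h. h *\<^sub>R V x t)"
          using curl[OF qb[OF t]]
          by (auto simp: fun_eq_iff vec_eq_iff forall_2 axis_def V_def inner_vec2 algebra_simps)
        ultimately show ?thesis
          unfolding has_vector_derivative_def F_eq[THEN fun_cong, symmetric]
          by (metis (no_types, lifting) has_derivative_at_withinI)
      qed
      have "(V x has_integral (1 *\<^sub>R F (q x 1) - 0 *\<^sub>R F (q x 0))) {0..1}"
        by (rule fundamental_theorem_of_calculus) (use dt in auto)
      then have "integral (cbox 0 1) (V x) = F x" by (simp add: q_def integral_unique)
      moreover have "V x integrable_on cbox 0 1" by (rule integrable_continuous[OF cVt])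
      ultimately show ?thesis
        using integral_linear[OF _ bounded_linear_blinfun_inner_right, of "V x" "cbox 0 1"]
        by (simp add: o_def)
    qed
    ultimately show ?thesis
      by (metis (no_types, lifting) blinfun_inner_right.rep_eq has_derivative_eq_rhs ext)
  qed
  moreover have "\<psi> x0 = 0" by (simp add: \<psi>_def)
  ultimately show ?thesis by blast
qed

subsection \<open>Continuous functions with compact support\<close>

definition compactly_supported :: "'a::euclidean_space set \<Rightarrow> ('a \<Rightarrow> 'b::euclidean_space) \<Rightarrow> bool" where
  "compactly_supported S f \<longleftrightarrow>
     continuous_on UNIV f \<and> (\<exists>K. compact K \<and> K \<subseteq> S \<and> (\<forall>x. x \<notin> K \<longrightarrow> f x = 0))"

lemma compactly_supported_bounded:
  assumes "compactly_supported S f"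
  obtains B where "B \<ge> 0" "\<And>x. norm (f x) \<le> B"
proof -
  obtain K where K: "compact K" "\<And>x. x \<notin> K \<Longrightarrow> f x = 0" and c: "continuous_on UNIV f"
    using assms by (auto simp: compactly_supported_def)
  have "compact (f ` K)" using K c by (intro compact_continuous_image) (auto intro: continuous_on_subset)
  then have "bounded (f ` K)" by (rule compact_imp_bounded)
  then obtain B where B: "\<And>x. x \<in> K \<Longrightarrow> norm (f x) \<le> B" by (auto simp: bounded_iff)
  show ?thesis
  proof (rule that[of "max B 0"])
    fix x show "norm (f x) \<le> max B 0"
      using B[of x] K(2)[of x] by (cases "x \<in> K") auto
  qed simp
qed

text \<open>Integrals over \<open>S\<close> become integrals over the whole space with respect to
  \<open>lborel\<close>, where translation invariance applies.\<close>

lemma integral_compactly_supported: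
  assumes "compactly_supported S f" "S \<in> sets lebesgue"
  shows "integrable (lebesgue_on S) f" "integrable lborel f"
    and "(LINT x|lebesgue_on S. f x) = (LINT x|lborel. f x)"
proof -
  obtain K where K: "compact K" "K \<subseteq> S" "\<And>x. x \<notin> K \<Longrightarrow> f x = 0" and c: "continuous_on UNIV f"
    using assms by (auto simp: compactly_supported_def)
  have "integrable lborel (\<lambda>x. indicator K x *\<^sub>R f x)"
    using K c by (intro borel_integrable_compact) (auto intro: continuous_on_subset)
  moreover have "(\<lambda>x. indicator K x *\<^sub>R f x) = f" using K by (auto simp: fun_eq_iff indicator_def)
  ultimately show lb: "integrable lborel f" by simp
  have m: "f \<in> borel_measurable lborel" using lb by auto
  have S: "(\<lambda>x. indicator S x *\<^sub>R f x) = f" using K by (auto simp: fun_eq_iff indicator_def)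
  have "integrable lebesgue f" using lb integrable_completion[OF m] by simp
  then show "integrable (lebesgue_on S) f"
    using integrable_restrict_space[of S lebesgue f] assms S by simp
  show "(LINT x|lebesgue_on S. f x) = (LINT x|lborel. f x)"
    using integral_restrict_space[of S lebesgue f] integral_completion[OF m] assms S by simp
qed

lemma compactly_supported_continuous:
  "compactly_supported S f \<Longrightarrow> continuous_on UNIV f"
  by (simp add: compactly_supported_def)

lemma compactly_supported_scaleR:
  fixes f :: "'a::euclidean_space \<Rightarrow> real"
  assumes "compactly_supported S f" "continuous_on UNIV g"
  shows "compactly_supported S (\<lambda>x. f x *\<^sub>R g x)"
proof -
  obtain K where "compact K" "K \<subseteq> S" "\<And>x. x \<notin> K \<Longrightarrow> f x = 0" and c: "continuous_on UNIV f"
    using assms by (auto simp: compactly_supported_def)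
  moreover have "continuous_on UNIV (\<lambda>x. f x *\<^sub>R g x)"
    by (rule continuous_on_scaleR[OF c assms(2)])
  ultimately show ?thesis unfolding compactly_supported_def by force
qed

lemma compactly_supported_compose:
  assumes "compactly_supported S f" "continuous_on UNIV h" "h 0 = 0"
  shows "compactly_supported S (\<lambda>x. h (f x))"
proof -
  obtain K where "compact K" "K \<subseteq> S" "\<And>x. x \<notin> K \<Longrightarrow> f x = 0" and c: "continuous_on UNIV f"
    using assms by (auto simp: compactly_supported_def)
  moreover have "continuous_on UNIV (\<lambda>x. h (f x))"
    by (rule continuous_on_compose2[OF assms(2) c]) simp
  ultimately show ?thesis unfolding compactly_supported_def using assms(3) by force
qed

lemma compactly_supported_measurable:
  assumes "compactly_supported S f" "S \<in> sets lebesgue"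
  shows "f \<in> borel_measurable (lebesgue_on S)"
  using integral_compactly_supported(1)[OF assms] by auto

lemma integrable_scaleR_bounded:
  fixes f :: "'a \<Rightarrow> 'b::euclidean_space" and u :: "'a \<Rightarrow> real"
  assumes "integrable M u" "f \<in> borel_measurable M" "\<And>x. norm (f x) \<le> B"
  shows "integrable M (\<lambda>x. u x *\<^sub>R f x)"
proof (rule Bochner_Integration.integrable_bound)
  show "integrable M (\<lambda>x. B * u x)" using assms by simp
  show "(\<lambda>x. u x *\<^sub>R f x) \<in> borel_measurable M" using assms by measurable
  show "AE x in M. norm (u x *\<^sub>R f x) \<le> norm (B * u x)"
  proof (rule AE_I2)
    fix x
    have "\<bar>u x\<bar> * norm (f x) \<le> \<bar>u x\<bar> * \<bar>B\<bar>"
      using assms(3)[of x] by (intro mult_left_mono) auto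
    then show "norm (u x *\<^sub>R f x) \<le> norm (B * u x)" by (simp add: abs_mult mult.commute)
  qed
qed

lemma integral_nth:
  fixes f :: "'a \<Rightarrow> real^2"
  assumes "integrable M f"
  shows "(LINT x|M. f x) $ i = (LINT x|M. f x $ i)" "integrable M (\<lambda>x. f x $ i)"
  using integral_bounded_linear[OF bounded_linear_vec_nth assms]
    integrable_bounded_linear[OF bounded_linear_vec_nth assms] by simp_all

subsection \<open>Test functions\<close>

lemma real2_sum_axis: "(h :: real^2) = h $ 1 *\<^sub>R axis 1 1 + h $ 2 *\<^sub>R axis 2 1"
  by (simp add: vec_eq_iff forall_2 axis_def)

lemma has_derivative_gradient:
  assumes "\<phi> differentiable (at x)"
  shows "(\<phi> has_derivative (\<lambda>h. gradient \<phi> x \<bullet> h)) (at x)"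
proof -
  let ?D = "frechet_derivative \<phi> (at x)"
  have D: "(\<phi> has_derivative ?D) (at x)" using assms frechet_derivative_works by blast
  then interpret linear ?D using has_derivative_linear by blast
  have "?D h = gradient \<phi> x \<bullet> h" for h
  proof -
    have "?D h = ?D (h $ 1 *\<^sub>R axis 1 1 + h $ 2 *\<^sub>R axis 2 1)"
      using real2_sum_axis by metis
    also have "\<dots> = h $ 1 * ?D (axis 1 1) + h $ 2 * ?D (axis 2 1)"
      by (simp only: add scale real_scaleR_def)
    finally show ?thesis by (simp add: inner_vec2 gradient_def mult.commute)
  qed
  then have "?D = (\<lambda>h. gradient \<phi> x \<bullet> h)" by auto
  with D show ?thesis by simp
qed

lemma gradient_eqI:
  assumes "(\<phi> has_derivative (\<lambda>h. g \<bullet> h)) (at x)"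
  shows "gradient \<phi> x = g"
proof -
  have "frechet_derivative \<phi> (at x) = (\<lambda>h. g \<bullet> h)"
    using frechet_derivative_at[OF assms] by simp
  then show ?thesis by (simp add: gradient_def vec_eq_iff inner_axis)
qed

lemma test_function_support:
  assumes "test_function S \<phi>"
  obtains K where "compact K" "K \<subseteq> S" "\<And>x. x \<notin> K \<Longrightarrow> \<phi> x = 0" "\<And>x. x \<notin> K \<Longrightarrow> gradient \<phi> x = 0"
proof -
  obtain K where K: "compact K" "K \<subseteq> S" "\<And>x. x \<notin> K \<Longrightarrow> \<phi> x = 0"
    using assms by (auto simp: test_function_def)
  have "gradient \<phi> x = 0" if x: "x \<notin> K" for x
  proof (rule gradient_eqI)
    have "((\<lambda>_. 0) has_derivative (\<lambda>h. 0 \<bullet> h)) (at x)" by simp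
    then show "(\<phi> has_derivative (\<lambda>h. 0 \<bullet> h)) (at x)"
      by (rule has_derivative_transform_within_open[where s="- K"])
        (use K x compact_imp_closed in auto)
  qed
  then show ?thesis using that K by blast
qed

lemma test_functionD:
  assumes "test_function S \<phi>"
  shows "compactly_supported S \<phi>" "compactly_supported S (gradient \<phi>)"
    "\<phi> differentiable (at x)"
proof -
  obtain K where K: "compact K" "K \<subseteq> S" "\<And>x. x \<notin> K \<Longrightarrow> \<phi> x = 0" "\<And>x. x \<notin> K \<Longrightarrow> gradient \<phi> x = 0"
    using test_function_support[OF assms] by blast
  have "continuous_on UNIV \<phi>"
    using assms by (auto simp: test_function_def intro!: continuous_at_imp_continuous_on differentiable_imp_continuous_within)
  then show "compactly_supported S \<phi>" using K by (auto simp: compactly_supported_def)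
  show "compactly_supported S (gradient \<phi>)"
    using K assms unfolding compactly_supported_def test_function_def by blast
  show "\<phi> differentiable (at x)" using assms by (simp add: test_function_def)
qed

lemma gradient_mult:
  assumes "\<phi> differentiable (at x)" "\<eta> differentiable (at x)"
  shows "gradient (\<lambda>x. \<phi> x * \<eta> x) x = \<phi> x *\<^sub>R gradient \<eta> x + \<eta> x *\<^sub>R gradient \<phi> x"
proof (rule gradient_eqI)
  have "((\<lambda>x. \<phi> x * \<eta> x) has_derivative (\<lambda>h. \<phi> x * (gradient \<eta> x \<bullet> h) + (gradient \<phi> x \<bullet> h) * \<eta> x)) (at x)"
    by (intro has_derivative_mult has_derivative_gradient assms)
  moreover have "(\<lambda>h. \<phi> x * (gradient \<eta> x \<bullet> h) + (gradient \<phi> x \<bullet> h) * \<eta> x) =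
    (\<lambda>h. (\<phi> x *\<^sub>R gradient \<eta> x + \<eta> x *\<^sub>R gradient \<phi> x) \<bullet> h)"
    by (simp add: fun_eq_iff inner_add_left)
  ultimately show "((\<lambda>x. \<phi> x * \<eta> x) has_derivative (\<lambda>h. (\<phi> x *\<^sub>R gradient \<eta> x + \<eta> x *\<^sub>R gradient \<phi> x) \<bullet> h)) (at x)"
    by simp
qed

section \<open>Translation invariance and integration by parts\<close>

lemma lborel_integral_shift:
  fixes f :: "'a::euclidean_space \<Rightarrow> 'b::{banach, second_countable_topology}"
  assumes "f \<in> borel_measurable borel"
  shows "(LINT x|lborel. f (c + x)) = (LINT x|lborel. f x)"
    "integrable lborel (\<lambda>x. f (c + x)) \<longleftrightarrow> integrable lborel f"
proof -
  have "(LINT x|lborel. f x) = (LINT x|distr lborel borel ((+) c). f x)"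
    by (simp add: lborel_distr_plus)
  also have "\<dots> = (LINT x|lborel. f (c + x))"
    using assms by (intro integral_distr) auto
  finally show "(LINT x|lborel. f (c + x)) = (LINT x|lborel. f x)" by simp
  have "integrable lborel f \<longleftrightarrow> integrable (distr lborel borel ((+) c)) f"
    by (simp add: lborel_distr_plus)
  also have "\<dots> \<longleftrightarrow> integrable lborel (\<lambda>x. f (c + x))"
    using assms by (intro integrable_distr_eq) auto
  finally show "integrable lborel (\<lambda>x. f (c + x)) \<longleftrightarrow> integrable lborel f" by simp
qed

text \<open>Difference quotients have vanishing integral by translation invariance, and they converge boundedly.\<close>

lemma integral_gradient:
  assumes \<phi>: "test_function S \<phi>" and S: "S \<in> sets lebesgue"
  shows "(LINT x|lebesgue_on S. gradient \<phi> x) = 0"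
proof -
  note cs = test_functionD[OF \<phi>]
  obtain K where K: "compact K" "K \<subseteq> S" "\<And>x. x \<notin> K \<Longrightarrow> \<phi> x = 0" "\<And>x. x \<notin> K \<Longrightarrow> gradient \<phi> x = 0"
    using test_function_support[OF \<phi>] by blast
  obtain M where M: "M \<ge> 0" "\<And>x. norm (gradient \<phi> x) \<le> M"
    using compactly_supported_bounded[OF cs(2)] by blast
  obtain R where R: "\<And>x. x \<in> K \<Longrightarrow> norm x \<le> R"
    using compact_imp_bounded[OF K(1)] by (auto simp: bounded_iff)
  have m: "\<phi> \<in> borel_measurable borel" "gradient \<phi> \<in> borel_measurable borel"
    using cs(1,2) by (auto simp: compactly_supported_def intro!: borel_measurable_continuous_onI)
  note int = integral_compactly_supported[OF cs(1) S] integral_compactly_supported[OF cs(2) S]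
  have "(LINT x|lborel. gradient \<phi> x) $ i = 0" for i
  proof -
    let ?e = "axis i 1 :: real^2"
    define d where "d n x = real (Suc n) * (\<phi> ((1 / real (Suc n)) *\<^sub>R ?e + x) - \<phi> x)" for n x
    have "(\<lambda>n. LINT x|lborel. d n x) \<longlonglongrightarrow> (LINT x|lborel. gradient \<phi> x $ i)"
    proof (rule integral_dominated_convergence)
      show "(\<lambda>x. gradient \<phi> x $ i) \<in> borel_measurable lborel"
        using integral_nth(2)[OF int(5)] by auto
      show "d n \<in> borel_measurable lborel" for n
        unfolding d_def using m by measurable
      \<comment> \<open>The mean value inequality bounds the quotients by \<open>M\<close>; shifts
        have length at most one, so all supports lie in the ball of radius
        \<open>R + 1\<close>.\<close>
      show "integrable lborel (\<lambda>x. indicator (cball 0 (R + 1)) x *\<^sub>R M :: real)"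
        by (intro borel_integrable_compact) auto
      show "AE x in lborel. (\<lambda>n. d n x) \<longlonglongrightarrow> gradient \<phi> x $ i"
      proof (rule AE_I2)
        fix x
        have g: "(\<phi> has_derivative (\<lambda>h. gradient \<phi> x \<bullet> h)) (at (0 *\<^sub>R ?e + x))"
          using has_derivative_gradient[OF cs(3)] by simp
        have "((\<lambda>t. \<phi> (t *\<^sub>R ?e + x)) has_derivative (\<lambda>h. gradient \<phi> x \<bullet> (h *\<^sub>R ?e))) (at 0)"
          by (rule has_derivative_compose[where g=\<phi> and f="\<lambda>t. t *\<^sub>R ?e + x", OF _ g])
            (auto intro!: derivative_eq_intros)
        then have "((\<lambda>t. \<phi> (t *\<^sub>R ?e + x)) has_real_derivative gradient \<phi> x $ i) (at 0)"
          by (simp add: has_field_derivative_def inner_axis mult_commute_abs)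
        then have "((\<lambda>h. (\<phi> (h *\<^sub>R ?e + x) - \<phi> x) / h) \<longlongrightarrow> gradient \<phi> x $ i) (at 0)"
          by (simp add: DERIV_def)
        moreover have "filterlim (\<lambda>n. 1 / real (Suc n)) (at 0) sequentially"
          unfolding filterlim_at
          by (auto intro!: LIMSEQ_Suc[OF lim_1_over_n] simp del: of_nat_Suc)
        ultimately have "(\<lambda>n. (\<phi> ((1 / real (Suc n)) *\<^sub>R ?e + x) - \<phi> x) / (1 / real (Suc n)))
            \<longlonglongrightarrow> gradient \<phi> x $ i"
          by (rule filterlim_compose)
        then show "(\<lambda>n. d n x) \<longlonglongrightarrow> gradient \<phi> x $ i"
          by (simp add: d_def mult.commute)
      qed
      show "AE x in lborel. norm (d n x) \<le> indicator (cball 0 (R + 1)) x *\<^sub>R M" for n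
      proof (rule AE_I2)
        fix x :: "real^2"
        let ?y = "(1 / real (Suc n)) *\<^sub>R ?e + x"
        have le1: "norm ((1 / real (Suc n)) *\<^sub>R ?e) \<le> 1" by (simp add: norm_axis_1)
        have "norm (\<phi> ?y - \<phi> x) \<le> M * norm (?y - x)"
        proof (rule differentiable_bound[OF convex_UNIV])
          fix z :: "real^2"
          show "(\<phi> has_derivative (\<lambda>h. gradient \<phi> z \<bullet> h)) (at z within UNIV)"
            using has_derivative_gradient[OF cs(3)] by simp
          show "onorm (\<lambda>h. gradient \<phi> z \<bullet> h) \<le> M"
          proof (rule onorm_bound)
            fix h
            have "\<bar>gradient \<phi> z \<bullet> h\<bar> \<le> norm (gradient \<phi> z) * norm h" by (rule Cauchy_Schwarz_ineq2)
            also have "\<dots> \<le> M * norm h" using M by (intro mult_right_mono) auto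
            finally show "norm (gradient \<phi> z \<bullet> h) \<le> M * norm h" by simp
          qed (use M in auto)
        qed auto
        then have "norm (\<phi> ?y - \<phi> x) \<le> M * (1 / real (Suc n))" by (simp add: norm_axis_1)
        then have "real (Suc n) * norm (\<phi> ?y - \<phi> x) \<le> real (Suc n) * (M * (1 / real (Suc n)))"
          by (intro mult_left_mono) auto
        then have le: "norm (d n x) \<le> M" by (simp add: d_def abs_mult)
        show "norm (d n x) \<le> indicator (cball 0 (R + 1)) x *\<^sub>R M"
        proof (cases "x \<in> cball 0 (R + 1)")
          case True
          then show ?thesis using le by simp
        next
          case False
          then have nx: "norm x > R + 1" by simp
          then have "x \<notin> K" using R[of x] by auto
          moreover have "?y \<notin> K"
          proof
            assume "?y \<in> K"
            then have "norm ?y \<le> R" using R by simp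
            moreover have "norm x \<le> norm ?y + norm ((1 / real (Suc n)) *\<^sub>R ?e)"
              using norm_triangle_ineq4[of ?y "(1 / real (Suc n)) *\<^sub>R ?e"] by simp
            ultimately show False using le1 nx by linarith
          qed
          ultimately show ?thesis using K(3) M(1) by (simp add: d_def del: of_nat_Suc)
        qed
      qed
    qed
    moreover have "(LINT x|lborel. d n x) = 0" for n
    proof -
      have "(LINT x|lborel. d n x) = real (Suc n) * ((LINT x|lborel. \<phi> ((1 / real (Suc n)) *\<^sub>R ?e + x)) - (LINT x|lborel. \<phi> x))"
        unfolding d_def using lborel_integral_shift(2)[OF m(1)] int(2) by (simp del: of_nat_Suc)
      then show ?thesis using lborel_integral_shift(1)[OF m(1)] by simp
    qed
    ultimately have "(LINT x|lborel. gradient \<phi> x $ i) = 0"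
      using LIMSEQ_unique[OF _ tendsto_const[of 0]] by simp
    then show ?thesis using integral_nth(1)[OF int(5)] by simp
  qed
  then show ?thesis using int(6) by (simp add: vec_eq_iff)
qed

lemma test_function_mult:
  assumes "test_function S \<phi>" "test_function S \<eta>"
  shows "test_function S (\<lambda>x. \<phi> x * \<eta> x)"
proof -
  note a = test_functionD[OF assms(1)] and b = test_functionD[OF assms(2)]
  have "gradient (\<lambda>x. \<phi> x * \<eta> x) = (\<lambda>x. \<phi> x *\<^sub>R gradient \<eta> x + \<eta> x *\<^sub>R gradient \<phi> x)"
    using gradient_mult a(3) b(3) by blast
  moreover have "continuous_on UNIV (\<lambda>x. \<phi> x *\<^sub>R gradient \<eta> x + \<eta> x *\<^sub>R gradient \<phi> x)"
    by (intro continuous_on_add continuous_on_scaleR) (rule compactly_supported_continuous, rule a b)+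
  moreover have "\<exists>K. compact K \<and> K \<subseteq> S \<and> (\<forall>x. x \<notin> K \<longrightarrow> \<phi> x * \<eta> x = 0)"
  proof -
    obtain K where "compact K" "K \<subseteq> S" "\<And>x. x \<notin> K \<Longrightarrow> \<phi> x = 0"
      using assms(1) by (auto simp: test_function_def)
    then show ?thesis by (intro exI[of _ K]) simp
  qed
  moreover have "(\<lambda>x. \<phi> x * \<eta> x) differentiable (at x)" for x
    by (intro differentiable_mult a(3) b(3))
  ultimately show ?thesis
    unfolding test_function_def by simp
qed

text \<open>The product of two test functions is a test function, so its gradient has integral
  zero.\<close>

lemma integration_by_parts:
  assumes \<phi>: "test_function S \<phi>" and \<eta>: "test_function S \<eta>" and S: "S \<in> sets lebesgue"
  shows "(LINT x|lebesgue_on S. \<phi> x *\<^sub>R gradient \<eta> x) = - (LINT x|lebesgue_on S. \<eta> x *\<^sub>R gradient \<phi> x)"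
proof -
  note a = test_functionD[OF \<phi>] and b = test_functionD[OF \<eta>]
  have "compactly_supported S (\<lambda>x. \<phi> x *\<^sub>R gradient \<eta> x)" "compactly_supported S (\<lambda>x. \<eta> x *\<^sub>R gradient \<phi> x)"
    using compactly_supported_scaleR[OF a(1) compactly_supported_continuous[OF b(2)]]
      compactly_supported_scaleR[OF b(1) compactly_supported_continuous[OF a(2)]] by blast+
  then have "integrable (lebesgue_on S) (\<lambda>x. \<phi> x *\<^sub>R gradient \<eta> x)"
    "integrable (lebesgue_on S) (\<lambda>x. \<eta> x *\<^sub>R gradient \<phi> x)"
    using integral_compactly_supported S by blast+
  then have "(LINT x|lebesgue_on S. \<phi> x *\<^sub>R gradient \<eta> x) + (LINT x|lebesgue_on S. \<eta> x *\<^sub>R gradient \<phi> x)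
    = (LINT x|lebesgue_on S. gradient (\<lambda>x. \<phi> x * \<eta> x) x)"
    using gradient_mult[OF a(3) b(3)] by simp
  also have "\<dots> = 0" by (rule integral_gradient[OF test_function_mult[OF \<phi> \<eta>] S])
  finally show ?thesis by (simp add: add_eq_0_iff2)
qed

subsection \<open>The Euler equation of the minimizer\<close>

text \<open>The expansion shows the bulk energy of a varied stress as a quadratic polynomial in
  \<open>t\<close>, whose linear coefficient is the first variation.\<close>

lemma square_integrable_add:
  fixes f g :: "real^2 \<Rightarrow> real^2"
  assumes f: "square_integrable_on S f" and g: "square_integrable_on S g"
  shows "integrable (lebesgue_on S) (\<lambda>x. f x \<bullet> g x)"
    and "square_integrable_on S (\<lambda>x. f x + t *\<^sub>R g x)"
    and "(LINT x|lebesgue_on S. (norm (f x + t *\<^sub>R g x))\<^sup>2) =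
      (LINT x|lebesgue_on S. (norm (f x))\<^sup>2) + 2 * t * (LINT x|lebesgue_on S. f x \<bullet> g x)
      + t\<^sup>2 * (LINT x|lebesgue_on S. (norm (g x))\<^sup>2)"
proof -
  note d = f[unfolded square_integrable_on_def] g[unfolded square_integrable_on_def]
  have m: "f \<in> borel_measurable (lebesgue_on S)" "g \<in> borel_measurable (lebesgue_on S)" using d by auto
  have i: "integrable (lebesgue_on S) (\<lambda>x. (norm (f x))\<^sup>2)" "integrable (lebesgue_on S) (\<lambda>x. (norm (g x))\<^sup>2)"
    using d by auto
  show fg: "integrable (lebesgue_on S) (\<lambda>x. f x \<bullet> g x)"
  proof (rule Bochner_Integration.integrable_bound)
    show "integrable (lebesgue_on S) (\<lambda>x. (norm (f x))\<^sup>2 + (norm (g x))\<^sup>2)" using i by simp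
    show "(\<lambda>x. f x \<bullet> g x) \<in> borel_measurable (lebesgue_on S)" using m by measurable
    show "AE x in lebesgue_on S. norm (f x \<bullet> g x) \<le> norm ((norm (f x))\<^sup>2 + (norm (g x))\<^sup>2)"
    proof (rule AE_I2)
      fix x
      have "\<bar>f x \<bullet> g x\<bar> \<le> norm (f x) * norm (g x)" by (rule Cauchy_Schwarz_ineq2)
      moreover have "2 * (norm (f x) * norm (g x)) \<le> (norm (f x))\<^sup>2 + (norm (g x))\<^sup>2"
        using sum_squares_bound[of "norm (f x)" "norm (g x)"] by (simp add: mult.assoc)
      moreover have "0 \<le> norm (f x) * norm (g x)" by simp
      ultimately have "\<bar>f x \<bullet> g x\<bar> \<le> (norm (f x))\<^sup>2 + (norm (g x))\<^sup>2" by linarith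
      then show "norm (f x \<bullet> g x) \<le> norm ((norm (f x))\<^sup>2 + (norm (g x))\<^sup>2)" by simp
    qed
  qed
  have eq: "(norm (f x + t *\<^sub>R g x))\<^sup>2 = (norm (f x))\<^sup>2 + 2 * t * (f x \<bullet> g x) + t\<^sup>2 * (norm (g x))\<^sup>2" for x
    unfolding power2_norm_eq_inner inner_add_left inner_add_right inner_scaleR_left inner_scaleR_right
      inner_commute[of "g x" "f x"]
    by (simp add: power2_eq_square distrib_left mult.assoc)
  show "square_integrable_on S (\<lambda>x. f x + t *\<^sub>R g x)"
    unfolding square_integrable_on_def eq using i fg m by (auto intro!: borel_measurable_add borel_measurable_scaleR)
  show "(LINT x|lebesgue_on S. (norm (f x + t *\<^sub>R g x))\<^sup>2) =
      (LINT x|lebesgue_on S. (norm (f x))\<^sup>2) + 2 * t * (LINT x|lebesgue_on S. f x \<bullet> g x)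
      + t\<^sup>2 * (LINT x|lebesgue_on S. (norm (g x))\<^sup>2)"
    unfolding eq using i fg by simp
qed

section \<open>Admissible variations of the minimizer\<close>

lemma square_integrable_compactly_supported:
  fixes f :: "real^2 \<Rightarrow> 'a::euclidean_space"
  assumes "compactly_supported S f" "S \<in> sets lebesgue"
  shows "square_integrable_on S f"
proof -
  have "compactly_supported S (\<lambda>x. (norm (f x))\<^sup>2)"
    by (rule compactly_supported_compose[OF assms(1)]) (auto intro!: continuous_intros)
  then show ?thesis
    unfolding square_integrable_on_def
    using integral_compactly_supported(1) compactly_supported_measurable assms by blast
qed

lemma integrable_square_mult:
  fixes f :: "real^2 \<Rightarrow> real^2"
  assumes f: "square_integrable_on S f" and h: "compactly_supported S h" and S: "S \<in> sets lebesgue"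
  shows "integrable (lebesgue_on S) (\<lambda>x. h x *\<^sub>R f x)"
proof (rule Bochner_Integration.integrable_bound)
  have h2: "square_integrable_on S h" by (rule square_integrable_compactly_supported[OF h S])
  show "integrable (lebesgue_on S) (\<lambda>x. (norm (h x))\<^sup>2 + (norm (f x))\<^sup>2)"
    using f h2 by (simp add: square_integrable_on_def)
  have "h \<in> borel_measurable (lebesgue_on S)" "f \<in> borel_measurable (lebesgue_on S)"
    using f h2 by (auto simp: square_integrable_on_def)
  then show "(\<lambda>x. h x *\<^sub>R f x) \<in> borel_measurable (lebesgue_on S)" by (rule borel_measurable_scaleR)
  show "AE x in lebesgue_on S. norm (h x *\<^sub>R f x) \<le> norm ((norm (h x))\<^sup>2 + (norm (f x))\<^sup>2)"
  proof (rule AE_I2)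
    fix x
    have "2 * (\<bar>h x\<bar> * norm (f x)) \<le> (norm (h x))\<^sup>2 + (norm (f x))\<^sup>2"
      using sum_squares_bound[of "\<bar>h x\<bar>" "norm (f x)"] by (simp add: mult.assoc)
    moreover have "0 \<le> \<bar>h x\<bar> * norm (f x)" by simp
    ultimately have "\<bar>h x\<bar> * norm (f x) \<le> (norm (h x))\<^sup>2 + (norm (f x))\<^sup>2" by linarith
    then show "norm (h x *\<^sub>R f x) \<le> norm ((norm (h x))\<^sup>2 + (norm (f x))\<^sup>2)" by simp
  qed
qed

text \<open>Tested against a field of norm at most one, the added term is moved onto the gradient of
  \<phi> by parts. It therefore changes the supremum by at most \<bar>t\<bar> times the L1 norm of
  that gradient.\<close>

lemma BV_space_add_test_function:
  assumes S: "S \<in> sets lebesgue" and u: "BV_space S u" and \<phi>: "test_function S \<phi>"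
  shows "BV_space S (\<lambda>x. u x + t * \<phi> x)"
proof -
  note p = test_functionD[OF \<phi>]
  have iu: "integrable (lebesgue_on S) u" using u by (simp add: BV_space_def)
  have ip: "integrable (lebesgue_on S) \<phi>" using integral_compactly_supported(1)[OF p(1) S] .
  obtain B where B: "\<And>\<Phi>. (\<forall>i. test_function S (\<lambda>x. \<Phi> x $ i)) \<Longrightarrow> (\<forall>x. norm (\<Phi> x) \<le> 1) \<Longrightarrow>
      (LINT x|lebesgue_on S. u x * divergence \<Phi> x) \<le> B"
    using u unfolding BV_space_def bdd_above_def by blast
  define N where "N = (LINT x|lebesgue_on S. norm (gradient \<phi> x))"
  have "compactly_supported S (\<lambda>x. norm (gradient \<phi> x))"
    by (rule compactly_supported_compose[OF p(2)]) (auto intro!: continuous_intros)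
  then have iN: "integrable (lebesgue_on S) (\<lambda>x. norm (gradient \<phi> x))"
    using integral_compactly_supported(1) S by blast
  have "(LINT x|lebesgue_on S. (u x + t * \<phi> x) * divergence \<Phi> x) \<le> B + \<bar>t\<bar> * N"
    if \<Phi>: "\<forall>i. test_function S (\<lambda>x. \<Phi> x $ i)" "\<forall>x. norm (\<Phi> x) \<le> 1" for \<Phi>
  proof -
    define G where "G i = gradient (\<lambda>x. \<Phi> x $ i)" for i
    have div: "divergence \<Phi> = (\<lambda>x. G 1 x $ 1 + G 2 x $ 2)"
      by (simp add: fun_eq_iff divergence_def sum_2 G_def)
    have csG: "compactly_supported S (G i)" and cs\<Phi>: "compactly_supported S (\<lambda>x. \<Phi> x $ i)" for i
      using test_functionD(1,2)[of S "\<lambda>x. \<Phi> x $ i"] \<Phi>(1) unfolding G_def by auto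
    have csGi: "compactly_supported S (\<lambda>x. G i x $ j)" for i j
      by (rule compactly_supported_compose[OF csG]) (auto intro!: continuous_intros)
    have iuG: "integrable (lebesgue_on S) (\<lambda>x. u x *\<^sub>R (G i x $ j))" for i j
    proof -
      obtain c where "0 \<le> c" and c: "\<And>x. norm (G i x $ j) \<le> c"
        by (rule compactly_supported_bounded[OF csGi[of i j]]) (rule that)
      show ?thesis
        by (rule integrable_scaleR_bounded[OF iu compactly_supported_measurable[OF csGi[of i j] S] c])
    qed
    have cspG: "compactly_supported S (\<lambda>x. \<phi> x *\<^sub>R G i x)" for i
      by (intro compactly_supported_scaleR compactly_supported_continuous[OF csG] p(1))
    note ipG = integral_compactly_supported(1)[OF cspG S]
    have cs\<Phi>p: "compactly_supported S (\<lambda>x. \<Phi> x $ i *\<^sub>R gradient \<phi> x)" for i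
      by (intro compactly_supported_scaleR compactly_supported_continuous[OF p(2)] cs\<Phi>)
    note i\<Phi>p = integral_compactly_supported(1)[OF cs\<Phi>p S]
    have part: "(LINT x|lebesgue_on S. \<phi> x * (G i x $ i)) = - (LINT x|lebesgue_on S. \<Phi> x $ i * gradient \<phi> x $ i)" for i
    proof -
      have "(LINT x|lebesgue_on S. \<phi> x *\<^sub>R G i x) $ i = (- (LINT x|lebesgue_on S. \<Phi> x $ i *\<^sub>R gradient \<phi> x)) $ i"
        using integration_by_parts[OF \<phi> _ S, of "\<lambda>x. \<Phi> x $ i"] \<Phi>(1) by (simp add: G_def)
      then show ?thesis using integral_nth(1)[OF ipG] integral_nth(1)[OF i\<Phi>p] by simp
    qed
    have ii: "integrable (lebesgue_on S) (\<lambda>x. \<Phi> x $ i * gradient \<phi> x $ i)" for i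
      using integral_nth(2)[OF i\<Phi>p[of i], of i] by simp
    have ig: "integrable (lebesgue_on S) (\<lambda>x. \<phi> x * G i x $ i)" for i
      using integral_nth(2)[OF ipG[of i], of i] by simp
    have iuG': "integrable (lebesgue_on S) (\<lambda>x. u x * G i x $ i)" for i
      using iuG[of i i] by simp
    have eq: "(LINT x|lebesgue_on S. \<phi> x * divergence \<Phi> x) = - (LINT x|lebesgue_on S. \<Phi> x \<bullet> gradient \<phi> x)"
      unfolding div inner_vec2 using part[of 1] part[of 2] ig[of 1] ig[of 2] ii[of 1] ii[of 2]
      by (simp add: distrib_left)
    have "\<bar>LINT x|lebesgue_on S. \<Phi> x \<bullet> gradient \<phi> x\<bar> \<le> N"
    proof -
      have "integrable (lebesgue_on S) (\<lambda>x. \<Phi> x \<bullet> gradient \<phi> x)"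
        unfolding inner_vec2 using ii by simp
      then have "norm (LINT x|lebesgue_on S. \<Phi> x \<bullet> gradient \<phi> x) \<le> N"
        unfolding N_def
      proof (rule Bochner_Integration.integral_norm_bound_integral[OF _ iN])
        fix x
        have "\<bar>\<Phi> x \<bullet> gradient \<phi> x\<bar> \<le> norm (\<Phi> x) * norm (gradient \<phi> x)" by (rule Cauchy_Schwarz_ineq2)
        also have "\<dots> \<le> 1 * norm (gradient \<phi> x)" using \<Phi>(2) by (intro mult_right_mono) auto
        finally show "norm (\<Phi> x \<bullet> gradient \<phi> x) \<le> norm (gradient \<phi> x)" by simp
      qed
      then show ?thesis by simp
    qed
    then have bound: "\<bar>LINT x|lebesgue_on S. \<phi> x * divergence \<Phi> x\<bar> \<le> N" using eq by simp
    have "integrable (lebesgue_on S) (\<lambda>x. u x * divergence \<Phi> x)"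
      "integrable (lebesgue_on S) (\<lambda>x. \<phi> x * divergence \<Phi> x)"
      unfolding div using iuG' ig by (simp_all add: distrib_left)
    then have "(LINT x|lebesgue_on S. (u x + t * \<phi> x) * divergence \<Phi> x) =
      (LINT x|lebesgue_on S. u x * divergence \<Phi> x) + t * (LINT x|lebesgue_on S. \<phi> x * divergence \<Phi> x)"
      by (simp add: distrib_right mult.assoc)
    moreover have "t * (LINT x|lebesgue_on S. \<phi> x * divergence \<Phi> x) \<le> \<bar>t\<bar> * N"
    proof -
      have "t * (LINT x|lebesgue_on S. \<phi> x * divergence \<Phi> x)
          \<le> \<bar>t\<bar> * \<bar>LINT x|lebesgue_on S. \<phi> x * divergence \<Phi> x\<bar>"
        by (simp flip: abs_mult)
      also have "\<dots> \<le> \<bar>t\<bar> * N" using bound by (intro mult_left_mono) auto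
      finally show ?thesis .
    qed
    ultimately show ?thesis using B[OF \<Phi>] by linarith
  qed
  then show ?thesis
    unfolding BV_space_def bdd_above_def using iu ip by auto
qed

text \<open>The support of \<phi> is a compact subset of the open set \<open>S\<close>, so
  sufficiently small balls about a boundary point do not meet it.\<close>

lemma boundary_trace_add_test_function:
  assumes "open S" and t: "boundary_trace S u tu" and \<phi>: "test_function S \<phi>"
  shows "boundary_trace S (\<lambda>x. u x + t * \<phi> x) tu"
proof -
  obtain K where K: "compact K" "K \<subseteq> S" "\<And>x. x \<notin> K \<Longrightarrow> \<phi> x = 0"
    using \<phi> by (auto simp: test_function_def)
  have "((\<lambda>r. (LINT y|lebesgue_on (S \<inter> ball x r). \<bar>u y + t * \<phi> y - tu x\<bar>) / r\<^sup>2) \<longlongrightarrow> 0) (at_right 0)"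
    if x: "x \<in> frontier S"
      and lim: "((\<lambda>r. (LINT y|lebesgue_on (S \<inter> ball x r). \<bar>u y - tu x\<bar>) / r\<^sup>2) \<longlongrightarrow> 0) (at_right 0)" for x
  proof (rule Lim_transform_eventually[OF lim])
    have "x \<in> - K" using x K(2) \<open>open S\<close> by (auto simp: frontier_def interior_open)
    then obtain e where e: "e > 0" "ball x e \<subseteq> - K"
      using K(1) by (meson compact_imp_closed open_Compl openE)
    show "\<forall>\<^sub>F r in at_right 0. (LINT y|lebesgue_on (S \<inter> ball x r). \<bar>u y - tu x\<bar>) / r\<^sup>2 =
        (LINT y|lebesgue_on (S \<inter> ball x r). \<bar>u y + t * \<phi> y - tu x\<bar>) / r\<^sup>2"
      unfolding eventually_at_right_field
    proof (intro exI[of _ e] conjI allI impI)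
      fix r assume r: "0 < r" "r < e"
      have "(LINT y|lebesgue_on (S \<inter> ball x r). \<bar>u y - tu x\<bar>) =
          (LINT y|lebesgue_on (S \<inter> ball x r). \<bar>u y + t * \<phi> y - tu x\<bar>)"
      proof (rule Bochner_Integration.integral_cong[OF refl])
        fix y assume "y \<in> space (lebesgue_on (S \<inter> ball x r))"
        then have "y \<in> ball x e" using r by auto
        then have "y \<notin> K" using e by blast
        then show "\<bar>u y - tu x\<bar> = \<bar>u y + t * \<phi> y - tu x\<bar>" using K(3) by simp
      qed
      then show "(LINT y|lebesgue_on (S \<inter> ball x r). \<bar>u y - tu x\<bar>) / r\<^sup>2 =
        (LINT y|lebesgue_on (S \<inter> ball x r). \<bar>u y + t * \<phi> y - tu x\<bar>) / r\<^sup>2" by simp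
    qed (rule e)
  qed
  then show ?thesis
    using t unfolding boundary_trace_def by (auto elim!: eventually_mono)
qed

text \<open>Integration by parts shows that the added function and the added stress balance in the
  distributional equation, so the same measure \<open>p\<close> remains compatible; its boundary
  part is preserved because the trace does not change.\<close>

lemma admissible_add_test_function:
  assumes "open \<Omega>" and adm: "admissible \<Omega> \<nu> w u \<sigma> p" and \<phi>: "test_function \<Omega> \<phi>"
  shows "admissible \<Omega> \<nu> w (\<lambda>x. u x + t * \<phi> x) (\<lambda>x. \<sigma> x + t *\<^sub>R gradient \<phi> x) p"
proof -
  have S: "\<Omega> \<in> sets lebesgue" using \<open>open \<Omega>\<close> by auto
  note a = adm[unfolded admissible_def]
  note p = test_functionD[OF \<phi>]
  have bv: "BV_space \<Omega> (\<lambda>x. u x + t * \<phi> x)"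
    by (rule BV_space_add_test_function[OF S _ \<phi>]) (use a in blast)
  have sq: "square_integrable_on \<Omega> (\<lambda>x. \<sigma> x + t *\<^sub>R gradient \<phi> x)"
    by (rule square_integrable_add(2)[OF _ square_integrable_compactly_supported[OF p(2) S]]) (use a in blast)
  have eq: "(LINT x|lebesgue_on \<Omega>. (u x + t * \<phi> x) *\<^sub>R gradient \<eta> x) =
     - ((LINT x|lebesgue_on \<Omega>. \<eta> x *\<^sub>R (\<sigma> x + t *\<^sub>R gradient \<phi> x)) + vector_measure_integral \<Omega> p \<eta>)"
    if \<eta>: "test_function \<Omega> \<eta>" for \<eta>
  proof -
    note e = test_functionD[OF \<eta>]
    have iu: "integrable (lebesgue_on \<Omega>) u" using a by (simp add: BV_space_def)
    obtain B where B: "\<And>x. norm (gradient \<eta> x) \<le> B" using compactly_supported_bounded[OF e(2)] by blast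
    have i1: "integrable (lebesgue_on \<Omega>) (\<lambda>x. u x *\<^sub>R gradient \<eta> x)"
      by (rule integrable_scaleR_bounded[OF iu compactly_supported_measurable[OF e(2) S] B])
    have "compactly_supported \<Omega> (\<lambda>x. \<phi> x *\<^sub>R gradient \<eta> x)" "compactly_supported \<Omega> (\<lambda>x. \<eta> x *\<^sub>R gradient \<phi> x)"
      using compactly_supported_scaleR[OF p(1) compactly_supported_continuous[OF e(2)]]
        compactly_supported_scaleR[OF e(1) compactly_supported_continuous[OF p(2)]] by blast+
    then have i2: "integrable (lebesgue_on \<Omega>) (\<lambda>x. \<phi> x *\<^sub>R gradient \<eta> x)"
      and i3: "integrable (lebesgue_on \<Omega>) (\<lambda>x. \<eta> x *\<^sub>R gradient \<phi> x)"
      using integral_compactly_supported(1) S by blast+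
    have i4: "integrable (lebesgue_on \<Omega>) (\<lambda>x. \<eta> x *\<^sub>R \<sigma> x)"
      by (rule integrable_square_mult[OF _ e(1) S]) (use a in blast)
    have "(LINT x|lebesgue_on \<Omega>. (u x + t * \<phi> x) *\<^sub>R gradient \<eta> x) =
      (LINT x|lebesgue_on \<Omega>. u x *\<^sub>R gradient \<eta> x + t *\<^sub>R (\<phi> x *\<^sub>R gradient \<eta> x))"
      by (simp add: scaleR_left_distrib)
    also have "\<dots> = (LINT x|lebesgue_on \<Omega>. u x *\<^sub>R gradient \<eta> x) + t *\<^sub>R (LINT x|lebesgue_on \<Omega>. \<phi> x *\<^sub>R gradient \<eta> x)"
      by (simp only: Bochner_Integration.integral_add[OF i1 integrable_scaleR_right[OF i2]] integral_scaleR_right)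
    also have "\<dots> = - ((LINT x|lebesgue_on \<Omega>. \<eta> x *\<^sub>R \<sigma> x) + vector_measure_integral \<Omega> p \<eta>)
        - t *\<^sub>R (LINT x|lebesgue_on \<Omega>. \<eta> x *\<^sub>R gradient \<phi> x)"
      using a \<eta> integration_by_parts[OF \<phi> \<eta> S] by simp
    also have "\<dots> = - (((LINT x|lebesgue_on \<Omega>. \<eta> x *\<^sub>R \<sigma> x) + t *\<^sub>R (LINT x|lebesgue_on \<Omega>. \<eta> x *\<^sub>R gradient \<phi> x))
        + vector_measure_integral \<Omega> p \<eta>)"
      by simp
    also have "(LINT x|lebesgue_on \<Omega>. \<eta> x *\<^sub>R \<sigma> x) + t *\<^sub>R (LINT x|lebesgue_on \<Omega>. \<eta> x *\<^sub>R gradient \<phi> x)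
      = (LINT x|lebesgue_on \<Omega>. \<eta> x *\<^sub>R \<sigma> x + t *\<^sub>R (\<eta> x *\<^sub>R gradient \<phi> x))"
      by (simp only: Bochner_Integration.integral_add[OF i4 integrable_scaleR_right[OF i3]] integral_scaleR_right)
    also have "\<dots> = (LINT x|lebesgue_on \<Omega>. \<eta> x *\<^sub>R (\<sigma> x + t *\<^sub>R gradient \<phi> x))"
      by (simp add: scaleR_right_distrib mult.commute)
    finally show ?thesis .
  qed
  obtain tu tw where tr: "boundary_trace \<Omega> u tu" "boundary_trace \<Omega> w tw"
    "\<forall>B\<in>sets borel. B \<subseteq> frontier \<Omega> \<longrightarrow> p B = (LINT x:B|hausdorff1. (tw x - tu x) *\<^sub>R \<nu> x)"
    using a by blast
  have "boundary_trace \<Omega> (\<lambda>x. u x + t * \<phi> x) tu"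
    by (rule boundary_trace_add_test_function[OF \<open>open \<Omega>\<close> tr(1) \<phi>])
  then show ?thesis
    unfolding admissible_def using bv sq eq a tr by blast
qed

text \<open>First variation in the direction \<open>(\<phi>, \<nabla>\<phi>, 0)\<close>, which does not touch the measure.\<close>

lemma minimizer_divergence_free:
  assumes "open \<Omega>" and min: "minimizer \<Omega> \<nu> w u \<sigma> p" and \<phi>: "test_function \<Omega> \<phi>"
  shows "(LINT x|lebesgue_on \<Omega>. \<sigma> x \<bullet> gradient \<phi> x) = 0"
proof -
  have S: "\<Omega> \<in> sets lebesgue" using \<open>open \<Omega>\<close> by auto
  have adm: "admissible \<Omega> \<nu> w u \<sigma> p" using min by (simp add: minimizer_def)
  have sq: "square_integrable_on \<Omega> \<sigma>" using adm by (simp add: admissible_def)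
  have sg: "square_integrable_on \<Omega> (gradient \<phi>)"
    by (rule square_integrable_compactly_supported[OF test_functionD(2)[OF \<phi>] S])
  define A where "A = (LINT x|lebesgue_on \<Omega>. (norm (\<sigma> x))\<^sup>2)"
  define X where "X = (LINT x|lebesgue_on \<Omega>. \<sigma> x \<bullet> gradient \<phi> x)"
  define Y where "Y = (LINT x|lebesgue_on \<Omega>. (norm (gradient \<phi> x))\<^sup>2)"
  \<comment> \<open>Finiteness permits cancelling the measure term from both energies in the
    extended reals.\<close>
  have TV: "total_variation (closure \<Omega>) p < \<infinity>"
    using adm by (simp add: admissible_def vector_measure_on_def)
  have energy_eq: "energy \<Omega> f p = ennreal (1/2) * ennreal (LINT x|lebesgue_on \<Omega>. (norm (f x))\<^sup>2)
      + total_variation (closure \<Omega>) p" if "square_integrable_on \<Omega> f" for f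
    using that by (simp add: energy_def square_integrable_on_def nn_integral_eq_integral)
  have le: "0 \<le> 2 * t * X + t\<^sup>2 * Y" for t
  proof -
    let ?f = "\<lambda>x. \<sigma> x + t *\<^sub>R gradient \<phi> x"
    have sf: "square_integrable_on \<Omega> ?f" by (rule square_integrable_add(2)[OF sq sg])
    have "energy \<Omega> \<sigma> p \<le> energy \<Omega> ?f p"
      using min admissible_add_test_function[OF \<open>open \<Omega>\<close> adm \<phi>] unfolding minimizer_def by blast
    then have "ennreal (1/2) * ennreal A \<le> ennreal (1/2) * ennreal (LINT x|lebesgue_on \<Omega>. (norm (?f x))\<^sup>2)"
      unfolding energy_eq[OF sq] energy_eq[OF sf] A_def using TV
      by (auto simp: add.commute[of _ "total_variation (closure \<Omega>) p"] ennreal_add_left_cancel_le)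
    moreover have "ennreal (1/2) * ennreal x = ennreal (1/2 * x)" for x
      by (rule ennreal_mult'[symmetric]) simp
    ultimately have "ennreal (1/2 * A) \<le> ennreal (1/2 * (LINT x|lebesgue_on \<Omega>. (norm (?f x))\<^sup>2))"
      by (simp only:)
    then have "1/2 * A \<le> 1/2 * (LINT x|lebesgue_on \<Omega>. (norm (?f x))\<^sup>2)"
      by (subst (asm) ennreal_le_iff) auto
    then show ?thesis
      unfolding square_integrable_add(3)[OF sq sg] A_def X_def Y_def by simp
  qed
  have Y: "Y \<ge> 0" by (simp add: Y_def)
  have "X = 0"
  proof (rule ccontr)
    assume "X \<noteq> 0"
    \<comment> \<open>The quadratic is minimal at \<open>- X / Y\<close>; the denominator
      \<open>Y + 1\<close> avoids the case \<open>Y = 0\<close> and still makes the value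
      negative.\<close>
    define t where "t = - X / (Y + 1)"
    have tY: "t * (Y + 1) = - X" using Y by (simp add: t_def)
    have "(Y + 1)\<^sup>2 * (2 * t * X + t\<^sup>2 * Y) = 2 * (Y + 1) * X * (t * (Y + 1)) + (t * (Y + 1))\<^sup>2 * Y"
      by (simp add: power2_eq_square algebra_simps)
    also have "\<dots> = - (X\<^sup>2 * (Y + 2))"
      unfolding tY by (simp add: power2_eq_square algebra_simps)
    also have "\<dots> < 0" using Y \<open>X \<noteq> 0\<close> by (simp add: mult_pos_pos)
    finally have "(Y + 1)\<^sup>2 * (2 * t * X + t\<^sup>2 * Y) < 0" .
    moreover have "(Y + 1)\<^sup>2 * (2 * t * X + t\<^sup>2 * Y) \<ge> 0"
      using le[of t] by (intro mult_nonneg_nonneg) auto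
    ultimately show False by simp
  qed
  then show ?thesis by (simp add: X_def)
qed

subsection \<open>Mollification\<close>

text \<open>Squaring the positive part makes this kernel continuously differentiable with support in
  the closed ball of radius \<open>e\<close>. Its mass is left unnormalised and divided out
  later.\<close>

definition bump :: "real \<Rightarrow> real^2 \<Rightarrow> real" where
  "bump e z = (max 0 (e\<^sup>2 - z \<bullet> z))\<^sup>2"

definition bump_grad :: "real \<Rightarrow> real^2 \<Rightarrow> real^2" where
  "bump_grad e z = (- 4 * max 0 (e\<^sup>2 - z \<bullet> z)) *\<^sub>R z"

lemma has_real_derivative_max_power2:
  "((\<lambda>u::real. (max 0 u)\<^sup>2) has_real_derivative 2 * max 0 u) (at u)"
proof (cases "u = 0")
  case True
  have "((\<lambda>h::real. max 0 h) \<longlongrightarrow> max 0 0) (at 0)" by (intro tendsto_intros)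
  then have "((\<lambda>h::real. max 0 h) \<longlongrightarrow> 0) (at 0)" by simp
  then have "((\<lambda>h::real. (max 0 h)\<^sup>2 / h) \<longlongrightarrow> 0) (at 0)"
    by (rule Lim_transform_eventually)
      (auto simp: eventually_at max_def power2_eq_square intro!: exI[of _ 1])
  then show ?thesis using True by (simp add: DERIV_def)
next
  case False
  then consider "u > 0" | "u < 0" by linarith
  then show ?thesis
  proof cases
    case 1
    have "((\<lambda>u::real. u\<^sup>2) has_real_derivative 2 * max 0 u) (at u)"
      using 1 by (auto intro!: derivative_eq_intros)
    then show ?thesis
      by (rule has_field_derivative_transform_within_open[where S="{0<..}"]) (use 1 in auto)
  next
    case 2
    have "((\<lambda>u::real. 0) has_real_derivative 2 * max 0 u) (at u)"
      using 2 by (auto intro!: derivative_eq_intros)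
    then show ?thesis
      by (rule has_field_derivative_transform_within_open[where S="{..<0}"]) (use 2 in auto)
  qed
qed

lemma has_derivative_bump: "(bump e has_derivative (\<lambda>h. bump_grad e z \<bullet> h)) (at z)"
proof -
  have "((\<lambda>z::real^2. e\<^sup>2 - z \<bullet> z) has_derivative (\<lambda>h. - (2 * (z \<bullet> h)))) (at z)"
    by (auto intro!: derivative_eq_intros simp: inner_commute)
  moreover have "((\<lambda>u::real. (max 0 u)\<^sup>2) has_derivative (\<lambda>h. (2 * max 0 (e\<^sup>2 - z \<bullet> z)) * h)) (at (e\<^sup>2 - z \<bullet> z))"
    using has_real_derivative_max_power2 by (simp add: has_field_derivative_def)
  ultimately have "((\<lambda>z::real^2. (max 0 (e\<^sup>2 - z \<bullet> z))\<^sup>2) has_derivative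
      (\<lambda>h. (2 * max 0 (e\<^sup>2 - z \<bullet> z)) * (- (2 * (z \<bullet> h))))) (at z)"
    by (rule has_derivative_compose)
  moreover have "(\<lambda>h. (2 * max 0 (e\<^sup>2 - z \<bullet> z)) * (- (2 * (z \<bullet> h)))) = (\<lambda>h. bump_grad e z \<bullet> h)"
    by (simp add: fun_eq_iff bump_grad_def)
  ultimately show ?thesis by (simp add: bump_def[abs_def])
qed

lemma continuous_on_bump [continuous_intros]:
  "continuous_on S f \<Longrightarrow> continuous_on S (\<lambda>x. bump e (f x))"
  unfolding bump_def by (intro continuous_intros)

lemma continuous_on_bump_grad [continuous_intros]:
  "continuous_on S f \<Longrightarrow> continuous_on S (\<lambda>x. bump_grad e (f x))"
  unfolding bump_grad_def by (intro continuous_intros)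

lemma bump_nonneg: "bump e z \<ge> 0"
  by (simp add: bump_def)

lemma bump_outside:
  assumes "0 < e" "z \<notin> cball 0 e"
  shows "bump e z = 0" "bump_grad e z = 0"
proof -
  have "e\<^sup>2 \<le> (norm z)\<^sup>2" using assms by (intro power_mono) auto
  then show "bump e z = 0" "bump_grad e z = 0"
    by (auto simp: bump_def bump_grad_def dot_square_norm)
qed

text \<open>The derivative falls on the kernel, so \<open>f\<close> need only be continuous on the
  box. The formula holds at every \<open>x\<close>, as the global differentiability assumed in
  \<open>poincare_plane\<close> demands.\<close>

lemma convolution_has_derivative:
  fixes f :: "real^2 \<Rightarrow> real"
  assumes f: "continuous_on (cbox a b) f"
  shows "((\<lambda>x. integral (cbox a b) (\<lambda>y. bump e (x - y) * f y)) has_derivative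
      (\<lambda>h. integral (cbox a b) (\<lambda>y. f y *\<^sub>R bump_grad e (x - y)) \<bullet> h)) (at x)"
    and "continuous_on UNIV (\<lambda>x. integral (cbox a b) (\<lambda>y. f y *\<^sub>R bump_grad e (x - y)))"
proof -
  let ?V = "\<lambda>x y. f y *\<^sub>R bump_grad e (x - y)"
  have fsnd: "continuous_on (UNIV \<times> cbox a b) (\<lambda>z. f (snd z))"
    by (rule continuous_on_compose2[OF f]) (auto intro!: continuous_intros)
  have cV: "continuous_on (UNIV \<times> cbox a b) (\<lambda>(x, y). ?V x y)"
    unfolding split_beta by (intro continuous_intros fsnd)
  have cVx: "continuous_on (cbox a b) (?V x)" for x
    by (intro continuous_intros f)
  have der: "((\<lambda>x. bump e (x - y) * f y) has_derivative blinfun_apply (blinfun_inner_right (?V x y))) (at x within UNIV)"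
    for x y
  proof -
    have "((\<lambda>x. bump e (x - y)) has_derivative (\<lambda>h. bump_grad e (x - y) \<bullet> h)) (at x)"
      by (rule has_derivative_compose[OF _ has_derivative_bump]) (auto intro!: derivative_eq_intros)
    then have "((\<lambda>x. bump e (x - y) * f y) has_derivative (\<lambda>h. (bump_grad e (x - y) \<bullet> h) * f y)) (at x)"
      by (rule has_derivative_mult_left)
    moreover have "(\<lambda>h. (bump_grad e (x - y) \<bullet> h) * f y) = blinfun_apply (blinfun_inner_right (?V x y))"
      by (simp add: fun_eq_iff mult.commute)
    ultimately show ?thesis by simp
  qed
  have "((\<lambda>x. integral (cbox a b) (\<lambda>y. bump e (x - y) * f y)) has_derivative
      blinfun_apply (integral (cbox a b) (\<lambda>y. blinfun_inner_right (?V x y)))) (at x within UNIV)"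
  proof (rule leibniz_rule[OF der])
    show "(\<lambda>y. bump e (x - y) * f y) integrable_on cbox a b" for x
      by (intro integrable_continuous continuous_intros f)
    show "continuous_on (UNIV \<times> cbox a b) (\<lambda>(x, y). blinfun_inner_right (?V x y))"
      using bounded_linear.continuous_on[OF bounded_linear_blinfun_inner_right cV]
      by (simp add: split_beta)
  qed auto
  moreover have "integral (cbox a b) (\<lambda>y. blinfun_inner_right (?V x y)) = blinfun_inner_right (integral (cbox a b) (?V x))"
    using integral_linear[OF integrable_continuous[OF cVx] bounded_linear_blinfun_inner_right] by (simp add: o_def)
  ultimately show "((\<lambda>x. integral (cbox a b) (\<lambda>y. bump e (x - y) * f y)) has_derivative
      (\<lambda>h. integral (cbox a b) (?V x) \<bullet> h)) (at x)"
    by simp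
  show "continuous_on UNIV (\<lambda>x. integral (cbox a b) (?V x))"
    by (rule integral_continuous_on_param[OF cV])
qed

lemma test_function_bump:
  assumes "0 < e" "cball x e \<subseteq> S"
  shows "test_function S (\<lambda>y. bump e (x - y))" "gradient (\<lambda>y. bump e (x - y)) y = - bump_grad e (x - y)"
proof -
  have d: "((\<lambda>y. bump e (x - y)) has_derivative (\<lambda>h. (- bump_grad e (x - y)) \<bullet> h)) (at y)" for y
  proof -
    have "((\<lambda>y. bump e (x - y)) has_derivative (\<lambda>h. bump_grad e (x - y) \<bullet> (- h))) (at y)"
      by (rule has_derivative_compose[OF _ has_derivative_bump]) (auto intro!: derivative_eq_intros)
    then show ?thesis by simp
  qed
  show g: "gradient (\<lambda>y. bump e (x - y)) y = - bump_grad e (x - y)" for y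
    by (rule gradient_eqI[OF d])
  have "continuous_on UNIV (gradient (\<lambda>y. bump e (x - y)))"
    unfolding g[abs_def] by (intro continuous_intros)
  moreover have "bump e (x - y) = 0" if "y \<notin> cball x e" for y
    by (rule bump_outside(1)) (use that assms in \<open>auto simp: dist_norm norm_minus_commute\<close>)
  ultimately show "test_function S (\<lambda>y. bump e (x - y))"
    unfolding test_function_def using d assms(2) differentiableI by (metis compact_cball)
qed

text \<open>Links the weak divergence, a Lebesgue integral over \<open>S\<close>, to the gauge
  integrals over boxes in which the mollification is differentiated.\<close>

lemma integral_lebesgue_on_cbox:
  fixes f :: "real^2 \<Rightarrow> real"
  assumes S: "S \<in> sets lebesgue" "cbox a b \<subseteq> S" and f: "continuous_on (cbox a b) f"
    and z: "\<And>x. x \<in> S \<Longrightarrow> x \<notin> cbox a b \<Longrightarrow> f x = 0"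
  shows "(LINT x|lebesgue_on S. f x) = integral (cbox a b) f"
proof -
  have i: "integrable lborel (\<lambda>x. indicator (cbox a b) x *\<^sub>R f x)"
    by (intro borel_integrable_compact f) auto
  have eq: "(\<lambda>x. indicator S x *\<^sub>R f x) = (\<lambda>x. indicator (cbox a b) x *\<^sub>R f x)"
    using S(2) z by (auto simp: fun_eq_iff indicator_def)
  have "(LINT x|lebesgue_on S. f x) = (LINT x|lebesgue. indicator (cbox a b) x *\<^sub>R f x)"
    using integral_restrict_space[of S lebesgue f] S(1) eq by simp
  also have "\<dots> = (LINT x|lborel. indicator (cbox a b) x *\<^sub>R f x)"
    using i by (intro integral_completion) auto
  also have "\<dots> = integral (cbox a b) f"
    using set_borel_integral_eq_integral(2)[of "cbox a b" f] i
    by (simp add: set_integrable_def set_lebesgue_integral_def)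
  finally show ?thesis .
qed

text \<open>Translation invariance makes the mass independent of the centre and of the surrounding
  box. It is positive because a continuous nonnegative function with integral zero vanishes, while
  the kernel is positive at its centre.\<close>

lemma bump_mass:
  assumes "0 < e"
  shows "\<exists>c>0. \<forall>x a b. cball x e \<subseteq> cbox a b \<longrightarrow> integral (cbox a b) (\<lambda>y. bump e (x - y)) = c"
proof -
  define c where "c = (LINT y|lborel. bump e (- y))"
  have eq: "integral (cbox a b) (\<lambda>y. bump e (x - y)) = c" if "cball x e \<subseteq> cbox a b" for x a b
  proof -
    have "integral (cbox a b) (\<lambda>y. bump e (x - y)) = (LINT y|lebesgue_on UNIV. bump e (x - y))"
    proof (rule integral_lebesgue_on_cbox[symmetric])
      show "continuous_on (cbox a b) (\<lambda>y. bump e (x - y))" by (intro continuous_intros)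
      show "bump e (x - y) = 0" if "y \<notin> cbox a b" for y
        by (rule bump_outside(1)[OF assms]) (use that \<open>cball x e \<subseteq> _\<close> in \<open>auto simp: dist_norm norm_minus_commute\<close>)
    qed auto
    also have "\<dots> = (LINT y|lborel. bump e (x - y))"
      unfolding lebesgue_on_UNIV_eq
      by (intro integral_completion) (auto intro!: borel_measurable_continuous_onI continuous_intros)
    also have "\<dots> = (LINT y|lborel. bump e (x - (x + y)))"
      by (rule lborel_integral_shift(1)[symmetric])
        (auto intro!: borel_measurable_continuous_onI continuous_intros)
    finally show ?thesis by (simp add: c_def)
  qed
  have pos: "c > 0"
  proof -
    have "bounded (cball (0::real^2) e)" by simp
    then obtain a where a: "cball (0::real^2) e \<subseteq> cbox (-a) a" using bounded_subset_cbox_symmetric by blast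
    have c: "integral (cbox (-a) a) (\<lambda>y. bump e (0 - y)) = c" by (rule eq[OF a])
    have cont: "continuous_on (cbox (-a) a) (\<lambda>y. bump e (0 - y))" by (intro continuous_intros)
    have "(\<lambda>y. bump e (0 - y)) integrable_on cbox (-a) a" by (rule integrable_continuous[OF cont])
    then have hi: "((\<lambda>y. bump e (0 - y)) has_integral c) (cbox (-a) a)"
      using c by (metis integrable_integral)
    have "c \<ge> 0" by (rule has_integral_nonneg[OF hi bump_nonneg])
    moreover have "c \<noteq> 0"
    proof
      assume "c = 0"
      have "ball (0::real^2) e \<subseteq> interior (cbox (-a) a)"
        by (rule interior_maximal) (use a ball_subset_cball in \<open>auto\<close>)
      then have "0 \<in> box (-a) a" using assms by (simp add: subset_iff)
      then have ne: "box (-a) a \<noteq> {}" by blast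
      have "0 \<in> cbox (-a) a" using a assms by (simp add: subset_iff)
      then have "bump e (0 - 0) = 0"
        using has_integral_0_cbox_imp_0[OF cont bump_nonneg, of 0] hi \<open>c = 0\<close> ne by blast
      then show False using assms by (simp add: bump_def)
    qed
    ultimately show ?thesis by simp
  qed
  show ?thesis
    by (rule exI[of _ c]) (use pos eq in auto)
qed

text \<open>Locally, a continuous divergence-free field is a rotated gradient; mollifying reduces this to the \<open>C\<^sup>1\<close> case.\<close>

lemma divergence_free_potential:
  fixes s :: "real^2 \<Rightarrow> real^2"
  assumes S: "open S" and cont: "continuous_on S s"
    and div: "\<And>\<phi>. test_function S \<phi> \<Longrightarrow> (LINT x|lebesgue_on S. s x \<bullet> gradient \<phi> x) = 0"
    and x0: "x0 \<in> S"
  obtains r \<psi> where "r > 0" "ball x0 r \<subseteq> S"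
    "\<And>x. x \<in> ball x0 r \<Longrightarrow> (\<psi> has_derivative (\<lambda>h. perp (s x) \<bullet> h)) (at x)"
proof -
  obtain a b where ab: "x0 \<in> box a b" "cbox a b \<subseteq> S"
    using open_contains_cbox[OF S] x0 by metis
  obtain d where d: "d > 0" "ball x0 d \<subseteq> box a b"
    using ab(1) open_box by (meson openE)
  \<comment> \<open>Half the radius is kept in reserve, so that mollifying at points of
    \<open>ball x0 r\<close> with radius below \<open>r\<close> never leaves the box.\<close>
  define r where "r = d / 2"
  have r: "r > 0" using d by (simp add: r_def)
  have inbox: "cball x e \<subseteq> cbox a b" if "x \<in> ball x0 r" "e < r" for x e
  proof
    fix y assume "y \<in> cball x e"
    then have "dist x0 y < d" using that dist_triangle[of x0 y x] by (simp add: r_def)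
    then have "y \<in> box a b" using d(2) by (auto simp: subset_eq)
    then show "y \<in> cbox a b" using box_subset_cbox[of a b] by blast
  qed
  have cs: "continuous_on (cbox a b) s" using cont ab(2) by (rule continuous_on_subset)
  have csi: "continuous_on (cbox a b) (\<lambda>y. s y $ i)" for i by (intro continuous_intros cs)
  have sets: "S \<in> sets lebesgue" using S by auto
  \<comment> \<open>The shift by two gives \<open>e n < r\<close> already at
    \<open>n = 0\<close>.\<close>
  define e where "e n = r / real (n + 2)" for n
  have e: "0 < e n" "e n < r" for n
    using r mult_strict_left_mono[of 1 "real (n + 2)" r] by (simp_all add: e_def divide_less_eq)
  have "\<exists>c. \<forall>n. c n > 0 \<and> (\<forall>x a b. cball x (e n) \<subseteq> cbox a b \<longrightarrow> integral (cbox a b) (\<lambda>y. bump (e n) (x - y)) = c n)"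
    by (rule choice) (use bump_mass[OF e(1)] in blast)
  then obtain c where c: "\<And>n. c n > 0"
    "\<And>n x a b. cball x (e n) \<subseteq> cbox a b \<Longrightarrow> integral (cbox a b) (\<lambda>y. bump (e n) (x - y)) = c n"
    by blast
  define I where "I n i x = integral (cbox a b) (\<lambda>y. bump (e n) (x - y) * s y $ i)" for n i x
  define g where "g n i x = integral (cbox a b) (\<lambda>y. s y $ i *\<^sub>R bump_grad (e n) (x - y))" for n i x
  define F where "F n x = (vector [- I n 2 x, I n 1 x] :: real^2)" for n x
  have dI: "(I n i has_derivative (\<lambda>h. g n i x \<bullet> h)) (at x)" for n i x
    unfolding I_def g_def by (rule convolution_has_derivative(1)[OF csi])
  have cg: "continuous_on UNIV (g n i)" for n i
    unfolding g_def by (rule convolution_has_derivative(2)[OF csi])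
  \<comment> \<open>Testing the weak equation with the kernel centred at \<open>x\<close> shows that
    the mollified field has zero divergence, which is the curl condition for its rotation
    \<open>F n\<close>.\<close>
  have div0: "g n 1 x $ 1 + g n 2 x $ 2 = 0" if x: "x \<in> ball x0 r" for n x
  proof -
    let ?G = "\<lambda>y. bump_grad (e n) (x - y)"
    have sub: "cball x (e n) \<subseteq> cbox a b" by (rule inbox[OF x e(2)])
    have int: "(\<lambda>y. s y $ i *\<^sub>R ?G y) integrable_on cbox a b" for i
      by (intro integrable_continuous continuous_intros csi)
    have int': "(\<lambda>y. s y $ i * ?G y $ j) integrable_on cbox a b" for i j
      by (intro integrable_continuous continuous_intros csi)
    have comp: "g n i x $ j = integral (cbox a b) (\<lambda>y. s y $ i * ?G y $ j)" for i j
      unfolding g_def using integral_linear[OF int[of i] bounded_linear_vec_nth[of j]] by (simp add: o_def)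
    note tf = test_function_bump[OF e(1)[of n] order_trans[OF sub ab(2)]]
    have "0 = (LINT y|lebesgue_on S. s y \<bullet> gradient (\<lambda>y. bump (e n) (x - y)) y)"
      using div[OF tf(1)] by simp
    also have "\<dots> = (LINT y|lebesgue_on S. - (s y \<bullet> ?G y))" unfolding tf(2) by simp
    also have "\<dots> = integral (cbox a b) (\<lambda>y. - (s y \<bullet> ?G y))"
    proof (rule integral_lebesgue_on_cbox[OF sets ab(2)])
      show "continuous_on (cbox a b) (\<lambda>y. - (s y \<bullet> ?G y))" by (intro continuous_intros cs)
      show "- (s y \<bullet> ?G y) = 0" if "y \<notin> cbox a b" for y
      proof -
        have "y \<notin> cball x (e n)" using that sub by blast
        then have "x - y \<notin> cball 0 (e n)" by (simp add: dist_norm norm_minus_commute)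
        then show ?thesis using bump_outside(2)[OF e(1)] by simp
      qed
    qed
    also have "\<dots> = - (integral (cbox a b) (\<lambda>y. s y $ 1 * ?G y $ 1 + s y $ 2 * ?G y $ 2))"
      unfolding inner_vec2 by (rule integral_neg)
    also have "\<dots> = - (g n 1 x $ 1 + g n 2 x $ 2)"
      unfolding comp by (simp add: Henstock_Kurzweil_Integration.integral_add[OF int' int'])
    finally show ?thesis by simp
  qed
  have "\<exists>\<psi>. \<psi> x0 = 0 \<and> (\<forall>x\<in>ball x0 r. (\<psi> has_derivative (\<lambda>h. F n x \<bullet> h)) (at x))" for n
  proof (rule poincare_plane)
    show "((\<lambda>x. F n x $ 1) has_derivative (\<lambda>h. (- g n 2 x) \<bullet> h)) (at x)" for x
      using has_derivative_minus[OF dI[of n 2 x]] by (simp add: F_def)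
    show "((\<lambda>x. F n x $ 2) has_derivative (\<lambda>h. g n 1 x \<bullet> h)) (at x)" for x
      using dI[of n 1 x] by (simp add: F_def)
    show "continuous_on UNIV (\<lambda>x. - g n 2 x)" by (intro continuous_intros cg)
    show "continuous_on UNIV (g n 1)" by (rule cg)
    show "(- g n 2 x) $ 2 = g n 1 x $ 1" if "x \<in> ball x0 r" for x
      using div0[OF that, of n] by simp
  qed
  then obtain \<Psi> where \<Psi>: "\<And>n. \<Psi> n x0 = 0"
    "\<And>n x. x \<in> ball x0 r \<Longrightarrow> (\<Psi> n has_derivative (\<lambda>h. F n x \<bullet> h)) (at x)"
    by metis
  \<comment> \<open>After division by the mass each component is a weighted average of
    \<open>s\<close> near \<open>x\<close>; the factor two comes from bounding the norm by the sum
    of two components.\<close>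
  have close: "norm (F n x /\<^sub>R c n - perp (s x)) \<le> 2 * \<epsilon>"
    if x: "x \<in> ball x0 r" and \<epsilon>: "\<And>y. y \<in> cball x (e n) \<Longrightarrow> norm (s y - s x) \<le> \<epsilon>" for n x \<epsilon>
  proof -
    have sub: "cball x (e n) \<subseteq> cbox a b" by (rule inbox[OF x e(2)])
    have "\<epsilon> \<ge> 0" using \<epsilon>[of x] e(1)[of n] by simp
    have comp: "\<bar>I n i x / c n - s x $ i\<bar> \<le> \<epsilon>" for i
    proof -
      have i1: "(\<lambda>y. bump (e n) (x - y) * s y $ i) integrable_on cbox a b"
        and i2: "(\<lambda>y. bump (e n) (x - y) * s x $ i) integrable_on cbox a b"
        and i3: "(\<lambda>y. bump (e n) (x - y) * \<epsilon>) integrable_on cbox a b"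
        by (intro integrable_continuous continuous_intros csi)+
      have "I n i x - c n * s x $ i = integral (cbox a b) (\<lambda>y. bump (e n) (x - y) * s y $ i - bump (e n) (x - y) * s x $ i)"
        using Henstock_Kurzweil_Integration.integral_diff[OF i1 i2] c(2)[OF sub] by (simp add: I_def)
      moreover have "norm (integral (cbox a b) (\<lambda>y. bump (e n) (x - y) * s y $ i - bump (e n) (x - y) * s x $ i))
        \<le> integral (cbox a b) (\<lambda>y. bump (e n) (x - y) * \<epsilon>)"
      proof (rule integral_norm_bound_integral[OF integrable_diff[OF i1 i2] i3])
        fix y
        show "norm (bump (e n) (x - y) * s y $ i - bump (e n) (x - y) * s x $ i) \<le> bump (e n) (x - y) * \<epsilon>"
        proof (cases "y \<in> cball x (e n)")
          case True
          have "\<bar>s y $ i - s x $ i\<bar> \<le> norm (s y - s x)" using component_le_norm_cart[of "s y - s x" i] by simp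
          then have "bump (e n) (x - y) * \<bar>s y $ i - s x $ i\<bar> \<le> bump (e n) (x - y) * \<epsilon>"
            using \<epsilon>[OF True] by (intro mult_left_mono bump_nonneg) auto
          then show ?thesis
            using bump_nonneg[of "e n" "x - y"] by (simp add: abs_mult flip: right_diff_distrib)
        next
          case False
          then have "bump (e n) (x - y) = 0" by (intro bump_outside(1)[OF e(1)]) (auto simp: dist_norm norm_minus_commute)
          then show ?thesis by simp
        qed
      qed
      ultimately have "\<bar>I n i x - c n * s x $ i\<bar> \<le> c n * \<epsilon>"
        using c(2)[OF sub] by simp
      moreover have "I n i x / c n - s x $ i = (I n i x - c n * s x $ i) / c n"
        using c(1)[of n] by (simp add: field_simps)
      ultimately show ?thesis
        using c(1)[of n] by (simp add: abs_divide divide_le_eq mult.commute)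
    qed
    have "norm (F n x /\<^sub>R c n - perp (s x)) \<le> (\<Sum>i\<in>UNIV. \<bar>(F n x /\<^sub>R c n - perp (s x)) $ i\<bar>)"
      by (rule norm_le_l1_cart)
    also have "\<dots> = \<bar>- (I n 2 x / c n - s x $ 2)\<bar> + \<bar>I n 1 x / c n - s x $ 1\<bar>"
      by (simp add: sum_2 F_def divide_inverse mult.commute)
    also have "\<dots> \<le> 2 * \<epsilon>" using comp[of 1] comp[of 2] by simp
    finally show ?thesis .
  qed
  \<comment> \<open>The normalised gradients converge uniformly on the ball by uniform continuity of
    \<open>s\<close> on the box. As the potentials all vanish at \<open>x0\<close>, they converge to
    a potential of the unmollified field.\<close>
  have "\<exists>\<psi>. \<forall>x\<in>ball x0 r. (\<lambda>n. \<Psi> n x /\<^sub>R c n) \<longlonglongrightarrow> \<psi> x \<and>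
      (\<psi> has_derivative (\<lambda>h. perp (s x) \<bullet> h)) (at x within ball x0 r)"
  proof (rule has_derivative_sequence[OF convex_ball])
    show "((\<lambda>x. \<Psi> n x /\<^sub>R c n) has_derivative (\<lambda>h. (F n x /\<^sub>R c n) \<bullet> h)) (at x within ball x0 r)"
      if "x \<in> ball x0 r" for n x
      using has_derivative_scaleR_right[OF \<Psi>(2)[OF that], of "inverse (c n)" n]
      by (simp add: has_derivative_at_withinI)
    show "x0 \<in> ball x0 r" using r by simp
    show "(\<lambda>n. \<Psi> n x0 /\<^sub>R c n) \<longlonglongrightarrow> 0" by (simp add: \<Psi>(1))
    fix \<delta> :: real assume "\<delta> > 0"
    have "uniformly_continuous_on (cbox a b) s"
      by (rule compact_uniformly_continuous[OF cs compact_cbox])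
    then obtain \<rho> where \<rho>: "\<rho> > 0" "\<And>x y. x \<in> cbox a b \<Longrightarrow> y \<in> cbox a b \<Longrightarrow> dist y x < \<rho> \<Longrightarrow> dist (s y) (s x) < \<delta> / 2"
      unfolding uniformly_continuous_on_def using \<open>\<delta> > 0\<close> by (meson half_gt_zero)
    have "e \<longlonglongrightarrow> 0"
    proof -
      have "(\<lambda>n. r * (1 / real (n + 2))) \<longlonglongrightarrow> r * 0"
        by (intro tendsto_intros LIMSEQ_ignore_initial_segment[OF lim_1_over_n])
      then show ?thesis by (simp add: e_def[abs_def])
    qed
    then have "\<forall>\<^sub>F n in sequentially. e n < \<rho>" using \<rho>(1) by (rule order_tendstoD(2))
    then show "\<forall>\<^sub>F n in sequentially. \<forall>x\<in>ball x0 r. \<forall>h. norm ((F n x /\<^sub>R c n) \<bullet> h - perp (s x) \<bullet> h) \<le> \<delta> * norm h"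
    proof eventually_elim
      case (elim n)
      show ?case
      proof (intro ballI allI)
        fix x h assume x: "x \<in> ball x0 r"
        have sub: "cball x (e n) \<subseteq> cbox a b" by (rule inbox[OF x e(2)])
        have "norm (F n x /\<^sub>R c n - perp (s x)) \<le> 2 * (\<delta> / 2)"
        proof (rule close[OF x])
          fix y assume y: "y \<in> cball x (e n)"
          then have "dist y x < \<rho>" using elim by (simp add: dist_commute)
          moreover have "x \<in> cbox a b" using sub e(1)[of n] by (auto simp: subset_eq)
          moreover have "y \<in> cbox a b" using sub y by blast
          ultimately show "norm (s y - s x) \<le> \<delta> / 2" using \<rho>(2)[of x y] by (simp add: dist_norm)
        qed
        then have le: "norm (F n x /\<^sub>R c n - perp (s x)) \<le> \<delta>" by simp
        have "\<bar>(F n x /\<^sub>R c n - perp (s x)) \<bullet> h\<bar> \<le> norm (F n x /\<^sub>R c n - perp (s x)) * norm h"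
          by (rule Cauchy_Schwarz_ineq2)
        also have "\<dots> \<le> \<delta> * norm h" using le by (intro mult_right_mono) auto
        finally show "norm ((F n x /\<^sub>R c n) \<bullet> h - perp (s x) \<bullet> h) \<le> \<delta> * norm h"
          by (simp add: inner_diff_left)
      qed
    qed
  qed
  then obtain \<psi> where "\<And>x. x \<in> ball x0 r \<Longrightarrow> (\<psi> has_derivative (\<lambda>h. perp (s x) \<bullet> h)) (at x within ball x0 r)"
    by blast
  then have "\<And>x. x \<in> ball x0 r \<Longrightarrow> (\<psi> has_derivative (\<lambda>h. perp (s x) \<bullet> h)) (at x)"
    by (metis at_within_open open_ball)
  moreover have "ball x0 r \<subseteq> S"
    using d(2) ab(2) box_subset_cbox[of a b] r by (auto simp: r_def subset_eq)
  ultimately show ?thesis using that r by blast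
qed

subsection \<open>The order on characteristic chords\<close>

text \<open>For unit \<open>s a\<close> this is the signed distance from \<open>y\<close> to the
  characteristic line of \<open>a\<close>, positive on the side to which \<open>s a\<close>
  points.\<close>

definition side :: "(real^2 \<Rightarrow> real^2) \<Rightarrow> real^2 \<Rightarrow> real^2 \<Rightarrow> real" where
  "side s a y = (y - a) \<bullet> s a"

lemma side_self [simp]: "side s a a = 0"
  by (simp add: side_def)

lemma side_uminus [simp]: "side (\<lambda>x. - s x) a y = - side s a y"
  by (simp add: side_def)

lemma side_affine: "side s a (x + t *\<^sub>R (y - x)) = (1 - t) * side s a x + t * side s a y"
  by (simp add: side_def algebra_simps inner_diff_left inner_add_left)

lemma continuous_on_side_right [continuous_intros]:
  "continuous_on S f \<Longrightarrow> continuous_on S (\<lambda>y. side s a (f y))"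
  unfolding side_def by (intro continuous_intros)

lemma char_line_iff_side:
  assumes "norm (s x) = 1"
  shows "y \<in> char_line s x \<longleftrightarrow> side s x y = 0"
proof
  assume "side s x y = 0"
  then have "y - x = ((y - x) \<bullet> perp (s x)) *\<^sub>R perp (s x)"
    using unit_frame_decomposition[OF assms, of "y - x"] by (simp add: side_def)
  then have "y = x + ((y - x) \<bullet> perp (s x)) *\<^sub>R perp (s x)" by (simp add: algebra_simps)
  then show "y \<in> char_line s x" unfolding char_line_def by blast
qed (auto simp: char_line_def side_def)

lemma char_line_uminus: "char_line (\<lambda>x. - s x) = char_line s"
proof (intro ext set_eqI iffI)
  fix x y assume "y \<in> char_line (\<lambda>x. - s x) x"
  then obtain t where "y = x + t *\<^sub>R perp (- s x)" by (auto simp: char_line_def)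
  then have "y = x + (- t) *\<^sub>R perp (s x)" by (simp add: perp_minus)
  then show "y \<in> char_line s x" unfolding char_line_def by blast
next
  fix x y assume "y \<in> char_line s x"
  then obtain t where "y = x + t *\<^sub>R perp (s x)" by (auto simp: char_line_def)
  then have "y = x + (- t) *\<^sub>R perp (- s x)" by (simp add: perp_minus)
  then show "y \<in> char_line (\<lambda>x. - s x) x" unfolding char_line_def by blast
qed

lemma fan_complement_uminus: "fan_complement P (\<lambda>x. - s x) = fan_complement P s"
  by (simp add: fan_complement_def fan_apexes_def boundary_fan_def char_line_uminus)

lemma char_boundary_uminus: "char_boundary P (\<lambda>x. - s x) C = char_boundary P s C"
  by (simp add: char_boundary_def char_line_uminus)

lemma connected_real_image_sign:
  fixes f :: "'a::topological_space \<Rightarrow> real"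
  assumes "connected U" "continuous_on U f" "\<And>x. x \<in> U \<Longrightarrow> f x \<noteq> 0" "a \<in> U" "b \<in> U" "f a > 0"
  shows "f b > 0"
proof (rule ccontr)
  assume "\<not> f b > 0"
  then have "f b \<le> 0" by simp
  moreover have "connected (f ` U)" using assms by (intro connected_continuous_image)
  ultimately have "0 \<in> f ` U"
    using connectedD_interval[of "f ` U" "f b" "f a" 0] assms by auto
  then show False using assms by auto
qed

text \<open>Isolates what the geometry takes from the variational problem. The assumptions are
  invariant under reversing the sign of \<open>s\<close>, so each result has a mirror image.\<close>

locale char_foliation =
  fixes P :: "(real^2) set" and s :: "real^2 \<Rightarrow> real^2"
  assumes open_P: "open P" and convex_P: "convex P" and bounded_P: "bounded P"
    and cont: "continuous_on P s"
    and unit: "x \<in> P \<Longrightarrow> norm (s x) = 1"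
    and const: "\<lbrakk>x \<in> P; y \<in> P; y \<in> char_line s x\<rbrakk> \<Longrightarrow> s y = s x"
begin

lemma reverse: "char_foliation P (\<lambda>x. - s x)"
  by unfold_locales
    (auto simp: open_P convex_P bounded_P unit char_line_uminus intro!: continuous_intros cont const)

lemma unit_inner [simp]: "x \<in> P \<Longrightarrow> s x \<bullet> s x = 1"
  using unit by (simp add: dot_square_norm)

lemma s_nonzero: "x \<in> P \<Longrightarrow> s x \<noteq> 0"
  using unit by fastforce

lemma mem_char_line: "x \<in> P \<Longrightarrow> y \<in> char_line s x \<longleftrightarrow> side s x y = 0"
  using char_line_iff_side unit by blast

lemma continuous_on_side_left: "continuous_on P (\<lambda>y. side s y x)"
  unfolding side_def by (intro continuous_intros cont)

text \<open>The function \<open>side s a\<close> depends only on the chord of \<open>a\<close>,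
  which makes it legitimate to order chords through their points.\<close>

lemma side_eq_0_same:
  assumes "a \<in> P" "y \<in> P" "side s a y = 0"
  shows "s y = s a" "side s y = side s a"
proof -
  show s: "s y = s a" using const assms mem_char_line by blast
  show "side s y = side s a"
    using assms s by (auto simp: side_def fun_eq_iff inner_diff_left)
qed

lemma side_eq_0_commute: "a \<in> P \<Longrightarrow> y \<in> P \<Longrightarrow> side s a y = 0 \<longleftrightarrow> side s y a = 0"
  by (metis side_eq_0_same(2) side_self)

lemma frontier_iff: "x \<in> frontier P \<longleftrightarrow> x \<in> closure P \<and> x \<notin> P"
  using open_P by (simp add: frontier_def interior_open)

lemma move_along_s:
  assumes "y \<in> P"
  obtains e where "e > 0" "\<And>t. \<bar>t\<bar> < e \<Longrightarrow> y + t *\<^sub>R s y \<in> P"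
proof -
  obtain e where e: "e > 0" "ball y e \<subseteq> P" using open_P assms by (meson openE)
  show ?thesis
    by (rule that[OF e(1)]) (use e unit[OF assms] in \<open>auto simp: dist_norm subset_iff\<close>)
qed

section \<open>Antisymmetry and transitivity of the chord order\<close>

lemma convex_side_ge: "convex {y \<in> P. side s b y \<ge> 0}"
proof (rule convexI)
  fix x y and u v :: real
  assume *: "x \<in> {y \<in> P. side s b y \<ge> 0}" "y \<in> {y \<in> P. side s b y \<ge> 0}" "0 \<le> u" "0 \<le> v" "u + v = 1"
  have "side s b (u *\<^sub>R x + v *\<^sub>R y) = u * side s b x + v * side s b y"
    using side_affine[of s b x v y] * by (simp add: algebra_simps scaleR_left_distrib[symmetric]
      flip: eq_diff_eq)
  then show "u *\<^sub>R x + v *\<^sub>R y \<in> {y \<in> P. side s b y \<ge> 0}"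
    using * convex_P by (auto intro: convexD)
qed

lemma convex_side_gt: "convex {y \<in> P. side s b y > 0}"
proof -
  have "{y \<in> P. side s b y > 0} = P \<inter> {y. s b \<bullet> y > s b \<bullet> b}"
    by (auto simp: side_def inner_diff_left inner_commute[of "s b"])
  then show ?thesis using convex_P by (simp add: convex_Int convex_halfspace_gt)
qed

text \<open>On the connected half \<open>?U\<close> of \<open>P\<close> the map \<open>y\<close> to
  \<open>side s y a\<close> is continuous and has no zero, vanishing being symmetric in the two
  points. Its sign is therefore decided at one point slightly above \<open>a\<close>, where
  \<open>s\<close> is still close to \<open>s a\<close>.\<close>

lemma side_pos_imp_neg:
  assumes "a \<in> P" "y \<in> P" "side s a y > 0"
  shows "side s y a < 0"
proof -
  obtain e where e: "e > 0" "\<And>t. \<bar>t\<bar> < e \<Longrightarrow> a + t *\<^sub>R s a \<in> P"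
    using move_along_s assms by blast
  have lim: "((\<lambda>t. s (a + t *\<^sub>R s a) \<bullet> s a) \<longlongrightarrow> s (a + 0 *\<^sub>R s a) \<bullet> s a) (at 0)"
  proof -
    have "isCont s a" using cont open_P assms by (simp add: continuous_on_eq_continuous_at)
    then have "isCont s (a + 0 *\<^sub>R s a)" by simp
    then have "((\<lambda>t. s (a + t *\<^sub>R s a)) \<longlongrightarrow> s (a + 0 *\<^sub>R s a)) (at 0)"
      by (rule isCont_tendsto_compose) (intro tendsto_intros)
    then show ?thesis by (intro tendsto_intros)
  qed
  have "\<forall>\<^sub>F t in at 0. s (a + t *\<^sub>R s a) \<bullet> s a > 0"
    using order_tendstoD(1)[OF lim, of 0] assms by simp
  then obtain d where d: "d > 0" "\<And>t. t \<noteq> 0 \<Longrightarrow> \<bar>t\<bar> < d \<Longrightarrow> s (a + t *\<^sub>R s a) \<bullet> s a > 0"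
    by (auto simp: eventually_at dist_real_def)
  define t where "t = min e d / 2"
  have t: "t > 0" "\<bar>t\<bar> < e" "\<bar>t\<bar> < d" using e d by (auto simp: t_def)
  let ?b = "a + t *\<^sub>R s a"
  let ?U = "{y \<in> P. side s a y > 0}"
  have b: "?b \<in> ?U" using t e assms by (simp add: side_def)
  have neg: "- side s ?b a > 0"
    using t d by (simp add: side_def inner_commute)
  have "continuous_on ?U (\<lambda>y. - side s y a)"
    by (intro continuous_on_minus continuous_on_subset[OF continuous_on_side_left]) auto
  moreover have "- side s w a \<noteq> 0" if "w \<in> ?U" for w
    using side_eq_0_commute[of a w] that assms(1) by auto
  ultimately have "- side s y a > 0"
    using connected_real_image_sign[of ?U "\<lambda>y. - side s y a" ?b y] convex_side_gt convex_connected
      neg b assms by blast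
  then show ?thesis by simp
qed

lemma side_neg_imp_pos: "\<lbrakk>a \<in> P; y \<in> P; side s a y < 0\<rbrakk> \<Longrightarrow> side s y a > 0"
  using char_foliation.side_pos_imp_neg[OF reverse, of a y] by simp

lemma side_antisym: "a \<in> P \<Longrightarrow> y \<in> P \<Longrightarrow> side s a y > 0 \<longleftrightarrow> side s y a < 0"
  using side_pos_imp_neg side_neg_imp_pos by blast

lemma side_antisym': "a \<in> P \<Longrightarrow> y \<in> P \<Longrightarrow> side s a y \<ge> 0 \<longleftrightarrow> side s y a \<le> 0"
  using side_antisym[of y a] by linarith

text \<open>The half of \<open>P\<close> weakly above \<open>b\<close> is connected and does not
  meet the chord of \<open>a\<close>: a common point \<open>y\<close> would have \<open>b\<close>
  strictly above it and yet be weakly above \<open>b\<close>. So \<open>side s a\<close> has on this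
  half the sign that it has at \<open>b\<close>.\<close>

lemma side_trans_le_less:
  assumes P: "a \<in> P" "b \<in> P" "c \<in> P" and ab: "side s a b \<ge> 0" and bc: "side s b c > 0"
  shows "side s a c > 0"
proof (cases "side s a b = 0")
  case True
  then show ?thesis using side_eq_0_same[of a b] P bc by simp
next
  case False
  with ab have ab: "side s a b > 0" by simp
  let ?U = "{y \<in> P. side s b y \<ge> 0}"
  have "side s a y \<noteq> 0" if "y \<in> ?U" for y
  proof
    assume "side s a y = 0"
    then have "side s y b > 0" using side_eq_0_same(2)[of a y] P that ab by simp
    then have "side s b y < 0" using side_antisym that P by blast
    then show False using that by simp
  qed
  then show ?thesis
    by (intro connected_real_image_sign[of ?U "side s a" b c])
      (use convex_side_ge convex_connected P ab bc in \<open>auto intro!: continuous_intros\<close>)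
qed

lemma side_trans:
  assumes "a \<in> P" "b \<in> P" "c \<in> P" "side s a b \<ge> 0" "side s b c \<ge> 0"
  shows "side s a c \<ge> 0"
proof (cases "side s b c = 0")
  case True
  then have "side s c a = side s b a" using side_eq_0_same(2)[of b c] assms by simp
  then show ?thesis using assms side_antisym' by metis
qed (use assms side_trans_le_less in \<open>auto intro: less_imp_le\<close>)

lemma segment_in_P:
  "\<lbrakk>z \<in> P; x \<in> closure P; 0 \<le> t; t < 1\<rbrakk> \<Longrightarrow> z + t *\<^sub>R (x - z) \<in> P"
  by (rule segment_in_open_convex[OF open_P convex_P bounded_P])

text \<open>The boundary point \<open>x\<close> carries no chord of its own. It is approached along
  the segment from \<open>z\<close>, on which the signed distances are affine.\<close>

lemma side_trans_closure:
  assumes "y \<in> P" "z \<in> P" "x \<in> closure P" "side s y z \<ge> 0" "side s z x \<ge> 0"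
  shows "side s y x \<ge> 0"
proof -
  have "(1 - t) * side s y z + t * side s y x \<ge> 0" if "0 \<le> t" "t < 1" for t
  proof -
    have "side s z (z + t *\<^sub>R (x - z)) \<ge> 0" using assms that by (simp add: side_affine)
    then have "side s y (z + t *\<^sub>R (x - z)) \<ge> 0"
      using side_trans[of y z "z + t *\<^sub>R (x - z)"] segment_in_P assms that by blast
    then show ?thesis by (simp add: side_affine)
  qed
  then have "\<forall>\<^sub>F t in at_left 1. (1 - t) * side s y z + t * side s y x \<ge> 0"
    unfolding eventually_at_left_field by (auto intro!: exI[of _ 0])
  moreover have "((\<lambda>t. (1 - t) * side s y z + t * side s y x) \<longlongrightarrow> (1 - 1) * side s y z + 1 * side s y x) (at_left 1)"
    by (intro tendsto_intros)
  ultimately show ?thesis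
    using tendsto_lowerbound[of _ _ "at_left (1::real)" 0] by simp
qed

lemma side_trans_closure':
  assumes "y \<in> P" "z \<in> P" "x \<in> closure P" "side s y z \<le> 0" "side s z x \<le> 0"
  shows "side s y x \<le> 0"
  using char_foliation.side_trans_closure[OF reverse, of y z x] assms by simp

subsection \<open>Components of the fan complement\<close>

text \<open>Fans are interiors, so openness has to be carried along the chord. Sliding every base
  point by the same signed length \<open>r\<close> along its own chord is continuous, and it pulls
  the fan back to an open neighbourhood of \<open>y\<close> whose chords also point to
  \<open>a\<close>.\<close>

lemma saturated_boundary_fan:
  assumes y: "y \<in> P" "y' \<in> P" "side s y y' = 0" and fan: "y' \<in> boundary_fan P s a"
  shows "y \<in> boundary_fan P s a"
proof -
  define r where "r = (y' - y) \<bullet> perp (s y)"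
  define f where "f w = w + r *\<^sub>R perp (s w)" for w
  have y': "f y = y'"
    using unit_frame_decomposition[OF unit[OF y(1)], of "y' - y"] y
    by (simp add: f_def r_def side_def algebra_simps)
  have "continuous_on P f" unfolding f_def by (intro continuous_intros cont)
  then have op: "open (P \<inter> f -` boundary_fan P s a)"
    using open_P by (intro continuous_open_preimage) (auto simp: boundary_fan_def)
  have "P \<inter> f -` boundary_fan P s a \<subseteq> {z \<in> P. a \<in> char_line s z}"
  proof safe
    fix w assume w: "w \<in> P" "f w \<in> boundary_fan P s a"
    then have fw: "f w \<in> P" "a \<in> char_line s (f w)"
      using interior_subset unfolding boundary_fan_def by blast+
    have "side s w (f w) = 0" by (simp add: side_def f_def)
    then show "a \<in> char_line s w" using fw w mem_char_line side_eq_0_same(2) by metis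
  qed
  then have "P \<inter> f -` boundary_fan P s a \<subseteq> boundary_fan P s a"
    using op unfolding boundary_fan_def by (rule interior_maximal)
  then show ?thesis using y y' fan by blast
qed

lemma saturated_fan_complement:
  "\<lbrakk>y \<in> fan_complement P s; y' \<in> P; side s y y' = 0\<rbrakk> \<Longrightarrow> y' \<in> fan_complement P s"
  unfolding fan_complement_def using saturated_boundary_fan[of y y'] by auto

end

locale fan_component = char_foliation +
  fixes C :: "(real^2) set"
  assumes C: "C \<in> components (fan_complement P s)"
    and interior_C: "interior C \<noteq> {}"
begin

lemma reverse_component: "fan_component P (\<lambda>x. - s x) C"
  using reverse C interior_C
  by (simp add: fan_component_def fan_component_axioms_def fan_complement_uminus)

lemma C_subset: "C \<subseteq> fan_complement P s" "C \<subseteq> P"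
  using in_components_subset[OF C] by (auto simp: fan_complement_def)

lemma connected_C: "connected C"
  using C in_components_connected by blast

lemma convex_band: "convex {y \<in> P. side s a y \<ge> 0 \<and> side s b y \<le> 0}"
proof -
  have "{y \<in> P. side s a y \<ge> 0 \<and> side s b y \<le> 0} =
    {y \<in> P. side s a y \<ge> 0} \<inter> {y \<in> P. side (\<lambda>x. - s x) b y \<ge> 0}"
    by auto
  then show ?thesis
    using convex_side_ge char_foliation.convex_side_ge[OF reverse] by (simp only: convex_Int)
qed

text \<open>The band is convex, hence connected, and meets \<open>C\<close>, so it only has to avoid
  the fans. The chord of a fan point \<open>y\<close> misses \<open>C\<close> by saturation; then
  \<open>side s y\<close> has constant sign on the connected set \<open>C\<close>, although
  \<open>a\<close> lies weakly below \<open>y\<close> and \<open>b\<close> above.\<close>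

lemma band_subset:
  assumes ab: "a \<in> C" "b \<in> C" "side s a b \<ge> 0"
  shows "{y \<in> P. side s a y \<ge> 0 \<and> side s b y \<le> 0} \<subseteq> C" (is "?B \<subseteq> C")
proof (rule components_maximal[OF C])
  show "connected ?B" using convex_band convex_connected by blast
  show "C \<inter> ?B \<noteq> {}" using ab C_subset side_antisym'[of a b] by auto
  show "?B \<subseteq> fan_complement P s"
  proof
    fix y assume y: "y \<in> ?B"
    show "y \<in> fan_complement P s"
    proof (rule ccontr)
      assume n: "y \<notin> fan_complement P s"
      have ne: "side s y w \<noteq> 0" if "w \<in> C" for w
        using saturated_fan_complement[of w y] that y n C_subset side_eq_0_commute by blast
      have "side s y b > 0" using ne[of b] y ab C_subset side_antisym'[of y b] by force
      then have "side s y a > 0"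
        using connected_real_image_sign[OF connected_C, of "side s y" b a] ne ab
        by (auto intro!: continuous_on_side_right[OF continuous_on_id])
      then show False using side_antisym[of y a] y ab C_subset by auto
    qed
  qed
qed

lemma between_in_C:
  "\<lbrakk>a \<in> C; b \<in> C; y \<in> P; side s a y \<ge> 0; side s y b \<ge> 0\<rbrakk> \<Longrightarrow> y \<in> C"
  using band_subset[of a b] side_trans[of a y b] side_antisym'[of y b] C_subset by blast

lemma saturated_C: "\<lbrakk>a \<in> C; y \<in> P; side s a y = 0\<rbrakk> \<Longrightarrow> y \<in> C"
  using between_in_C[of a a y] side_eq_0_commute[of a y] C_subset by auto

text \<open>Fans are open and components are relatively closed, so \<open>C\<close> is closed in
  \<open>P\<close>.\<close>

lemma closure_C_in_P:
  assumes "x \<in> P" "x \<in> closure C"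
  shows "x \<in> C"
proof -
  have "open (\<Union>a\<in>fan_apexes P s. boundary_fan P s a)"
    by (auto simp: boundary_fan_def)
  then have "closed (- (\<Union>a\<in>fan_apexes P s. boundary_fan P s a))" by (simp add: closed_def)
  then have "closure C \<subseteq> - (\<Union>a\<in>fan_apexes P s. boundary_fan P s a)"
    using C_subset by (intro closure_minimal) (auto simp: fan_complement_def)
  then have x: "x \<in> fan_complement P s" using assms by (auto simp: fan_complement_def)
  have "closedin (top_of_set (fan_complement P s)) C"
    using closedin_component[OF C] .
  then obtain T where T: "closed T" "C = fan_complement P s \<inter> T"
    by (auto simp: closedin_closed)
  then have "closure C \<subseteq> T" by (intro closure_minimal) auto
  then show ?thesis using assms(2) T x by blast
qed

text \<open>Walking from a point \<open>y\<close> outside \<open>C\<close> up to \<open>a\<close>,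
  the first point in the closure of \<open>C\<close> exists by compactness, belongs to
  \<open>C\<close>, and lies on the lowest chord.\<close>

lemma minimum_or_downward_closed:
  assumes "y \<in> P" "y \<notin> C" "a \<in> C" "side s y a \<ge> 0"
  obtains m where "m \<in> C" "\<And>z. z \<in> C \<Longrightarrow> side s m z \<ge> 0"
proof -
  define p where "p t = y + t *\<^sub>R (a - y)" for t :: real
  have aP: "a \<in> P" using assms C_subset by auto
  have pP: "p t \<in> P" if "t \<in> {0..1}" for t
    using segment_in_P[of y a t] assms aP that closure_subset[of P]
    by (cases "t = 1") (auto simp: p_def)
  have "compact ({0..1} \<inter> p -` closure C)"
    unfolding p_def by (intro closed_Int_compact continuous_closed_vimage compact_Int_closed) (auto intro!: continuous_intros)
  moreover have "1 \<in> {0..1} \<inter> p -` closure C"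
    using assms closure_subset[of C] by (auto simp: p_def)
  ultimately obtain r where r: "r \<in> {0..1} \<inter> p -` closure C"
    and least: "\<And>t. t \<in> {0..1} \<inter> p -` closure C \<Longrightarrow> r \<le> t"
    using compact_attains_inf[of "{0..1} \<inter> p -` closure C"] by blast
  have m: "p r \<in> C" using r pP closure_C_in_P by auto
  \<comment> \<open>Otherwise \<open>y\<close> would lie between two chords of \<open>C\<close> and
    belong to \<open>C\<close>.\<close>
  have less: "side s y z > 0" if "z \<in> C" for z
  proof (rule ccontr)
    assume "\<not> side s y z > 0"
    then have "side s z y \<ge> 0" using side_antisym'[of z y] that assms C_subset by auto
    then show False using between_in_C[of z a y] assms that by blast
  qed
  show ?thesis
  proof (rule that[OF m])
    fix z assume z: "z \<in> C"
    \<comment> \<open>If \<open>z\<close> were strictly lower, the walk would start below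
      \<open>z\<close> and reach \<open>p r\<close> above it, crossing the chord of \<open>z\<close>
      before time \<open>r\<close>. By saturation that crossing point is in \<open>C\<close>,
      against the minimality of \<open>r\<close>.\<close>
    show "side s (p r) z \<ge> 0"
    proof (rule ccontr)
      assume "\<not> ?thesis"
      then have pos: "side s z (p r) > 0"
        using side_antisym[of z "p r"] z m C_subset by auto
      have neg: "side s z y < 0" using less[OF z] side_antisym[of y z] z assms C_subset by auto
      have "continuous_on {0..r} (\<lambda>t. side s z (p t))"
        unfolding p_def by (intro continuous_intros)
      then obtain t where t: "0 \<le> t" "t \<le> r" "side s z (p t) = 0"
        using IVT'[of "\<lambda>t. side s z (p t)" 0 0 r] pos neg r by (auto simp: p_def)
      have "p t \<in> C" using saturated_C[OF z pP t(3)] t r by auto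
      then have "r \<le> t" using least[of t] t r closure_subset[of C] by auto
      then have "t = r" using t by auto
      then show False using t pos by auto
    qed
  qed
qed

end

subsection \<open>Endpoints of chords\<close>

text \<open>The other endpoint is \<open>chord_end P (\<lambda>x. - s x) z\<close>, because
  \<open>perp\<close> commutes with negation.\<close>

definition chord_end :: "(real^2) set \<Rightarrow> (real^2 \<Rightarrow> real^2) \<Rightarrow> real^2 \<Rightarrow> real^2" where
  "chord_end P s z = z + exit_time P z (perp (s z)) *\<^sub>R perp (s z)"

context char_foliation
begin

lemma perp_s_nonzero: "z \<in> P \<Longrightarrow> perp (s z) \<noteq> 0"
  using s_nonzero[of z] by (metis norm_eq_zero norm_perp)

lemma chord_end_frontier: "z \<in> P \<Longrightarrow> chord_end P s z \<in> frontier P"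
  unfolding chord_end_def
  using exit_time(2)[OF open_P convex_P bounded_P _ perp_s_nonzero] by blast

lemma side_chord_end [simp]: "side s z (chord_end P s z) = 0"
  by (simp add: side_def chord_end_def)

lemma side_chord_end_uminus [simp]: "side s z (chord_end P (\<lambda>x. - s x) z) = 0"
  by (simp add: side_def chord_end_def perp_minus)

lemma continuous_on_chord_end: "continuous_on P (chord_end P s)"
  unfolding chord_end_def
  by (intro continuous_intros cont continuous_on_exit_time open_P convex_P bounded_P perp_s_nonzero)

lemma on_chord_line:
  assumes "z \<in> P" "side s z x = 0"
  shows "x = z + ((x - z) \<bullet> perp (s z)) *\<^sub>R perp (s z)"
  using unit_frame_decomposition[OF unit[OF assms(1)], of "x - z"] assms
  by (simp add: side_def algebra_simps)

text \<open>The sign of the coordinate along the chord tells which of the two rays from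
  \<open>z\<close> reaches \<open>x\<close>, and each ray exits once.\<close>

lemma frontier_on_chord_line:
  assumes z: "z \<in> P" and x: "x \<in> frontier P" "side s z x = 0"
  shows "x = chord_end P s z \<or> x = chord_end P (\<lambda>x. - s x) z"
proof -
  define r where "r = (x - z) \<bullet> perp (s z)"
  have x_eq: "x = z + r *\<^sub>R perp (s z)" unfolding r_def by (rule on_chord_line[OF z x(2)])
  consider "r > 0" | "- r > 0" | "r = 0" by linarith
  then show ?thesis
  proof cases
    case 1
    then have "r = exit_time P z (perp (s z))"
      using ray_frontier_unique[OF open_P convex_P bounded_P z perp_s_nonzero[OF z]] x x_eq by blast
    then show ?thesis using x_eq by (simp add: chord_end_def)
  next
    case 2
    have "z + (- r) *\<^sub>R (- perp (s z)) \<in> frontier P" using x x_eq by simp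
    then have "- r = exit_time P z (- perp (s z))"
      using ray_frontier_unique[OF open_P convex_P bounded_P z _ 2] perp_s_nonzero[OF z] by auto
    then have "r = - exit_time P z (- perp (s z))" by simp
    then show ?thesis using x_eq by (simp add: chord_end_def perp_minus)
  next
    case 3
    then show ?thesis using x_eq x z frontier_iff by simp
  qed
qed

text \<open>As \<open>q\<close> lies inside \<open>P\<close>, the vector from \<open>q\<close> to
  the endpoint is a positive multiple of \<open>perp (s z)\<close>, and rotation preserves the inner
  product with \<open>v\<close>. So for a line crossing the chord upwards at \<open>q\<close>, the
  side of the endpoint is known.\<close>

lemma chord_end_side:
  assumes "z \<in> P" "q \<in> P" "side s z q = 0" "v \<bullet> s z > 0"
  shows "(chord_end P s z - q) \<bullet> perp v > 0"
proof -
  define r where "r = (q - z) \<bullet> perp (s z)"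
  let ?T = "exit_time P z (perp (s z))"
  have q: "q = z + r *\<^sub>R perp (s z)" unfolding r_def by (rule on_chord_line[OF assms(1,3)])
  have "r < ?T"
  proof (cases "r \<ge> 0")
    case True
    then show ?thesis
      using less_exit_time_iff[OF open_P convex_P bounded_P assms(1) perp_s_nonzero[OF assms(1)]] q assms(2)
      by blast
  next
    case False
    then show ?thesis
      using exit_time(1)[OF open_P convex_P bounded_P assms(1) perp_s_nonzero[OF assms(1)]] by linarith
  qed
  moreover have "chord_end P s z - q = (?T - r) *\<^sub>R perp (s z)"
    by (simp add: chord_end_def q scaleR_left_diff_distrib)
  ultimately show ?thesis using assms(4) by (simp add: inner_commute)
qed

text \<open>The line through \<open>m\<close> and \<open>k\<close> crosses the chord inside \<open>P\<close>, hence separates its two endpoints.\<close>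

lemma chord_ends_separated:
  assumes z: "z \<in> P" and m: "m \<in> P" and k: "k \<in> closure P"
    and "side s z m \<le> 0" "0 \<le> side s z k" "side s z m < side s z k" "k \<in> P \<or> 0 < side s z k"
  shows "(chord_end P s z - m) \<bullet> perp (k - m) > 0"
    and "(chord_end P (\<lambda>x. - s x) z - m) \<bullet> perp (k - m) < 0"
proof -
  \<comment> \<open>The parameter at which the affine function \<open>side s z\<close> vanishes on
    the segment from \<open>m\<close> to \<open>k\<close>. The value \<open>1\<close> occurs only
    when \<open>k\<close> lies on the line of \<open>z\<close>, and then \<open>k\<close> is assumed
    to be in \<open>P\<close>.\<close>
  define r where "r = - side s z m / (side s z k - side s z m)"
  define q where "q = m + r *\<^sub>R (k - m)"
  have r: "0 \<le> r" "r \<le> 1" "r = 1 \<longrightarrow> side s z k = 0"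
    using assms by (auto simp: r_def field_simps)
  have qP: "q \<in> P"
    using segment_in_P[OF m k, of r] r assms by (cases "r = 1") (auto simp: q_def)
  have "side s z q = side s z m + r * (side s z k - side s z m)"
    unfolding q_def side_affine by (simp add: algebra_simps)
  then have side: "side s z q = 0"
    using assms(6) by (simp add: r_def)
  have v: "(k - m) \<bullet> s z > 0"
    using assms by (simp add: side_def inner_diff_left)
  have q_line: "q \<bullet> perp (k - m) = m \<bullet> perp (k - m)"
    by (simp add: q_def inner_add_left)
  have "(chord_end P s z - q) \<bullet> perp (k - m) > 0"
    by (rule chord_end_side[OF z qP side v])
  then show "(chord_end P s z - m) \<bullet> perp (k - m) > 0"
    using q_line by (simp add: inner_diff_left)
  have "(chord_end P (\<lambda>x. - s x) z - q) \<bullet> perp (- (k - m)) > 0"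
    by (rule char_foliation.chord_end_side[OF reverse z qP])
      (use side v in \<open>simp_all del: minus_diff_eq\<close>)
  then have "(chord_end P (\<lambda>x. - s x) z - q) \<bullet> perp (k - m) < 0"
    by (simp add: perp_minus del: minus_diff_eq)
  then show "(chord_end P (\<lambda>x. - s x) z - m) \<bullet> perp (k - m) < 0"
    using q_line by (simp add: inner_diff_left)
qed

end

subsection \<open>The boundary of a component\<close>

text \<open>Packaging the conclusion lets it be transported under reversal of \<open>s\<close>, so
  that components with only a greatest chord reduce to those with only a least one.\<close>

definition char_boundary_structure :: "(real^2) set \<Rightarrow> (real^2 \<Rightarrow> real^2) \<Rightarrow> (real^2) set \<Rightarrow> bool" where
  "char_boundary_structure P s C \<longleftrightarrow>
    finite (components (frontier C \<inter> frontier P)) \<and>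
    card (components (frontier C \<inter> frontier P)) \<le> 2 \<and>
    (card (components (frontier C \<inter> frontier P)) = 2 \<longrightarrow>
       char_boundary P s C = {} \<and>
       (\<forall>z\<in>C. char_line s z \<inter> (frontier C \<inter> frontier P) \<noteq> {} \<longrightarrow>
          (\<forall>D\<in>components (frontier C \<inter> frontier P). char_line s z \<inter> D \<noteq> {}))) \<and>
    (connected (frontier C \<inter> frontier P) \<longrightarrow>
       ((\<exists>a. char_boundary P s C = {a}) \<or>
        (\<exists>a b. a \<noteq> b \<and> char_boundary P s C = closed_segment a b)) \<and>
       char_boundary P s C \<subseteq> frontier C \<inter> frontier P \<and>
       card (components ((frontier C \<inter> frontier P) - char_boundary P s C)) = 2 \<and>
       (\<forall>z\<in>C. char_line s z \<inter> (frontier C \<inter> frontier P) \<noteq> {} \<longrightarrow>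
          (\<forall>D\<in>components ((frontier C \<inter> frontier P) - char_boundary P s C).
             char_line s z \<inter> D \<noteq> {})))"

lemma char_boundary_structure_uminus:
  "char_boundary_structure P (\<lambda>x. - s x) C = char_boundary_structure P s C"
  by (simp add: char_boundary_structure_def char_boundary_uminus char_line_uminus)

context fan_component
begin

abbreviation "ends \<equiv> chord_end P s ` C"
abbreviation "ends' \<equiv> chord_end P (\<lambda>x. - s x) ` C"

section \<open>Endpoint curves and the characteristic boundary\<close>

lemma C_nonempty: "C \<noteq> {}"
  using interior_C interior_subset by blast

lemma frontier_C_Int: "frontier C \<inter> frontier P = closure C \<inter> frontier P"
  using C_subset(2) interior_subset[of C] frontier_iff by (auto simp: frontier_def)

lemma cont_left: "continuous_on C (\<lambda>z. side s z x)"
  using continuous_on_subset[OF continuous_on_side_left C_subset(2)] .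

lemma connected_ends: "connected ends" "connected ends'"
  using connected_continuous_image[OF _ connected_C] C_subset continuous_on_chord_end
    char_foliation.continuous_on_chord_end[OF reverse]
  by (blast intro: continuous_on_subset)+

text \<open>The endpoint is approached along its own chord, which stays in \<open>C\<close> by
  saturation.\<close>

lemma chord_end_in_closure:
  assumes "z \<in> C" "x \<in> frontier P" "side s z x = 0"
  shows "x \<in> closure C"
proof -
  have "z + t *\<^sub>R (x - z) \<in> closure C" if "0 \<le> t" "t < 1" for t
  proof -
    have "z + t *\<^sub>R (x - z) \<in> C"
      using saturated_C[OF assms(1) segment_in_P] assms C_subset that
      by (auto simp: frontier_iff side_affine)
    then show ?thesis using closure_subset by blast
  qed
  then have "\<forall>\<^sub>F t in at_left 1. z + t *\<^sub>R (x - z) \<in> closure C"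
    unfolding eventually_at_left_field by (auto intro!: exI[of _ 0])
  moreover have "((\<lambda>t. z + t *\<^sub>R (x - z)) \<longlongrightarrow> z + 1 *\<^sub>R (x - z)) (at_left 1)"
    by (intro tendsto_intros)
  ultimately show ?thesis
    using Lim_in_closed_set[of "closure C" _ "at_left (1::real)"] by fastforce
qed

lemma ends_subset: "ends \<union> ends' \<subseteq> frontier C \<inter> frontier P"
  unfolding frontier_C_Int
  using chord_end_in_closure chord_end_frontier char_foliation.chord_end_frontier[OF reverse]
    C_subset(2) by auto

lemma char_boundary_eq:
  "char_boundary P s C = (frontier C \<inter> frontier P) - (ends \<union> ends')"
proof -
  have "(\<forall>z\<in>C. x \<notin> char_line s z) \<longleftrightarrow> x \<notin> ends \<union> ends'" if "x \<in> frontier P" for x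
    using frontier_on_chord_line[of _ x] that mem_char_line C_subset(2) by fastforce
  then show ?thesis unfolding char_boundary_def by blast
qed

lemma char_line_meets_ends:
  assumes "z \<in> C"
  shows "char_line s z \<inter> ends \<noteq> {}" "char_line s z \<inter> ends' \<noteq> {}"
  using mem_char_line[of z] assms C_subset(2) side_chord_end[of z] side_chord_end_uminus[of z] by blast+

text \<open>A disc in \<open>C\<close> contains points at different distances from any given line.
  This excludes that a least and a greatest chord coincide.\<close>

lemma not_single_chord:
  assumes "z \<in> P"
  obtains w where "w \<in> C" "side s z w \<noteq> 0"
proof -
  obtain y e where y: "e > 0" "ball y e \<subseteq> C"
    using interior_C by (meson all_not_in_conv mem_interior)
  have "y + (e / 2) *\<^sub>R s z \<in> ball y e" using y unit[OF assms] by (simp add: dist_norm)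
  then have "y \<in> C" "y + (e / 2) *\<^sub>R s z \<in> C" using y by auto
  moreover have "side s z (y + (e / 2) *\<^sub>R s z) = side s z y + e / 2"
    using assms by (simp add: side_def inner_add_left inner_diff_left)
  ultimately show ?thesis using that y by (cases "side s z y = 0") auto
qed

text \<open>Every chord of \<open>C\<close> crosses the segment from \<open>m\<close> to
  \<open>k\<close> inside \<open>P\<close>, so the signed distance to the line through these points
  is positive at one endpoint and negative at the other. The point \<open>k\<close> will lie on the
  greatest chord or in the characteristic boundary.\<close>

lemma components_ends:
  assumes m: "m \<in> P" "k \<in> closure P"
    and "\<And>z. z \<in> C \<Longrightarrow> side s z m \<le> 0" "\<And>z. z \<in> C \<Longrightarrow> 0 \<le> side s z k"
    and "\<And>z. z \<in> C \<Longrightarrow> side s z m < side s z k"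
    and "\<And>z. z \<in> C \<Longrightarrow> k \<in> P \<or> 0 < side s z k"
  shows "components (ends \<union> ends') = {ends, ends'}" "ends \<noteq> ends'"
proof -
  let ?g = "\<lambda>x. (x - m) \<bullet> perp (k - m)"
  have pos: "?g x > 0" if "x \<in> ends" for x
    using that chord_ends_separated(1)[OF _ m] assms C_subset(2) by auto
  have neg: "?g x < 0" if "x \<in> ends'" for x
    using that chord_ends_separated(2)[OF _ m] assms C_subset(2) by auto
  have cont: "continuous_on (ends \<union> ends') ?g" by (intro continuous_intros)
  have ne: "ends \<noteq> {}" "ends' \<noteq> {}" using C_nonempty by auto
  show "components (ends \<union> ends') = {ends, ends'}" "ends \<noteq> ends'"
    by (rule components_Un_separated[OF connected_ends ne cont pos neg]; assumption)+
qed

text \<open>A boundary point \<open>x\<close> is weakly above \<open>m\<close> and weakly below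
  \<open>M\<close>. As \<open>side s z x\<close> is continuous in \<open>z\<close> on the connected
  set \<open>C\<close>, it vanishes for some \<open>z\<close>, so \<open>x\<close> is a chord end.
  The boundary then has two components, and the connected case is vacuous.\<close>

lemma structure_two_sided:
  assumes m: "m \<in> C" "\<And>z. z \<in> C \<Longrightarrow> side s m z \<ge> 0"
    and M: "M \<in> C" "\<And>z. z \<in> C \<Longrightarrow> side s M z \<le> 0"
  shows "char_boundary_structure P s C"
proof -
  let ?B = "frontier C \<inter> frontier P"
  have mP: "m \<in> P" "M \<in> P" using m M C_subset by auto
  have zm: "side s z m \<le> 0" and zM: "side s z M \<ge> 0" if "z \<in> C" for z
    using that m M side_antisym'[of m z] side_antisym'[of z M] mP C_subset(2) by auto
  have lt: "side s z m < side s z M" if z: "z \<in> C" for z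
  proof (rule ccontr)
    assume "\<not> ?thesis"
    then have 0: "side s z m = 0" "side s z M = 0" using zm[OF z] zM[OF z] by auto
    have zP: "z \<in> P" using z C_subset by auto
    have "side s z w = 0" if "w \<in> C" for w
      using m(2)[OF that] M(2)[OF that] side_eq_0_same(2)[OF zP mP(1) 0(1)]
        side_eq_0_same(2)[OF zP mP(2) 0(2)] by simp
    then show False using not_single_chord[OF zP] by metis
  qed
  have comps: "components (ends \<union> ends') = {ends, ends'}" "ends \<noteq> ends'"
    using components_ends[OF mP(1) _ zm zM lt] mP closure_subset[of P] by auto
  have "?B \<subseteq> ends \<union> ends'"
  proof
    fix x assume x: "x \<in> ?B"
    then have xC: "x \<in> closure C" and xF: "x \<in> frontier P" by (auto simp: frontier_C_Int)
    have "closure C \<subseteq> {x. side s m x \<ge> 0} \<inter> {x. side s M x \<le> 0}"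
      by (rule closure_minimal)
        (use m M in \<open>auto intro!: closed_Int closed_Collect_le continuous_intros\<close>)
    then have mx: "side s m x \<ge> 0" "side s M x \<le> 0" using xC by auto
    have "\<exists>z\<in>C. side s z x = 0"
    proof (rule ccontr)
      assume *: "\<not> ?thesis"
      then have "side s m x > 0" using mx m by force
      then have "side s M x > 0"
        using connected_real_image_sign[OF connected_C cont_left _ m(1) M(1)] * by blast
      with mx show False by simp
    qed
    then show "x \<in> ends \<union> ends'" using frontier_on_chord_line[OF _ xF] C_subset(2) by blast
  qed
  then have B: "?B = ends \<union> ends'" using ends_subset by auto
  have "\<not> connected ?B"
  proof
    assume "connected ?B"
    then have "components ?B = {?B}"
      using C_nonempty B components_eq_sing_iff[of ?B] by auto
    with comps B show False by (metis doubleton_eq_iff insert_absorb2)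
  qed
  then show ?thesis
    unfolding char_boundary_structure_def char_boundary_eq
    using B comps char_line_meets_ends by auto
qed

text \<open>By \<open>up\<close> the component is the whole part of \<open>P\<close> weakly above
  \<open>m\<close>. Its boundary consists of the two endpoint curves and the set \<open>K\<close>,
  to which both curves accumulate; removing \<open>K\<close> separates them.\<close>

lemma structure_one_sided:
  assumes m: "m \<in> C" "\<And>z. z \<in> C \<Longrightarrow> side s m z \<ge> 0"
    and up: "\<And>a y. a \<in> C \<Longrightarrow> y \<in> P \<Longrightarrow> side s a y \<ge> 0 \<Longrightarrow> y \<in> C"
  shows "char_boundary_structure P s C"
proof -
  let ?B = "frontier C \<inter> frontier P"
  \<comment> \<open>Only weak inequalities enter, so \<open>K\<close> is an intersection of compact
    convex caps; strictness is recovered in \<open>K_gt\<close>.\<close>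
  define K where "K = (\<Inter>z\<in>C. {x \<in> closure P. side s z x \<ge> 0})"
  have mP: "m \<in> P" using m C_subset by auto
  have zm: "side s z m \<le> 0" if "z \<in> C" for z
    using that m side_antisym'[of m z] mP C_subset(2) by auto
  have closedK: "closed {x \<in> closure P. side s z x \<ge> 0}" for z
    by (intro closed_Collect_conj closed_Collect_le continuous_intros) auto
  have compact_cl: "compact (closure P)" using bounded_P by (simp add: compact_closure)
  have convex_cap: "convex {x \<in> closure P. side s z x \<ge> 0}" for z
  proof -
    have "{x \<in> closure P. side s z x \<ge> 0} = closure P \<inter> {x. s z \<bullet> x \<ge> s z \<bullet> z}"
      by (auto simp: side_def inner_diff_left inner_commute[of "s z"])
    then show ?thesis using convex_P by (simp add: convex_Int convex_closure convex_halfspace_ge)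
  qed
  have "closed K" unfolding K_def using closedK by (intro closed_INT) auto
  moreover have "K \<subseteq> closure P" using m by (auto simp: K_def)
  ultimately have compactK: "compact K"
    using compact_cl by (metis compact_Int_closed inf.absorb2)
  have convexK: "convex K" unfolding K_def using convex_cap by (intro convex_INT) auto
  have K_ge: "side s z x \<ge> 0" if "x \<in> K" "z \<in> C" for x z using that by (auto simp: K_def)
  have K_cl: "x \<in> closure P" if "x \<in> K" for x using that m by (auto simp: K_def)
  \<comment> \<open>There is no greatest chord: a small step along \<open>s z\<close> stays in
    \<open>P\<close>, hence in \<open>C\<close> by \<open>up\<close>.\<close>
  have above: "\<exists>w\<in>C. side s z w > 0" if z: "z \<in> C" for z
  proof -
    have zP: "z \<in> P" using z C_subset by auto
    obtain e where e: "e > 0" "\<And>t. \<bar>t\<bar> < e \<Longrightarrow> z + t *\<^sub>R s z \<in> P"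
      using move_along_s[OF zP] by blast
    have "side s z (z + (e / 2) *\<^sub>R s z) = e / 2" using zP by (simp add: side_def)
    then show ?thesis
      using up[OF z e(2)[of "e / 2"]] e(1) by (intro bexI[of _ "z + (e / 2) *\<^sub>R s z"]) auto
  qed
  have K_notP: "x \<notin> P" if x: "x \<in> K" for x
  proof
    assume xP: "x \<in> P"
    then have xC: "x \<in> C" using up[OF m(1)] K_ge[OF x m(1)] by auto
    then obtain w where w: "w \<in> C" "side s x w > 0" using above by blast
    then show False using K_ge[OF x w(1)] side_antisym[of x w] xP C_subset(2) by auto
  qed
  have K_front: "K \<subseteq> frontier P" using K_notP K_cl frontier_iff by auto
  \<comment> \<open>Suppose the line of \<open>z\<close> reaches \<open>x\<close>. For every
    \<open>w\<close> above \<open>z\<close>, transitivity puts \<open>x\<close> weakly below the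
    line of \<open>w\<close> and membership in \<open>K\<close> puts it weakly above, so that line
    passes through \<open>x\<close> too. These points form an open set contained in the fan with
    apex \<open>x\<close>, yet they belong to \<open>C\<close>.\<close>
  have K_gt: "side s z x > 0" if x: "x \<in> K" and z: "z \<in> C" for x z
  proof (rule ccontr)
    assume "\<not> side s z x > 0"
    then have zx: "side s z x = 0" using K_ge[OF x z] by simp
    have zP: "z \<in> P" using z C_subset by auto
    let ?U = "{w \<in> P. side s z w > 0}"
    have U0: "w \<in> C \<and> side s w x = 0" if w: "w \<in> ?U" for w
    proof
      show wC: "w \<in> C" using up[OF z] w by auto
      have "side s w x \<le> 0"
        using side_trans_closure'[of w z x] w zP K_cl[OF x] zx side_antisym[of z w] by auto
      then show "side s w x = 0" using K_ge[OF x wC] by simp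
    qed
    have "open ?U"
      using open_P by (intro open_Collect_conj open_Collect_less continuous_intros) auto
    moreover have "?U \<subseteq> {w \<in> P. x \<in> char_line s w}" using U0 mem_char_line by auto
    ultimately have U: "?U \<subseteq> boundary_fan P s x"
      unfolding boundary_fan_def by (rule interior_maximal[rotated])
    obtain w where w: "w \<in> ?U" using above[OF z] C_subset(2) by auto
    \<comment> \<open>A second common point would make the lines parallel and thus equal, although
      \<open>w\<close> is strictly above the line of \<open>z\<close>.\<close>
    have "char_line s z \<inter> char_line s w = {x}"
    proof (intro equalityI subsetI)
      fix y assume "y \<in> char_line s z \<inter> char_line s w"
      then have y: "side s z y = 0" "side s w y = 0" using mem_char_line zP w by auto
      show "y \<in> {x}"
      proof (rule ccontr)
        assume "y \<notin> {x}"
        then have ne: "perp (y - x) \<noteq> 0" by (metis norm_eq_zero norm_perp right_minus_eq singletonI)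
        have yx: "(y - x) \<bullet> s z = 0" "(y - x) \<bullet> s w = 0"
          using y zx U0[OF w] by (auto simp: side_def inner_diff_left)
        have dec: "y - x = ((y - x) \<bullet> perp (s z)) *\<^sub>R perp (s z)"
          using unit_frame_decomposition[OF unit[OF zP], of "y - x"] yx by simp
        have "perp (s z) \<bullet> s w = 0"
          using yx(2) ne dec by (metis inner_scaleR_left mult_eq_0_iff perp_minus norm_eq_zero norm_perp scaleR_zero_left)
        then have "s w = (s w \<bullet> s z) *\<^sub>R s z"
          using unit_frame_decomposition[OF unit[OF zP], of "s w"] by (simp add: inner_commute)
        then have "side s w x = (s w \<bullet> s z) * ((x - w) \<bullet> s z)"
          unfolding side_def by (metis inner_scaleR_right)
        moreover have "s w \<bullet> s z \<noteq> 0" using \<open>s w = _\<close> s_nonzero w by force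
        ultimately have "(x - w) \<bullet> s z = 0" using U0[OF w] by simp
        then show False using zx w by (simp add: side_def inner_diff_left)
      qed
    qed (use zx U0[OF w] mem_char_line zP w in auto)
    moreover have "z \<noteq> w" using w by auto
    ultimately have "x \<in> fan_apexes P s"
      using K_front x zP w unfolding fan_apexes_def by blast
    then have "w \<notin> fan_complement P s" using U w by (auto simp: fan_complement_def)
    then show False using U0[OF w] C_subset(1) by auto
  qed
  \<comment> \<open>Totality and transitivity of the order give finitely many chords a common upper
    bound in \<open>C\<close>, which supplies the finite intersection property for
    \<open>K\<close>.\<close>
  have max: "\<exists>w\<in>C. \<forall>z\<in>Z. side s z w \<ge> 0" if "finite Z" "Z \<subseteq> C" for Z
    using that
  proof induction
    case empty
    then show ?case using m by auto
  next
    case (insert a Z)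
    then obtain w where w: "w \<in> C" "\<forall>z\<in>Z. side s z w \<ge> 0" by auto
    show ?case
    proof (cases "side s a w \<ge> 0")
      case True
      then show ?thesis using w by auto
    next
      case False
      then have wa: "side s w a \<ge> 0" using side_antisym'[of w a] w insert C_subset(2) by auto
      have "side s z a \<ge> 0" if "z \<in> Z" for z
        using side_trans[of z w a] wa w that insert C_subset(2) by blast
      then show ?thesis using insert by (intro bexI[of _ a]) auto
    qed
  qed
  have "closure P \<inter> K \<noteq> {}"
    unfolding K_def
  proof (rule compact_imp_fip_image[OF compact_cl])
    fix Z assume Z: "finite Z" "Z \<subseteq> C"
    obtain w where "w \<in> C" "\<forall>z\<in>Z. side s z w \<ge> 0" using max[OF Z] by blast
    then have "w \<in> closure P \<inter> (\<Inter>z\<in>Z. {x \<in> closure P. side s z x \<ge> 0})"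
      using C_subset(2) closure_subset[of P] by auto
    then show "closure P \<inter> (\<Inter>z\<in>Z. {x \<in> closure P. side s z x \<ge> 0}) \<noteq> {}" by blast
  qed (use closedK in auto)
  then obtain k where k: "k \<in> K" by blast
  have lt: "side s z m < side s z k" if "z \<in> C" for z
    using zm[OF that] K_gt[OF k that] by linarith
  have comps: "components (ends \<union> ends') = {ends, ends'}" "ends \<noteq> ends'"
    by (rule components_ends[OF mP K_cl[OF k] zm K_ge[OF k] lt disjI2[OF K_gt[OF k]]]; assumption)+
  \<comment> \<open>A frontier point weakly above \<open>m\<close> is the limit of points on the
    segment from \<open>m\<close>, which lie in \<open>C\<close> by \<open>up\<close>.\<close>
  have B_iff: "x \<in> ?B \<longleftrightarrow> x \<in> frontier P \<and> side s m x \<ge> 0" for x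
  proof
    assume "x \<in> ?B"
    moreover have "closure C \<subseteq> {x. side s m x \<ge> 0}"
      by (rule closure_minimal) (use m in \<open>auto intro!: closed_Collect_le continuous_intros\<close>)
    ultimately show "x \<in> frontier P \<and> side s m x \<ge> 0" by (auto simp: frontier_C_Int)
  next
    assume x: "x \<in> frontier P \<and> side s m x \<ge> 0"
    have "m + t *\<^sub>R (x - m) \<in> closure C" if "0 \<le> t" "t < 1" for t
    proof -
      have "m + t *\<^sub>R (x - m) \<in> C"
        by (rule up[OF m(1) segment_in_P]) (use x that mP in \<open>auto simp: side_affine frontier_iff\<close>)
      then show ?thesis using closure_subset by blast
    qed
    then have "\<forall>\<^sub>F t in at_left 1. m + t *\<^sub>R (x - m) \<in> closure C"
      unfolding eventually_at_left_field by (auto intro!: exI[of _ 0])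
    moreover have "((\<lambda>t. m + t *\<^sub>R (x - m)) \<longlongrightarrow> m + 1 *\<^sub>R (x - m)) (at_left 1)"
      by (intro tendsto_intros)
    ultimately have "x \<in> closure C"
      using Lim_in_closed_set[of "closure C" _ "at_left (1::real)"] by fastforce
    then show "x \<in> ?B" using x by (simp add: frontier_C_Int)
  qed
  have K_B: "K \<subseteq> ?B" using B_iff K_front K_ge m by blast
  have K_ends: "K \<inter> (ends \<union> ends') = {}"
  proof -
    have "\<exists>z\<in>C. side s z x = 0" if "x \<in> ends \<union> ends'" for x
      using that side_chord_end side_chord_end_uminus by blast
    then show ?thesis using K_gt by (metis disjoint_iff less_irrefl)
  qed
  have "?B \<subseteq> K \<union> (ends \<union> ends')"
  proof
    fix x assume x: "x \<in> ?B"
    then have xF: "x \<in> frontier P" by auto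
    show "x \<in> K \<union> (ends \<union> ends')"
    proof (cases "\<exists>z\<in>C. side s z x = 0")
      case True
      then show ?thesis using frontier_on_chord_line[OF _ xF] C_subset(2) by blast
    next
      case False
      \<comment> \<open>A point on no chord line of \<open>C\<close> keeps the sign it has relative
        to \<open>m\<close>, so it lies beyond every chord.\<close>
      have "side s m x \<ge> 0" "side s m x \<noteq> 0" using x B_iff False m by auto
      then have "side s z x > 0" if "z \<in> C" for z
        using connected_real_image_sign[OF connected_C cont_left _ m(1) that] False by force
      then have "x \<in> K" using xF by (auto simp: K_def frontier_iff less_imp_le)
      then show ?thesis by simp
    qed
  qed
  then have B: "?B = K \<union> (ends \<union> ends')" using K_B ends_subset by auto
  have K_eq: "char_boundary P s C = K" unfolding char_boundary_eq B using K_ends by auto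
  have B_diff: "?B - K = ends \<union> ends'" using B K_ends by auto
  have K_shape: "(\<exists>a. K = {a}) \<or> (\<exists>a b. a \<noteq> b \<and> K = closed_segment a b)"
  proof -
    \<comment> \<open>An open subset of \<open>closure P\<close> that misses \<open>P\<close> is
      empty. A planar convex set without interior lies in a line, and a compact one is then a
      segment or a point.\<close>
    have "interior K = {}"
      using open_Int_closure_eq_empty[OF open_interior, of K P] interior_subset[of K] K_cl K_notP by blast
    then obtain a b where ab: "a \<noteq> 0" "K \<subseteq> {x. a \<bullet> x = b}"
      using empty_interior_subset_hyperplane[OF convexK] by metis
    have na: "norm (a /\<^sub>R norm a) = 1" using ab by simp
    have "collinear K"
      unfolding collinear_def
    proof (intro exI[of _ "perp (a /\<^sub>R norm a)"] ballI)
      fix x y assume "x \<in> K" "y \<in> K"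
      then have "a \<bullet> x = b" "a \<bullet> y = b" using ab by auto
      then have "a \<bullet> (x - y) = 0" by (simp add: inner_diff_right)
      then have "(x - y) \<bullet> (a /\<^sub>R norm a) = 0" by (simp add: inner_commute)
      then show "\<exists>c. x - y = c *\<^sub>R perp (a /\<^sub>R norm a)"
        using unit_frame_decomposition[OF na, of "x - y"] by auto
    qed
    then obtain a b where "K = closed_segment a b"
      using compact_convex_collinear_segment[OF _ compactK convexK] k by blast
    then show ?thesis by (cases "a = b") auto
  qed
  \<comment> \<open>The chords are followed through points running from \<open>m\<close> to
    \<open>k\<close>. Since \<open>k\<close> is strictly beyond every chord, these chords eventually
    pass any given one, and every accumulation point of their endpoints lies in \<open>K\<close>.
    The map \<open>f\<close> stands for either endpoint.\<close>
  have limit: "\<exists>x\<in>K. x \<in> closure (f ` C)"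
    if f: "\<And>z. z \<in> C \<Longrightarrow> f z \<in> frontier P" "\<And>z. side s z (f z) = 0" for f
  proof -
    define z where "z n = m + (1 - 1 / real (Suc n)) *\<^sub>R (k - m)" for n
    have side_z: "side s w (z n) = (1 / real (Suc n)) * side s w m + (1 - 1 / real (Suc n)) * side s w k" for w n
      unfolding z_def by (simp add: side_affine)
    have zC: "z n \<in> C" for n
      unfolding z_def
      by (rule up[OF m(1) segment_in_P]) (use mP K_cl[OF k] K_ge[OF k m(1)] in \<open>auto simp: side_affine\<close>)
    have "compact (frontier P)" using bounded_P by (simp add: compact_frontier_bounded)
    then obtain x r where x: "x \<in> frontier P" "strict_mono r" "(\<lambda>n. f (z (r n))) \<longlonglongrightarrow> x"
      unfolding compact_def using f zC by (metis (no_types, lifting) comp_apply ext)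
    have "side s w x \<ge> 0" if w: "w \<in> C" for w
    proof -
      have "(\<lambda>n. side s w (z n)) \<longlonglongrightarrow> 0 * side s w m + (1 - 0) * side s w k"
        unfolding side_z by (intro tendsto_intros LIMSEQ_Suc[OF lim_1_over_n])
      then have "\<forall>\<^sub>F n in sequentially. side s w (z n) > 0"
        using K_gt[OF k w] by (intro order_tendstoD) auto
      then have "\<forall>\<^sub>F n in sequentially. side s w (z (r n)) > 0"
        using eventually_subseq[OF x(2), of "\<lambda>n. side s w (z n) > 0"] by simp
      then have "\<forall>\<^sub>F n in sequentially. side s w (f (z (r n))) \<ge> 0"
      proof eventually_elim
        case (elim n)
        then show ?case
          using side_trans_closure[of w "z (r n)" "f (z (r n))"] f zC[of "r n"] w C_subset(2)
          by (auto simp: frontier_iff)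
      qed
      moreover have "(\<lambda>n. side s w (f (z (r n)))) \<longlonglongrightarrow> side s w x"
        unfolding side_def by (intro tendsto_intros x)
      ultimately show ?thesis using tendsto_lowerbound[of _ _ sequentially 0] by simp
    qed
    then have "x \<in> K" using x by (auto simp: K_def frontier_iff)
    moreover have "x \<in> closure (f ` C)"
      unfolding closure_sequential using x(3) zC by (auto intro!: exI[of _ "\<lambda>n. f (z (r n))"])
    ultimately show ?thesis by blast
  qed
  \<comment> \<open>Adding one limit point keeps \<open>E\<close> connected, and that point joins it
    to the convex set \<open>K\<close>.\<close>
  have connect: "connected (K \<union> E)" if E: "connected E" "\<exists>x\<in>K. x \<in> closure E" for E
  proof -
    obtain x where x: "x \<in> K" "x \<in> closure E" using E by blast
    have xE: "connected (insert x E)"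
      by (rule connected_intermediate_closure[OF E(1)]) (use x closure_subset[of E] in auto)
    have "connected (K \<union> insert x E)"
      by (rule connected_Un[OF convex_connected[OF convexK] xE]) (use x in auto)
    then show ?thesis using x by (simp add: insert_absorb)
  qed
  have "connected (K \<union> ends)"
    by (rule connect[OF connected_ends(1) limit]) (use chord_end_frontier C_subset(2) in auto)
  moreover have "connected (K \<union> ends')"
    by (rule connect[OF connected_ends(2) limit])
      (use char_foliation.chord_end_frontier[OF reverse] C_subset(2) in auto)
  ultimately have "connected ((K \<union> ends) \<union> (K \<union> ends'))"
    using k by (intro connected_Un[of "K \<union> ends"]) auto
  moreover have "(K \<union> ends) \<union> (K \<union> ends') = ?B" using B by auto
  ultimately have "connected ?B" by simp
  then have "components ?B = {?B}"
    using K_B k components_eq_sing_iff[of ?B] by auto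
  then show ?thesis
    unfolding char_boundary_structure_def K_eq B_diff
    using K_shape K_B comps char_line_meets_ends by auto
qed

text \<open>In each direction either an extreme chord exists or \<open>C\<close> contains everything
  beyond its points. If neither extreme exists, totality of the order gives \<open>C = P\<close>,
  which is excluded.\<close>

lemma structure_of_component:
  assumes "C \<noteq> P"
  shows "char_boundary_structure P s C"
proof -
  have lo: "(\<exists>m\<in>C. \<forall>z\<in>C. side s m z \<ge> 0) \<or> (\<forall>a\<in>C. \<forall>y\<in>P. side s y a \<ge> 0 \<longrightarrow> y \<in> C)"
    using minimum_or_downward_closed by metis
  have "(\<exists>m\<in>C. \<forall>z\<in>C. side (\<lambda>x. - s x) m z \<ge> 0) \<or> (\<forall>a\<in>C. \<forall>y\<in>P. side (\<lambda>x. - s x) y a \<ge> 0 \<longrightarrow> y \<in> C)"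
    using fan_component.minimum_or_downward_closed[OF reverse_component] by metis
  then have hi: "(\<exists>m\<in>C. \<forall>z\<in>C. side s m z \<le> 0) \<or> (\<forall>a\<in>C. \<forall>y\<in>P. side s a y \<ge> 0 \<longrightarrow> y \<in> C)"
    using side_antisym' C_subset(2) by (simp, blast)
  consider (two) "\<exists>m\<in>C. \<forall>z\<in>C. side s m z \<ge> 0" "\<exists>m\<in>C. \<forall>z\<in>C. side s m z \<le> 0"
    | (lower) "\<exists>m\<in>C. \<forall>z\<in>C. side s m z \<ge> 0" "\<forall>a\<in>C. \<forall>y\<in>P. side s a y \<ge> 0 \<longrightarrow> y \<in> C"
    | (upper) "\<exists>m\<in>C. \<forall>z\<in>C. side s m z \<le> 0" "\<forall>a\<in>C. \<forall>y\<in>P. side s y a \<ge> 0 \<longrightarrow> y \<in> C"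
    | (none) "\<forall>a\<in>C. \<forall>y\<in>P. side s y a \<ge> 0 \<longrightarrow> y \<in> C" "\<forall>a\<in>C. \<forall>y\<in>P. side s a y \<ge> 0 \<longrightarrow> y \<in> C"
    using lo hi by blast
  then show ?thesis
  proof cases
    case two
    then show ?thesis using structure_two_sided by blast
  next
    case lower
    then show ?thesis using structure_one_sided by blast
  next
    case upper
    then obtain M where M: "M \<in> C" "\<forall>z\<in>C. side s M z \<le> 0" by blast
    have up: "y \<in> C" if "a \<in> C" "y \<in> P" "0 \<le> side (\<lambda>x. - s x) a y" for a y
      using upper(2) that side_antisym'[of y a] C_subset(2) by auto
    have "char_boundary_structure P (\<lambda>x. - s x) C"
      by (rule fan_component.structure_one_sided[OF reverse_component M(1) _ up]) (use M(2) in auto)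
    then show ?thesis by (simp add: char_boundary_structure_uminus)
  next
    case none
    obtain a where a: "a \<in> C" using C_nonempty by blast
    have "y \<in> C" if y: "y \<in> P" for y
    proof -
      have "0 \<le> side s a y \<or> 0 \<le> side s y a"
        using side_antisym'[of y a] a y C_subset(2) by fastforce
      then show ?thesis using none a y by blast
    qed
    then show ?thesis using C_subset(2) assms by blast
  qed
qed

end

subsection \<open>The characteristic foliation of the stress\<close>

lemma test_function_mono: "test_function S \<phi> \<Longrightarrow> S \<subseteq> T \<Longrightarrow> test_function T \<phi>"
  unfolding test_function_def by blast

text \<open>The exceptional set is open by continuity, and an open null set is empty.\<close>

lemma unit_of_AE_unit:
  fixes s :: "real^2 \<Rightarrow> real^2"
  assumes P: "open P" and cont: "continuous_on P s" and ae: "AE x in lebesgue_on P. norm (s x) = 1"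
    and x: "x \<in> P"
  shows "norm (s x) = 1"
proof (rule ccontr)
  assume n: "norm (s x) \<noteq> 1"
  let ?U = "P \<inter> s -` {z. norm z \<noteq> 1}"
  have "open {z :: real^2. norm z \<noteq> 1}" by (intro open_Collect_neq continuous_intros)
  then have U: "open ?U" using continuous_open_preimage[OF cont P] by blast
  have "P \<in> sets lebesgue" using P by auto
  then have "AE x in lebesgue. x \<in> P \<longrightarrow> norm (s x) = 1"
    using ae by (simp add: AE_restrict_space_iff)
  then have "AE x in lebesgue. x \<notin> ?U" by (rule AE_mp) auto
  then have "?U \<in> null_sets lebesgue" using U by (subst AE_iff_null_sets) auto
  then have "negligible ?U" by (simp add: negligible_iff_null_sets)
  then show False using open_not_negligible[OF U] n x by blast
qed

text \<open>The gradient of \<phi> vanishes outside a subset of \<open>P\<close>, so enlarging the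
  domain adds nothing, and inside \<open>P\<close> the two fields agree almost everywhere.\<close>

lemma divergence_free_restrict:
  fixes s \<sigma> :: "real^2 \<Rightarrow> real^2"
  assumes "P \<subseteq> \<Omega>" and P: "P \<in> sets lebesgue" and \<Omega>: "\<Omega> \<in> sets lebesgue"
    and ae: "AE x in lebesgue_on P. s x = \<sigma> x" and \<sigma>: "\<sigma> \<in> borel_measurable (lebesgue_on \<Omega>)"
    and s: "s \<in> borel_measurable (lebesgue_on P)"
    and \<phi>: "test_function P \<phi>"
  shows "(LINT x|lebesgue_on P. s x \<bullet> gradient \<phi> x) = (LINT x|lebesgue_on \<Omega>. \<sigma> x \<bullet> gradient \<phi> x)"
proof -
  obtain K where K: "K \<subseteq> P" "\<And>x. x \<notin> K \<Longrightarrow> gradient \<phi> x = 0"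
    by (rule test_function_support[OF \<phi>]) (rule that)
  have g: "gradient \<phi> \<in> borel_measurable (lebesgue_on P)"
    by (rule compactly_supported_measurable[OF test_functionD(2)[OF \<phi>] P])
  have \<sigma>P: "\<sigma> \<in> borel_measurable (lebesgue_on P)"
    using measurable_restrict_mono[OF \<sigma> \<open>P \<subseteq> \<Omega>\<close>] .
  have "(LINT x|lebesgue_on P. s x \<bullet> gradient \<phi> x) = (LINT x|lebesgue_on P. \<sigma> x \<bullet> gradient \<phi> x)"
  proof (rule integral_cong_AE)
    show "AE x in lebesgue_on P. s x \<bullet> gradient \<phi> x = \<sigma> x \<bullet> gradient \<phi> x"
      using ae by (rule AE_mp) auto
  qed (use s \<sigma>P g in measurable)
  also have "\<dots> = (LINT x|lebesgue. indicator P x *\<^sub>R (\<sigma> x \<bullet> gradient \<phi> x))"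
    using P by (intro integral_restrict_space) auto
  also have "(\<lambda>x. indicator P x *\<^sub>R (\<sigma> x \<bullet> gradient \<phi> x)) = (\<lambda>x. indicator \<Omega> x *\<^sub>R (\<sigma> x \<bullet> gradient \<phi> x))"
  proof
    fix x show "indicator P x *\<^sub>R (\<sigma> x \<bullet> gradient \<phi> x) = indicator \<Omega> x *\<^sub>R (\<sigma> x \<bullet> gradient \<phi> x)"
      using K(1) K(2)[of x] \<open>P \<subseteq> \<Omega>\<close> by (cases "x \<in> K") (auto simp: indicator_def)
  qed
  also have "(LINT x|lebesgue. indicator \<Omega> x *\<^sub>R (\<sigma> x \<bullet> gradient \<phi> x)) = (LINT x|lebesgue_on \<Omega>. \<sigma> x \<bullet> gradient \<phi> x)"
    using \<Omega> by (intro integral_restrict_space[symmetric]) auto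
  finally show ?thesis .
qed

text \<open>The local potential has gradient \<open>perp (s x)\<close>, of length one, so its
  gradient lines are exactly the characteristic lines. Local constancy along them spreads over the
  whole chord.\<close>

lemma char_foliation_of_divergence_free:
  fixes s :: "real^2 \<Rightarrow> real^2"
  assumes P: "open P" "convex P" "bounded P" and cont: "continuous_on P s"
    and unit: "\<And>x. x \<in> P \<Longrightarrow> norm (s x) = 1"
    and div: "\<And>\<phi>. test_function P \<phi> \<Longrightarrow> (LINT x|lebesgue_on P. s x \<bullet> gradient \<phi> x) = 0"
  shows "char_foliation P s"
proof
  fix x y assume x: "x \<in> P" and y: "y \<in> P" "y \<in> char_line s x"
  have loc: "\<exists>d>0. \<forall>t. \<bar>t\<bar> < d \<longrightarrow> s (x + t *\<^sub>R perp (s x)) = s x" if x: "x \<in> P" for x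
  proof -
    obtain r \<psi> where r: "r > 0" and sub: "ball x r \<subseteq> P"
      and der: "\<And>y. y \<in> ball x r \<Longrightarrow> (\<psi> has_derivative (\<lambda>h. perp (s y) \<bullet> h)) (at y)"
      by (rule divergence_free_potential[OF P(1) cont div x]) (assumption, rule that)
    have "perp (s (x + t *\<^sub>R perp (s x))) = perp (s x)" if t: "\<bar>t\<bar> < r" for t
    proof (rule eikonal_local_const[OF der _ _ t])
      show "norm (perp (s y)) = 1" if "y \<in> ball x r" for y using that sub unit by auto
      show "continuous_on (ball x r) (\<lambda>y. perp (s y))"
        by (intro continuous_on_perp continuous_on_subset[OF cont sub])
    qed
    then have "s (x + t *\<^sub>R perp (s x)) = s x" if "\<bar>t\<bar> < r" for t
      using that by simp
    then show ?thesis using r by blast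
  qed
  obtain t where "y = x + t *\<^sub>R perp (s x)" using y by (auto simp: char_line_def)
  then show "s y = s x" using const_on_segment[OF P(2) x _ cont loc, of t] y by blast
qed (use P cont unit in auto)

theorem theorem6p11:
  fixes \<Omega> \<Omega>\<^sub>p C :: "(real^2) set"
    and \<nu> \<sigma> s :: "real^2 \<Rightarrow> real^2"
    and w u :: "real^2 \<Rightarrow> real"
    and p :: "(real^2) set \<Rightarrow> real^2"
  assumes "open \<Omega>" "bounded \<Omega>" "lipschitz_boundary \<Omega>" "outer_unit_normal \<Omega> \<nu>"
    and "H1_space \<Omega> w"
    and "minimizer \<Omega> \<nu> w u \<sigma> p"
    and "\<Omega>\<^sub>p \<subseteq> \<Omega>" "\<Omega>\<^sub>p \<noteq> {}" "convex \<Omega>\<^sub>p" "open \<Omega>\<^sub>p"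
    and "AE x in lebesgue_on \<Omega>\<^sub>p. norm (\<sigma> x) = 1"
    and "\<forall>x\<in>\<Omega>\<^sub>p. \<exists>r>0. \<exists>L. L-lipschitz_on (ball x r \<inter> \<Omega>\<^sub>p) s"
    and "AE x in lebesgue_on \<Omega>\<^sub>p. s x = \<sigma> x"
    and "C \<in> components (fan_complement \<Omega>\<^sub>p s)"
    and "interior C \<noteq> {}" "C \<noteq> \<Omega>\<^sub>p"
  shows "finite (components (frontier C \<inter> frontier \<Omega>\<^sub>p)) \<and>
    card (components (frontier C \<inter> frontier \<Omega>\<^sub>p)) \<le> 2 \<and>
    (card (components (frontier C \<inter> frontier \<Omega>\<^sub>p)) = 2 \<longrightarrow>
       char_boundary \<Omega>\<^sub>p s C = {} \<and>
       (\<forall>z\<in>C. char_line s z \<inter> (frontier C \<inter> frontier \<Omega>\<^sub>p) \<noteq> {} \<longrightarrow>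
          (\<forall>D\<in>components (frontier C \<inter> frontier \<Omega>\<^sub>p). char_line s z \<inter> D \<noteq> {}))) \<and>
    (connected (frontier C \<inter> frontier \<Omega>\<^sub>p) \<longrightarrow>
       ((\<exists>a. char_boundary \<Omega>\<^sub>p s C = {a}) \<or>
        (\<exists>a b. a \<noteq> b \<and> char_boundary \<Omega>\<^sub>p s C = closed_segment a b)) \<and>
       char_boundary \<Omega>\<^sub>p s C \<subseteq> frontier C \<inter> frontier \<Omega>\<^sub>p \<and>
       card (components ((frontier C \<inter> frontier \<Omega>\<^sub>p) - char_boundary \<Omega>\<^sub>p s C)) = 2 \<and>
       (\<forall>z\<in>C. char_line s z \<inter> (frontier C \<inter> frontier \<Omega>\<^sub>p) \<noteq> {} \<longrightarrow>
          (\<forall>D\<in>components ((frontier C \<inter> frontier \<Omega>\<^sub>p) - char_boundary \<Omega>\<^sub>p s C).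
             char_line s z \<inter> D \<noteq> {})))"
proof -
  have sets: "\<Omega> \<in> sets lebesgue" "\<Omega>\<^sub>p \<in> sets lebesgue" using assms(1,10) by auto
  have cont: "continuous_on \<Omega>\<^sub>p s"
    unfolding continuous_on_eq_continuous_at[OF assms(10)]
  proof
    fix x assume x: "x \<in> \<Omega>\<^sub>p"
    then obtain r L where r: "r > 0" "L-lipschitz_on (ball x r \<inter> \<Omega>\<^sub>p) s" using assms(12) by blast
    have "continuous_on (ball x r \<inter> \<Omega>\<^sub>p) s" by (rule lipschitz_on_continuous_on[OF r(2)])
    then have "\<forall>y\<in>ball x r \<inter> \<Omega>\<^sub>p. isCont s y"
      by (simp only: continuous_on_eq_continuous_at[OF open_Int[OF open_ball assms(10)]])
    then show "isCont s x" using r(1) x by simp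
  qed
  have "AE x in lebesgue_on \<Omega>\<^sub>p. norm (s x) = 1"
    using assms(11,13) by eventually_elim simp
  then have unit: "norm (s x) = 1" if "x \<in> \<Omega>\<^sub>p" for x
    using unit_of_AE_unit[OF assms(10) cont] that by blast
  have \<sigma>: "\<sigma> \<in> borel_measurable (lebesgue_on \<Omega>)"
    using assms(6) by (simp add: minimizer_def admissible_def square_integrable_on_def)
  have s: "s \<in> borel_measurable (lebesgue_on \<Omega>\<^sub>p)"
    by (rule continuous_imp_measurable_on_sets_lebesgue[OF cont sets(2)])
  have div: "(LINT x|lebesgue_on \<Omega>\<^sub>p. s x \<bullet> gradient \<phi> x) = 0" if \<phi>: "test_function \<Omega>\<^sub>p \<phi>" for \<phi>
    using divergence_free_restrict[OF assms(7) sets(2,1) assms(13) \<sigma> s \<phi>]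
      minimizer_divergence_free[OF assms(1,6) test_function_mono[OF \<phi> assms(7)]] by simp
  have "char_foliation \<Omega>\<^sub>p s"
    by (rule char_foliation_of_divergence_free[OF assms(10,9) bounded_subset[OF assms(2,7)] cont unit div])
  then have "fan_component \<Omega>\<^sub>p s C"
    using assms(14,15) by (simp add: fan_component_def fan_component_axioms_def)
  then have "char_boundary_structure \<Omega>\<^sub>p s C"
    by (rule fan_component.structure_of_component[OF _ assms(16)])
  then show ?thesis
    unfolding char_boundary_structure_def .
qed

end
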